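(* There is an algorithm which, given a prime power $q$, integers $m,n\ge 1$ and a finite subset $\mathcal{S}$ of $\mathrm{GL}(n,\mathbb{F})$, where $\mathbb{F}=\mathbb{F}_q(X_1,\ldots,X_m)$, such that the group $G=\langle\mathcal{S}\rangle$ is finite, returns the order $|G|$ and finds an isomorphic copy of $G$ that is a matrix group of degree $n$ over a finite field.
   Context: $\mathbb{F}_q$ is the finite field of size $q$, and $\mathbb{F}=\mathbb{F}_q(X_1,\ldots,X_m)$ is the field of rational functions in the algebraically independent indeterminates $X_1,\ldots,X_m$. $\langle\mathcal{S}\rangle$ is the subgroup generated by $\mathcal{S}$. *)

theory Defs
  imports
    "HOL-Algebra.Indexed_Polynomials"
    "HOL-Algebra.Elementary_Groups"
    "HOL-Number_Theory.Prime_Powers"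
    "HOL-Library.Nat_Bijection"
    "Jordan_Normal_Form.Matrix"
begin

section \<open>Algorithms: partial recursive functions\<close>

text \<open>An algorithm is a program \<open>A\<close> for a partial recursive function; \<open>computes A xs y\<close>
  says that \<open>A\<close> halts on the argument list \<open>xs\<close> with result \<open>y\<close>.\<close>

datatype recf =
    Zero
  | Succ
  | Proj nat
  | Comp recf "recf list"
  | PrimRec recf recf
  | Mu recf

inductive computes :: "recf \<Rightarrow> nat list \<Rightarrow> nat \<Rightarrow> bool" where
  Zero: "computes Zero xs 0"
| Succ: "computes Succ [x] (Suc x)"
| Proj: "i < length xs \<Longrightarrow> computes (Proj i) xs (xs ! i)"
| Comp: "list_all2 (\<lambda>g y. computes g xs y) gs ys \<Longrightarrow> computes f ys z
    \<Longrightarrow> computes (Comp f gs) xs z"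
| PrimRec_0: "computes f xs y \<Longrightarrow> computes (PrimRec f g) (0 # xs) y"
| PrimRec_Suc: "computes (PrimRec f g) (k # xs) y \<Longrightarrow> computes g (k # y # xs) z
    \<Longrightarrow> computes (PrimRec f g) (Suc k # xs) z"
| Mu: "computes f (k # xs) 0 \<Longrightarrow> \<forall>i<k. \<exists>y. computes f (i # xs) (Suc y)
    \<Longrightarrow> computes (Mu f) xs k"

lemma computes_deterministic:
  "computes A xs y \<Longrightarrow> computes A xs z \<Longrightarrow> y = z"
proof (induction arbitrary: z rule: computes.induct)
  case (Comp xs gs ys f w)
  from Comp.prems obtain ys' where
    ys': "list_all2 (\<lambda>g y. computes g xs y) gs ys'" "computes f ys' z"
    by (cases rule: computes.cases) auto
  have "ys = ys'"
    using Comp.IH(1) ys'(1)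
    by (auto simp: list_all2_conv_all_nth intro: nth_equalityI)
  with ys'(2) Comp.IH(2) show ?case by simp
next
  case (PrimRec_0 f xs y g)
  from PrimRec_0.prems show ?case
    by (cases rule: computes.cases) (use PrimRec_0.IH in auto)
next
  case (PrimRec_Suc f g k xs y w)
  from PrimRec_Suc.prems show ?case
    by (cases rule: computes.cases) (use PrimRec_Suc.IH in auto)
next
  case (Mu f k xs)
  from Mu.prems have z: "computes f (z # xs) 0" "\<forall>i<z. \<exists>y. computes f (i # xs) (Suc y)"
    by (auto elim: computes.cases)
  show ?case
  proof (rule linorder_cases[of k z])
    assume "k < z"
    with z(2) Mu.IH(1) show ?thesis by fastforce
  next
    assume "z < k"
    with z(1) Mu.IH(2) show ?thesis by fastforce
  qed
qed (auto elim: computes.cases)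

section \<open>Rational functions in several variables\<close>

text \<open>As in \<^theory>\<open>HOL-Algebra.Indexed_Polynomials\<close>, a polynomial is its coefficient function,
  where a monomial is the multiset of its variables.  The variables are \<open>0, \<dots>, m - 1\<close>.\<close>

definition mpoly_ring :: "('a, 'b) ring_scheme \<Rightarrow> nat \<Rightarrow> (nat multiset \<Rightarrow> 'a) ring" where
  "mpoly_ring R m =
    \<lparr>carrier = ring.indexed_pset R {..<m} (carrier R),
     monoid.mult = (\<lambda>P Q M. \<Oplus>\<^bsub>R\<^esub>A\<in>{A. A \<subseteq># M}. P A \<otimes>\<^bsub>R\<^esub> Q (M - A)),
     one = ring.indexed_const R \<one>\<^bsub>R\<^esub>,
     zero = ring.indexed_const R \<zero>\<^bsub>R\<^esub>,
     add = ring.indexed_padd R\<rparr>"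

definition frac_rel :: "('a, 'b) ring_scheme \<Rightarrow> (('a \<times> 'a) \<times> ('a \<times> 'a)) set" where
  "frac_rel R = {((a, b), (c, d)). a \<in> carrier R \<and> b \<in> carrier R - {\<zero>\<^bsub>R\<^esub>} \<and>
     c \<in> carrier R \<and> d \<in> carrier R - {\<zero>\<^bsub>R\<^esub>} \<and> a \<otimes>\<^bsub>R\<^esub> d = c \<otimes>\<^bsub>R\<^esub> b}"

definition fraction :: "('a, 'b) ring_scheme \<Rightarrow> 'a \<Rightarrow> 'a \<Rightarrow> ('a \<times> 'a) set" where
  "fraction R a b = frac_rel R `` {(a, b)}"

definition fraction_field :: "('a, 'b) ring_scheme \<Rightarrow> ('a \<times> 'a) set ring" where
  "fraction_field R =
    \<lparr>carrier = (carrier R \<times> (carrier R - {\<zero>\<^bsub>R\<^esub>})) // frac_rel R,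
     monoid.mult = (\<lambda>U V. \<Union>(a, b)\<in>U. \<Union>(c, d)\<in>V. fraction R (a \<otimes>\<^bsub>R\<^esub> c) (b \<otimes>\<^bsub>R\<^esub> d)),
     one = fraction R \<one>\<^bsub>R\<^esub> \<one>\<^bsub>R\<^esub>,
     zero = fraction R \<zero>\<^bsub>R\<^esub> \<one>\<^bsub>R\<^esub>,
     add = (\<lambda>U V. \<Union>(a, b)\<in>U. \<Union>(c, d)\<in>V.
        fraction R (a \<otimes>\<^bsub>R\<^esub> d \<oplus>\<^bsub>R\<^esub> c \<otimes>\<^bsub>R\<^esub> b) (b \<otimes>\<^bsub>R\<^esub> d))\<rparr>"

type_synonym 'a ratfun = "((nat multiset \<Rightarrow> 'a) \<times> (nat multiset \<Rightarrow> 'a)) set"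

definition ratfun_field :: "('a, 'b) ring_scheme \<Rightarrow> nat \<Rightarrow> 'a ratfun ring" where
  "ratfun_field K m = fraction_field (mpoly_ring K m)"

section \<open>Matrix groups\<close>

text \<open>The arithmetic on \<^typ>\<open>'a mat\<close> in the library uses type classes; here the entries live in a
  ring with explicit carrier.\<close>

definition mat_monoid :: "nat \<Rightarrow> ('a, 'b) ring_scheme \<Rightarrow> 'a mat monoid" where
  "mat_monoid n R =
    \<lparr>carrier = {A \<in> carrier_mat n n. elements_mat A \<subseteq> carrier R},
     monoid.mult = (\<lambda>A B. mat n n (\<lambda>(i, j). \<Oplus>\<^bsub>R\<^esub>k\<in>{..<n}. A $$ (i, k) \<otimes>\<^bsub>R\<^esub> B $$ (k, j))),
     one = mat n n (\<lambda>(i, j). if i = j then \<one>\<^bsub>R\<^esub> else \<zero>\<^bsub>R\<^esub>)\<rparr>"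

definition GL :: "nat \<Rightarrow> ('a, 'b) ring_scheme \<Rightarrow> 'a mat monoid" where
  "GL n R = units_of (mat_monoid n R)"

section \<open>Presentation of the input and output data\<close>

text \<open>A finite field with \<open>q\<close> elements is a field \<open>K\<close> with carrier \<open>{..<q}\<close>; it is passed to, and
  returned by, an algorithm as its neutral elements and its operation tables.\<close>

definition table_code :: "nat \<Rightarrow> (nat \<Rightarrow> nat \<Rightarrow> nat) \<Rightarrow> nat" where
  "table_code q f = list_encode (map (\<lambda>a. list_encode (map (f a) [0..<q])) [0..<q])"

definition field_code :: "nat \<Rightarrow> nat ring \<Rightarrow> nat" where
  "field_code q K =
    list_encode [\<zero>\<^bsub>K\<^esub>, \<one>\<^bsub>K\<^esub>, table_code q (add K), table_code q (monoid.mult K)]"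

definition mat_code :: "('a \<Rightarrow> nat) \<Rightarrow> 'a mat \<Rightarrow> nat" where
  "mat_code f A = list_encode (map (\<lambda>row. list_encode (map f row)) (mat_to_list A))"

text \<open>A polynomial over \<open>K\<close> is written as a list of terms, each a coefficient with an exponent
  vector of length \<open>m\<close>; monomials may be repeated and coefficients may be zero.  A rational function
  is written as any numerator together with any nonzero denominator.\<close>

type_synonym poly_expr = "(nat \<times> nat list) list"
type_synonym ratfun_expr = "poly_expr \<times> poly_expr"

definition term_value :: "nat ring \<Rightarrow> nat \<times> nat list \<Rightarrow> nat multiset \<Rightarrow> nat" where
  "term_value K = (\<lambda>(c, e) M.
     if M = (\<Sum>i<length e. replicate_mset (e ! i) i) then c else \<zero>\<^bsub>K\<^esub>)"

definition poly_value :: "nat ring \<Rightarrow> poly_expr \<Rightarrow> nat multiset \<Rightarrow> nat" where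
  "poly_value K p =
    foldr (\<lambda>t. ring.indexed_padd K (term_value K t)) p (ring.indexed_const K \<zero>\<^bsub>K\<^esub>)"

definition ratfun_value :: "nat ring \<Rightarrow> nat \<Rightarrow> ratfun_expr \<Rightarrow> nat ratfun" where
  "ratfun_value K m = (\<lambda>(p, r). fraction (mpoly_ring K m) (poly_value K p) (poly_value K r))"

definition poly_exprs :: "nat ring \<Rightarrow> nat \<Rightarrow> poly_expr set" where
  "poly_exprs K m = {p. \<forall>(c, e)\<in>set p. c \<in> carrier K \<and> length e = m}"

definition ratfun_exprs :: "nat ring \<Rightarrow> nat \<Rightarrow> ratfun_expr set" where
  "ratfun_exprs K m = {(p, r). p \<in> poly_exprs K m \<and> r \<in> poly_exprs K m \<and>
     poly_value K r \<noteq> \<zero>\<^bsub>mpoly_ring K m\<^esub>}"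

text \<open>The list \<open>Ds\<close> of matrices of expressions denotes the set \<open>S\<close> of matrices over
  \<open>ratfun_field K m\<close>.\<close>

definition presents :: "nat ring \<Rightarrow> nat \<Rightarrow> nat \<Rightarrow> ratfun_expr mat list \<Rightarrow> nat ratfun mat set \<Rightarrow> bool"
  where
  "presents K m n Ds S \<longleftrightarrow>
     (\<forall>D\<in>set Ds. D \<in> carrier_mat n n \<and> elements_mat D \<subseteq> ratfun_exprs K m) \<and>
     S = map_mat (ratfun_value K m) ` set Ds"

text \<open>Every finite set of matrices over \<open>ratfun_field K m\<close> can be presented in this way.\<close>

context
  fixes K :: "nat ring"
  assumes ring_K: "ring K"
begin

interpretation ring K by (fact ring_K)

lemma poly_exprs_Cons:
  "(c, e) # p \<in> poly_exprs K m \<longleftrightarrow> c \<in> carrier K \<and> length e = m \<and> p \<in> poly_exprs K m"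
  by (auto simp: poly_exprs_def)

lemma poly_value_Cons: "poly_value K (t # p) M = term_value K t M \<oplus>\<^bsub>K\<^esub> poly_value K p M"
  by (simp add: poly_value_def indexed_padd_def)

lemma poly_value_Nil: "poly_value K [] M = \<zero>\<^bsub>K\<^esub>"
  by (simp add: poly_value_def indexed_const_def)

lemma term_value_closed: "c \<in> carrier K \<Longrightarrow> term_value K (c, e) M \<in> carrier K"
  by (simp add: term_value_def)

lemma poly_value_closed: "p \<in> poly_exprs K m \<Longrightarrow> poly_value K p M \<in> carrier K"
  by (induction p) (auto simp: poly_exprs_Cons poly_value_Cons poly_value_Nil term_value_closed)

lemma poly_value_append:
  assumes "p \<in> poly_exprs K m" "r \<in> poly_exprs K m"
  shows "poly_value K (p @ r) M = poly_value K p M \<oplus>\<^bsub>K\<^esub> poly_value K r M"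
  using assms(1)
proof (induction p)
  case Nil
  then show ?case by (simp add: poly_value_Nil poly_value_closed[OF assms(2)])
next
  case (Cons t p)
  obtain c e where t: "t = (c, e)" by fastforce
  with Cons.prems have "c \<in> carrier K" "p \<in> poly_exprs K m"
    by (auto simp: poly_exprs_Cons)
  with Cons.IH poly_value_closed[OF assms(2)] show ?case
    by (simp add: t poly_value_Cons term_value_closed poly_value_closed a_assoc)
qed

lemma term_value_shift:
  assumes "i < length e"
  shows "term_value K (c, e[i := Suc (e ! i)]) M
    = (if i \<in># M then term_value K (c, e) (M - {#i#}) else \<zero>\<^bsub>K\<^esub>)"
proof -
  have "(\<Sum>j<length e. replicate_mset (e[i := Suc (e ! i)] ! j) j)
      = (\<Sum>j<length e. replicate_mset (e ! j) j + (if j = i then {#i#} else {#}))"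
    using assms by (intro sum.cong) auto
  also have "\<dots> = add_mset i (\<Sum>j<length e. replicate_mset (e ! j) j)"
    using assms by (simp add: sum.distrib)
  finally have shift: "(\<Sum>j<length e. replicate_mset (e[i := Suc (e ! i)] ! j) j)
      = add_mset i (\<Sum>j<length e. replicate_mset (e ! j) j)" .
  show ?thesis
  proof (cases "i \<in># M")
    case True
    then obtain N where "M = add_mset i N" by (meson multi_member_split)
    then show ?thesis by (simp add: term_value_def shift)
  next
    case False
    then show ?thesis by (auto simp: term_value_def shift)
  qed
qed

lemma poly_value_shift:
  assumes "i < m" "p \<in> poly_exprs K m"
  shows "poly_value K (map (\<lambda>(c, e). (c, e[i := Suc (e ! i)])) p) M
    = (if i \<in># M then poly_value K p (M - {#i#}) else \<zero>\<^bsub>K\<^esub>)"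
  using assms(2)
proof (induction p)
  case Nil
  then show ?case by (simp add: poly_value_Nil)
next
  case (Cons t p)
  obtain c e where "t = (c, e)" by fastforce
  with Cons assms(1) show ?case
    by (simp add: poly_exprs_Cons poly_value_Cons term_value_shift)
qed

lemma poly_value_surj:
  assumes "P \<in> carrier (mpoly_ring K m)"
  shows "\<exists>p\<in>poly_exprs K m. poly_value K p = P"
proof -
  have "P \<in> indexed_pset {..<m} (carrier K)"
    using assms by (simp add: mpoly_ring_def)
  then show ?thesis
  proof (induction rule: indexed_pset.induct)
    case (indexed_const k)
    have "(\<Sum>i<m. replicate_mset (replicate m 0 ! i) i) = ({#} :: nat multiset)"
      by (intro sum.neutral) simp
    then have "poly_value K [(k, replicate m 0)] = indexed_const k"
      using indexed_const
      by (intro ext) (simp add: poly_value_Cons poly_value_Nil term_value_def indexed_const_def)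
    moreover have "[(k, replicate m 0)] \<in> poly_exprs K m"
      using indexed_const by (simp add: poly_exprs_def)
    ultimately show ?case by blast
  next
    case (indexed_padd P Q)
    then obtain p r where pr: "p \<in> poly_exprs K m" "poly_value K p = P"
      "r \<in> poly_exprs K m" "poly_value K r = Q" by blast
    then have "poly_value K (p @ r) = indexed_padd P Q"
      by (intro ext) (simp add: poly_value_append[of p m r] indexed_padd_def)
    moreover have "p @ r \<in> poly_exprs K m"
      using pr by (auto simp: poly_exprs_def)
    ultimately show ?case by blast
  next
    case (indexed_pmult P i)
    then obtain p where p: "p \<in> poly_exprs K m" "poly_value K p = P" by blast
    let ?p = "map (\<lambda>(c, e). (c, e[i := Suc (e ! i)])) p"
    have "poly_value K ?p = indexed_pmult P i"
      using indexed_pmult p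
      by (intro ext) (simp add: poly_value_shift[of i m p] indexed_pmult_def)
    moreover have "?p \<in> poly_exprs K m"
      using p(1) by (auto simp: poly_exprs_def)
    ultimately show ?case by blast
  qed
qed

lemma ratfun_value_surj:
  assumes "x \<in> carrier (ratfun_field K m)"
  shows "\<exists>d\<in>ratfun_exprs K m. ratfun_value K m d = x"
proof -
  obtain P Q where PQ: "P \<in> carrier (mpoly_ring K m)" "Q \<in> carrier (mpoly_ring K m)"
    "Q \<noteq> \<zero>\<^bsub>mpoly_ring K m\<^esub>" "x = fraction (mpoly_ring K m) P Q"
    using assms by (auto simp: ratfun_field_def fraction_field_def fraction_def quotient_def)
  obtain p r where "p \<in> poly_exprs K m" "poly_value K p = P"
    "r \<in> poly_exprs K m" "poly_value K r = Q"
    using poly_value_surj PQ(1,2) by meson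
  with PQ(3,4) have "(p, r) \<in> ratfun_exprs K m" "ratfun_value K m (p, r) = x"
    by (auto simp: ratfun_exprs_def ratfun_value_def)
  then show ?thesis by blast
qed

lemma presents_exists:
  assumes "finite S" "S \<subseteq> carrier (GL n (ratfun_field K m))"
  shows "\<exists>Ds. presents K m n Ds S"
proof -
  have "\<forall>x\<in>carrier (ratfun_field K m). \<exists>d. d \<in> ratfun_exprs K m \<and> ratfun_value K m d = x"
  proof
    fix x assume "x \<in> carrier (ratfun_field K m)"
    from ratfun_value_surj[OF this]
    show "\<exists>d. d \<in> ratfun_exprs K m \<and> ratfun_value K m d = x" by (simp only: Bex_def)
  qed
  from bchoice[OF this] obtain f where f: "\<forall>x\<in>carrier (ratfun_field K m).
      f x \<in> ratfun_exprs K m \<and> ratfun_value K m (f x) = x" ..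
  obtain As where As: "set As = S" using assms(1) finite_list by blast
  have A: "A \<in> carrier_mat n n" "elements_mat A \<subseteq> carrier (ratfun_field K m)" if "A \<in> S" for A
    using subsetD[OF assms(2) that] by (simp_all add: GL_def units_of_def Units_def mat_monoid_def)
  have entry: "A $$ (i, j) \<in> carrier (ratfun_field K m)" if "A \<in> S" "i < n" "j < n" for A i j
    using subsetD[OF A(2)[OF that(1)] elements_matI[OF A(1)[OF that(1)] that(2,3) refl]] .
  have 1: "map_mat f A \<in> carrier_mat n n" "elements_mat (map_mat f A) \<subseteq> ratfun_exprs K m"
    if "A \<in> S" for A
    using A(1)[OF that] f entry[OF that] by (auto simp: elements_mat_def)
  have 2: "map_mat (ratfun_value K m) (map_mat f A) = A" if "A \<in> S" for A
    using A(1)[OF that] f entry[OF that] by (intro eq_matI) auto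
  have "presents K m n (map (map_mat f) As) S"
    unfolding presents_def
  proof (intro conjI ballI)
    fix D assume "D \<in> set (map (map_mat f) As)"
    then obtain A where "A \<in> S" "D = map_mat f A" using As by auto
    then show "D \<in> carrier_mat n n" "elements_mat D \<subseteq> ratfun_exprs K m"
      using 1 by blast+
  next
    have "map_mat (ratfun_value K m) ` set (map (map_mat f) As)
        = (\<lambda>A. map_mat (ratfun_value K m) (map_mat f A)) ` S"
      by (simp only: set_map image_image As)
    also have "\<dots> = (\<lambda>A. A) ` S"
      by (rule image_cong) (use 2 in simp_all)
    finally show "S = map_mat (ratfun_value K m) ` set (map (map_mat f) As)" by simp
  qed
  then show ?thesis ..
qed

end

definition poly_code :: "poly_expr \<Rightarrow> nat" where
  "poly_code p = list_encode (map (\<lambda>(c, e). prod_encode (c, list_encode e)) p)"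

definition ratfun_code :: "ratfun_expr \<Rightarrow> nat" where
  "ratfun_code = (\<lambda>(p, r). prod_encode (poly_code p, poly_code r))"

definition input_code ::
    "nat \<Rightarrow> nat ring \<Rightarrow> nat \<Rightarrow> nat \<Rightarrow> ratfun_expr mat list \<Rightarrow> nat list" where
  "input_code q K m n Ds =
     [q, field_code q K, m, n, list_encode (map (mat_code ratfun_code) Ds)]"

definition output_code :: "nat \<Rightarrow> nat \<Rightarrow> nat ring \<Rightarrow> nat mat list \<Rightarrow> nat" where
  "output_code d r L Ts =
     list_encode [d, r, field_code r L, list_encode (map (mat_code id) Ts)]"

end

theory Submission
  imports Defs "HOL-Algebra.UnivPoly" "HOL-Algebra.Multiplicative_Group"
begin

text \<open>A finite matrix group \<open>G\<close> over \<open>F = K(X\<^sub>0, \<dots>, X\<^bsub>m - 1\<^esub>)\<close> survives a suitable specialisation of the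
  variables.  Only finitely many elements of \<open>F\<close> occur as entries of elements of \<open>G\<close>; let \<open>D\<close> be the
  product of their denominators and of the numerators of the differences of any two distinct ones.  A ring homomorphism from the polynomial
  ring to a finite field \<open>L\<close> that does not kill \<open>D\<close> extends to these entries and is injective on them, so it
  maps \<open>G\<close> isomorphically to a subgroup of \<open>GL(n, L)\<close> (\<open>ratfun_specialisation\<close>).

  Such a homomorphism comes from Kronecker's substitution \<open>X\<^sub>i := T ^ (B ^ i)\<close>.  It is a homomorphism to
  \<open>K[T]\<close> for every \<open>B\<close>, and it is injective on polynomials whose exponents are below \<open>B\<close>, because the
  exponents become digits in base \<open>B\<close>.  If \<open>D\<close> goes to \<open>f \<noteq> 0\<close>, then a maximal ideal of \<open>K[T]\<close> that
  contains \<open>T f + 1\<close> does not contain \<open>f\<close>, and its residue field is finite (\<open>UP_finite_quotient\<close>).  The same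
  substitutions transport the laws of a ring, and the absence of zero divisors, from \<open>K[T]\<close> to the
  polynomial ring in \<open>m\<close> variables (\<open>mpoly_cring\<close>, \<open>mpoly_domain\<close>).

  The algorithm does not compute \<open>D\<close>; it searches through all codes of certificates, without a bound on the
  search.  A certificate consists of the tables of a finite field \<open>L\<close>, of one matrix over \<open>L\<close> for each
  generator, and of a list \<open>W\<close> of words in the generators that contains the empty word.  It is accepted if,
  among the words of \<open>W\<close> and their left multiples by a generator, two words agree over \<open>F\<close> exactly if they
  agree over \<open>L\<close>, each of them agrees with one of \<open>W\<close>, and the words of \<open>W\<close> have distinct values.  Every word can then be reduced to a word
  of \<open>W\<close> letter by letter, and the same reduction is valid over \<open>F\<close> and over \<open>L\<close>.  So the two groups are
  isomorphic and have \<open>length W\<close> elements, whichever certificate is found (\<open>word_system_iso\<close>).  The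
  specialisation above shows that some certificate exists, so the search ends (\<open>certificate_exists\<close>).

  Acceptance is decidable because agreement over \<open>F\<close> is decided by symbolic arithmetic with fractions of
  polynomials: \<open>p/q = r/s\<close> exactly if \<open>p s\<close> and \<open>r q\<close> have the same coefficients.  That the test is
  recursive is proved by closure properties of the functions between types whose elements are coded by natural
  numbers; these properties follow the shape of the defining terms.\<close>

section \<open>Computable functions between coded types\<close>

text \<open>Bijective codes make both the inverse of the coding and every reinterpretation of a code as an element of
  another type computable, by the identity program.  On nested pairs and lists of natural numbers the code
  agrees with the presentation of the input and output data.\<close>

class coded =
  fixes enc :: "'a \<Rightarrow> nat"
  assumes bij_enc: "bij enc"

instantiation nat :: coded
begin
definition enc_nat :: "nat \<Rightarrow> nat" where "enc_nat n = n"
instance by standard (simp add: enc_nat_def bij_def inj_def surj_def)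
end

instantiation prod :: (coded, coded) coded
begin
definition enc_prod :: "'a \<times> 'b \<Rightarrow> nat" where
  "enc_prod p = prod_encode (map_prod enc enc p)"
instance
proof
  have "bij (map_prod enc enc :: 'a \<times> 'b \<Rightarrow> nat \<times> nat)"
    using bij_enc[where 'a = 'a] bij_enc[where 'a = 'b]
    by (auto simp: bij_def intro!: prod.inj_map map_prod_surj)
  then have "bij (prod_encode \<circ> (map_prod enc enc :: 'a \<times> 'b \<Rightarrow> nat \<times> nat))"
    using bij_prod_encode by (rule bij_comp)
  then show "bij (enc :: 'a \<times> 'b \<Rightarrow> nat)"
    by (simp add: enc_prod_def[abs_def] comp_def)
qed
end

instantiation list :: (coded) coded
begin
definition enc_list :: "'a list \<Rightarrow> nat" where
  "enc_list xs = list_encode (map enc xs)"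
instance
proof
  have "bij (map (enc :: 'a \<Rightarrow> nat))"
    using bij_enc[where 'a = 'a]
    by (simp add: bij_def list.inj_map) (metis lists_UNIV lists_image)
  then have "bij (list_encode \<circ> map (enc :: 'a \<Rightarrow> nat))"
    using bij_list_encode by (rule bij_comp)
  then show "bij (enc :: 'a list \<Rightarrow> nat)"
    by (simp add: enc_list_def[abs_def] comp_def)
qed
end

definition dec :: "nat \<Rightarrow> 'a :: coded" where "dec = inv_into UNIV enc"

lemma dec_enc [simp]: "dec (enc x) = x"
  by (simp add: dec_def bij_enc bij_is_inj inv_f_f)

lemma enc_dec [simp]: "enc (dec n :: 'a :: coded) = n"
  by (simp add: dec_def bij_enc bij_is_surj surj_f_inv_f)

lemma enc_eq_iff [simp]: "enc x = enc y \<longleftrightarrow> x = y"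
  by (metis dec_enc)

lemma enc_nat_simp [simp]: "enc (n :: nat) = n"
  by (simp add: enc_nat_def)

lemma enc_Pair: "enc (x, y) = prod_encode (enc x, enc y)"
  by (simp add: enc_prod_def)

lemma enc_Nil [simp]: "enc [] = 0"
  by (simp add: enc_list_def)

lemma enc_Cons: "enc (x # xs) = Suc (enc (x, xs))"
  by (simp add: enc_list_def enc_Pair)

lemma length_le_enc: "length xs \<le> enc xs"
proof (induction xs)
  case (Cons x xs)
  have "enc xs \<le> enc (x, xs)" by (simp add: enc_Pair le_prod_encode_2)
  with Cons show ?case by (simp add: enc_Cons)
qed simp

lemma computes_Comp1:
  "computes g xs y \<Longrightarrow> computes f [y] z \<Longrightarrow> computes (Comp f [g]) xs z"
  by (rule computes.Comp[where ys = "[y]"]) simp_all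

lemma computes_Comp2:
  "computes g xs y \<Longrightarrow> computes g' xs y' \<Longrightarrow> computes f [y, y'] z
    \<Longrightarrow> computes (Comp f [g, g']) xs z"
  by (rule computes.Comp[where ys = "[y, y']"]) simp_all

lemma computes_Proj0: "computes (Proj 0) (x # xs) x"
  using computes.Proj[of 0 "x # xs"] by simp

lemma computes_Proj1: "computes (Proj 1) (x # y # xs) y"
  using computes.Proj[of 1 "x # y # xs"] by simp

lemma computes_Proj2: "computes (Proj 2) (x # y # z # xs) z"
  using computes.Proj[of 2 "x # y # z # xs"] by simp

lemmas computes_intros = computes_Comp1 computes_Comp2
  computes_Proj0 computes_Proj1 computes_Proj2 computes.Succ computes.Zero

definition add_prog :: recf where "add_prog = PrimRec (Proj 0) (Comp Succ [Proj 1])"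

lemma computes_add: "computes add_prog [x, y] (x + y)"
proof (induction x)
  case 0
  then show ?case unfolding add_prog_def by (auto intro: computes.PrimRec_0 computes_intros)
next
  case (Suc x)
  then show ?case unfolding add_prog_def plus_nat.simps(2)
    by (rule computes.PrimRec_Suc) (rule computes_intros)+
qed

definition pred_prog :: recf where "pred_prog = PrimRec Zero (Proj 0)"

lemma computes_pred: "computes pred_prog [x] (x - 1)"
proof (induction x)
  case 0
  then show ?case unfolding pred_prog_def by (auto intro: computes.PrimRec_0 computes_intros)
next
  case (Suc x)
  then show ?case unfolding pred_prog_def
    by (rule computes.PrimRec_Suc) (use computes_Proj0 in simp)
qed

definition sub_prog :: recf where "sub_prog = PrimRec (Proj 0) (Comp pred_prog [Proj 1])"

lemma computes_sub: "computes sub_prog [y, x] (x - y)"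
proof (induction y)
  case 0
  then show ?case unfolding sub_prog_def by (auto intro: computes.PrimRec_0 computes_intros)
next
  case (Suc y)
  have eq: "x - Suc y = (x - y) - 1" by simp
  from Suc show ?case unfolding sub_prog_def eq
    by (rule computes.PrimRec_Suc) (rule computes_intros computes_pred)+
qed

definition triangle_prog :: recf where
  "triangle_prog = PrimRec Zero (Comp add_prog [Comp Succ [Proj 0], Proj 1])"

lemma computes_triangle: "computes triangle_prog [x] (triangle x)"
proof (induction x)
  case 0
  then show ?case unfolding triangle_prog_def by (auto intro: computes.PrimRec_0 computes_intros)
next
  case (Suc x)
  have eq: "triangle (Suc x) = Suc x + triangle x" by simp
  from Suc show ?case unfolding triangle_prog_def eq
    by (rule computes.PrimRec_Suc) (rule computes_intros computes_add)+
qed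

definition pair_prog :: recf where
  "pair_prog = Comp add_prog [Comp triangle_prog [add_prog], Proj 0]"

lemma computes_pair: "computes pair_prog [x, y] (prod_encode (x, y))"
  unfolding pair_prog_def prod_encode_def prod.case
  by (rule computes_intros computes_add computes_triangle)+

text \<open>The pair \<open>(x, y)\<close> is coded by \<open>triangle (x + y) + x\<close>.  The program finds the sum \<open>x + y\<close> as the least
  \<open>s\<close> with \<open>triangle (s + 1)\<close> above the code; both components are obtained from it by subtraction.\<close>

definition diag_prog :: recf where
  "diag_prog = Mu (Comp sub_prog [Comp triangle_prog [Comp Succ [Proj 0]], Comp Succ [Proj 1]])"

lemma triangle_mono: "x \<le> y \<Longrightarrow> triangle x \<le> triangle y"
  by (induction rule: dec_induct) auto

lemma computes_diag: "computes diag_prog [prod_encode (x, y)] (x + y)"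
proof -
  let ?z = "prod_encode (x, y)"
  let ?f = "Comp sub_prog [Comp triangle_prog [Comp Succ [Proj 0]], Comp Succ [Proj 1]]"
  have f: "computes ?f [k, ?z] (Suc ?z - triangle (Suc k))" for k
    by (rule computes_intros computes_sub computes_triangle)+
  have "Suc ?z - triangle (Suc (x + y)) = 0"
    by (simp add: prod_encode_def)
  with f[of "x + y"] have 1: "computes ?f [x + y, ?z] 0" by metis
  have "\<exists>w. computes ?f [i, ?z] (Suc w)" if "i < x + y" for i
  proof -
    have "triangle (Suc i) \<le> ?z"
      using triangle_mono[of "Suc i" "x + y"] that by (simp add: prod_encode_def)
    then have "Suc ?z - triangle (Suc i) = Suc (?z - triangle (Suc i))" by (simp add: Suc_diff_le)
    with f[of i] show ?thesis by metis
  qed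
  with 1 show ?thesis unfolding diag_prog_def by (intro computes.Mu) auto
qed

definition fst_prog :: recf where
  "fst_prog = Comp sub_prog [Comp triangle_prog [diag_prog], Proj 0]"

lemma computes_fst: "computes fst_prog [prod_encode (x, y)] x"
proof -
  have "computes fst_prog [prod_encode (x, y)] (prod_encode (x, y) - triangle (x + y))"
    unfolding fst_prog_def
    by (rule computes_intros computes_sub computes_triangle computes_diag)+
  then show ?thesis by (simp add: prod_encode_def)
qed

definition snd_prog :: recf where
  "snd_prog = Comp sub_prog [fst_prog, diag_prog]"

lemma computes_snd: "computes snd_prog [prod_encode (x, y)] y"
proof -
  have "computes snd_prog [prod_encode (x, y)] ((x + y) - x)"
    unfolding snd_prog_def
    by (rule computes_intros computes_sub computes_fst computes_diag)+
  then show ?thesis by simp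
qed

definition computable :: "('a :: coded \<Rightarrow> 'b :: coded) \<Rightarrow> bool" where
  "computable f \<longleftrightarrow> (\<exists>A. \<forall>x. computes A [enc x] (enc (f x)))"

text \<open>Every rule speaks of a term with one free variable, the environment.  A binder extends the environment by a
  pair, so that its body becomes a function of \<open>fst p\<close> and \<open>snd p\<close>; with the rules collected here,
  resolution alone then proves computability of a term by following its structure.\<close>

named_theorems computable_intros

lemma computable_id [computable_intros]: "computable (\<lambda>x. x)"
  unfolding computable_def by (auto intro: computes_Proj0)

lemma computable_const [computable_intros]: "computable (\<lambda>x. c)"
proof -
  have "\<exists>A. \<forall>x. computes A [x] n" for n
  proof (induction n)
    case 0
    then show ?case by (auto intro: computes.Zero)
  next
    case (Suc n)
    then show ?case by (blast intro: computes_Comp1 computes.Succ)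
  qed
  from this[of "enc c"] show ?thesis unfolding computable_def by blast
qed

lemma computable_comp:
  "computable f \<Longrightarrow> computable g \<Longrightarrow> computable (\<lambda>x. f (g x))"
  unfolding computable_def by (blast intro: computes_Comp1)

lemma computable_Pair [computable_intros]:
  "computable f \<Longrightarrow> computable g \<Longrightarrow> computable (\<lambda>x. (f x, g x))"
  unfolding computable_def enc_Pair by (blast intro: computes_Comp2 computes_pair)

lemma computable_comp2:
  assumes "computable (\<lambda>p. f (fst p) (snd p))" "computable a" "computable b"
  shows "computable (\<lambda>x. f (a x) (b x))"
  using computable_comp[OF assms(1) computable_Pair[OF assms(2,3)]] by simp

lemma computable_comp3:
  assumes "computable (\<lambda>p. f (fst p) (fst (snd p)) (snd (snd p)))" "computable a" "computable b" "computable c"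
  shows "computable (\<lambda>x. f (a x) (b x) (c x))"
  using computable_comp[OF assms(1) computable_Pair[OF assms(2) computable_Pair[OF assms(3,4)]]] by simp

text \<open>A function is computable as soon as a numeric function that produces the codes of its values is.\<close>

lemma computable_code:
  assumes "computable (\<lambda>x. enc (f x))"
  shows "computable f"
  using assms by (simp add: computable_def)

lemma computable_enc [computable_intros]: "computable f \<Longrightarrow> computable (\<lambda>x. enc (f x))"
  by (simp add: computable_def)

lemma computable_dec [computable_intros]: "computable f \<Longrightarrow> computable (\<lambda>x. dec (f x))"
  by (simp add: computable_def)

lemma computable_fst [computable_intros]:
  assumes "computable f"
  shows "computable (\<lambda>x. fst (f x))"
proof -
  have "computes fst_prog [enc p] (enc (fst p))" for p :: "'b \<times> 'c"
    by (cases p) (simp add: enc_Pair computes_fst)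
  with assms show ?thesis unfolding computable_def by (blast intro: computes_Comp1)
qed

lemma computable_snd [computable_intros]:
  assumes "computable f"
  shows "computable (\<lambda>x. snd (f x))"
proof -
  have "computes snd_prog [enc p] (enc (snd p))" for p :: "'b \<times> 'c"
    by (cases p) (simp add: enc_Pair computes_snd)
  with assms show ?thesis unfolding computable_def by (blast intro: computes_Comp1)
qed

lemma computable_Suc [computable_intros]:
  "computable f \<Longrightarrow> computable (\<lambda>x. Suc (f x))"
  unfolding computable_def enc_nat_simp by (blast intro: computes_Comp1 computes.Succ)

lemma computable_add [computable_intros]:
  "computable f \<Longrightarrow> computable g \<Longrightarrow> computable (\<lambda>x. f x + g x :: nat)"
  unfolding computable_def enc_nat_simp by (blast intro: computes_Comp2 computes_add)

lemma computable_diff [computable_intros]: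
  "computable f \<Longrightarrow> computable g \<Longrightarrow> computable (\<lambda>x. f x - g x :: nat)"
  unfolding computable_def enc_nat_simp by (blast intro: computes_Comp2 computes_sub)

lemma computable_rec_nat [computable_intros]:
  assumes "computable f" and "computable (\<lambda>p. g (fst p) (fst (snd p)) (snd (snd p)))"
    and "computable n"
  shows "computable (\<lambda>x. rec_nat (f x) (\<lambda>k y. g x k y) (n x))"
proof -
  obtain F G N where
    F: "\<And>x. computes F [enc x] (enc (f x))" and
    G: "\<And>x k y. computes G [prod_encode (enc x, prod_encode (k, enc y))] (enc (g x k y))" and
    N: "\<And>x. computes N [enc x] (n x)"
    using assms unfolding computable_def by (fastforce simp: enc_Pair)
  let ?G = "Comp G [Comp pair_prog [Proj 2, Comp pair_prog [Proj 0, Proj 1]]]"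
  have "computes (PrimRec F ?G) [k, enc x] (enc (rec_nat (f x) (\<lambda>k y. g x k y) k))" for k x
  proof (induction k)
    case 0
    then show ?case by (auto intro: computes.PrimRec_0 F)
  next
    case (Suc k)
    then show ?case unfolding nat.rec(2)
      by (rule computes.PrimRec_Suc) (rule computes_intros computes_pair G)+
  qed
  then have "computes (Comp (PrimRec F ?G) [N, Proj 0]) [enc x]
      (enc (rec_nat (f x) (\<lambda>k y. g x k y) (n x)))" for x
    by (intro computes_Comp2[OF N computes_Proj0])
  then show ?thesis unfolding computable_def by blast
qed

definition decidable :: "('a :: coded \<Rightarrow> bool) \<Rightarrow> bool" where
  "decidable P \<longleftrightarrow> computable (\<lambda>x. of_bool (P x) :: nat)"

lemma computable_If [computable_intros]:
  assumes "decidable P" "computable f" "computable g"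
  shows "computable (\<lambda>x. if P x then f x else g x)"
proof -
  have "computable (\<lambda>x. rec_nat (g x) (\<lambda>_ _. f x) (of_bool (P x)))"
    by (intro computable_intros assms(3) computable_comp[OF assms(2)]
      assms(1)[unfolded decidable_def])
  moreover have "rec_nat (g x) (\<lambda>_ _. f x) (of_bool (P x)) = (if P x then f x else g x)" for x
    by simp
  ultimately show ?thesis by simp
qed

lemma decidable_comp: "decidable P \<Longrightarrow> computable g \<Longrightarrow> decidable (\<lambda>x. P (g x))"
  unfolding decidable_def by (rule computable_comp)

lemma decidable_comp2:
  "decidable (\<lambda>p. P (fst p) (snd p)) \<Longrightarrow> computable a \<Longrightarrow> computable b \<Longrightarrow> decidable (\<lambda>x. P (a x) (b x))"
  unfolding decidable_def by (rule computable_comp2)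

lemma decidable_comp3:
  "decidable (\<lambda>p. P (fst p) (fst (snd p)) (snd (snd p))) \<Longrightarrow> computable a \<Longrightarrow> computable b \<Longrightarrow> computable c
    \<Longrightarrow> decidable (\<lambda>x. P (a x) (b x) (c x))"
  unfolding decidable_def by (rule computable_comp3)

lemma decidable_conj [computable_intros]:
  assumes "decidable P" "decidable Q"
  shows "decidable (\<lambda>x. P x \<and> Q x)"
proof -
  have "computable (\<lambda>x. if P x then of_bool (Q x) else 0 :: nat)"
    using assms by (intro computable_intros) (simp_all add: decidable_def)
  moreover have "(if P x then of_bool (Q x) else 0 :: nat) = of_bool (P x \<and> Q x)" for x
    by simp
  ultimately show ?thesis by (simp add: decidable_def)
qed

lemma decidable_not [computable_intros]:
  assumes "decidable P"
  shows "decidable (\<lambda>x. \<not> P x)"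
proof -
  have "computable (\<lambda>x. if P x then 0 else 1 :: nat)"
    using assms by (intro computable_intros)
  moreover have "(if P x then 0 else 1 :: nat) = of_bool (\<not> P x)" for x
    by simp
  ultimately show ?thesis by (simp add: decidable_def)
qed

lemma decidable_imp [computable_intros]:
  assumes "decidable P" "decidable Q"
  shows "decidable (\<lambda>x. P x \<longrightarrow> Q x)"
proof -
  have "decidable (\<lambda>x. \<not> (P x \<and> \<not> Q x))"
    by (intro computable_intros assms)
  then show ?thesis by simp
qed

lemma decidable_le [computable_intros]:
  assumes "computable f" "computable g"
  shows "decidable (\<lambda>x. f x \<le> (g x :: nat))"
proof -
  have "computable (\<lambda>x. 1 - (f x - g x))"
    by (intro computable_intros assms)
  moreover have "1 - (f x - g x) = of_bool (f x \<le> g x)" for x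
    by auto
  ultimately show ?thesis by (simp add: decidable_def)
qed

lemma decidable_less [computable_intros]:
  "computable f \<Longrightarrow> computable g \<Longrightarrow> decidable (\<lambda>x. f x < (g x :: nat))"
  unfolding less_eq_Suc_le by (intro computable_intros)

lemma decidable_eq [computable_intros]:
  assumes "computable f" "computable g"
  shows "decidable (\<lambda>x. f x = g x)"
proof -
  have "decidable (\<lambda>x. enc (f x) \<le> enc (g x) \<and> enc (g x) \<le> enc (f x))"
    by (intro computable_intros assms)
  then show ?thesis by (simp add: order_class.order_eq_iff[symmetric])
qed

lemma decidable_iff [computable_intros]:
  assumes "decidable P" "decidable Q"
  shows "decidable (\<lambda>x. P x \<longleftrightarrow> Q x)"
proof -
  have "decidable (\<lambda>x. (P x \<longrightarrow> Q x) \<and> (Q x \<longrightarrow> P x))"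
    by (intro computable_intros assms)
  moreover have "(P x \<longrightarrow> Q x) \<and> (Q x \<longrightarrow> P x) \<longleftrightarrow> (P x \<longleftrightarrow> Q x)" for x by blast
  ultimately show ?thesis by simp
qed

lemma computable_Cons [computable_intros]:
  assumes "computable f" "computable g"
  shows "computable (\<lambda>x. f x # g x)"
proof -
  have "computable (\<lambda>x. Suc (enc (f x, g x)))"
    by (intro computable_intros assms)
  then have "computable (\<lambda>x. enc (f x # g x))" by (simp add: enc_Cons)
  then show ?thesis by (rule computable_code)
qed

text \<open>The code of \<open>y # ys\<close> is the successor of the code of \<open>(y, ys)\<close>, so that case distinction on a list is
  primitive recursion on its code which ignores the recursive value.\<close>

lemma computable_case_list [computable_intros]:
  fixes l :: "'a :: coded \<Rightarrow> 'b :: coded list"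
  assumes "computable f" "computable (\<lambda>p. g (fst p) (fst (snd p)) (snd (snd p)))" "computable l"
  shows "computable (\<lambda>x. case l x of [] \<Rightarrow> f x | y # ys \<Rightarrow> g x y ys)"
proof -
  define h where "h x k = g x (fst (dec k :: 'b \<times> 'b list)) (snd (dec k :: 'b \<times> 'b list))" for x k
  have "computable (\<lambda>p. g (fst p) (fst (dec (fst (snd p)) :: 'b \<times> 'b list))
      (snd (dec (fst (snd p)) :: 'b \<times> 'b list)))"
    by (intro computable_comp3[OF assms(2)] computable_intros)
  then have "computable (\<lambda>x. rec_nat (f x) (\<lambda>k _. h x k) (enc (l x)))"
    unfolding h_def by (intro computable_intros assms(1,3))
  moreover have "rec_nat (f x) (\<lambda>k _. h x k) (enc (l x))
      = (case l x of [] \<Rightarrow> f x | y # ys \<Rightarrow> g x y ys)" for x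
    by (cases "l x") (simp_all add: enc_Cons h_def)
  ultimately show ?thesis by simp
qed

text \<open>The code of a list bounds its length, so that iterating a single step as often as the code says consumes
  the whole list; the step is the identity on the empty list.\<close>

lemma computable_foldl [computable_intros]:
  assumes "computable (\<lambda>p. f (fst p) (fst (snd p)) (snd (snd p)))" "computable a" "computable l"
  shows "computable (\<lambda>x. foldl (\<lambda>s y. f x s y) (a x) (l x))"
proof -
  define step where "step x = (\<lambda>(ys, s). case ys of [] \<Rightarrow> ([], s) | y # zs \<Rightarrow> (zs, f x s y))" for x
  have step_foldl: "snd (rec_nat (ys, s) (\<lambda>_. step x) k) = foldl (\<lambda>s y. f x s y) s ys"
    if "length ys \<le> k" for x k ys s
  proof -
    have "rec_nat (ys, s) (\<lambda>_. step x) k = (step x ^^ k) (ys, s)" for k ys s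
      by (induction k) auto
    moreover have "(step x ^^ k) ([], s) = ([], s)" for k s
      by (induction k) (auto simp: step_def)
    then have "snd ((step x ^^ k) (ys, s)) = foldl (\<lambda>s y. f x s y) s ys"
      using that
    proof (induction ys arbitrary: k s)
      case (Cons y ys)
      then obtain k' where "k = Suc k'" by (cases k) auto
      with Cons show ?case by (simp add: funpow_Suc_right step_def del: funpow.simps)
    qed simp
    ultimately show ?thesis by simp
  qed
  have step_eq: "step x p = (case fst p of [] \<Rightarrow> ([], snd p) | y # zs \<Rightarrow> (zs, f x (snd p) y))" for x p
    by (simp add: step_def case_prod_beta)
  have "computable (\<lambda>x. snd (rec_nat (l x, a x) (\<lambda>_. step x) (enc (l x))))"
    unfolding step_eq
    by (intro computable_intros assms(2,3)
      computable_comp3[OF assms(1)])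
  then show ?thesis by (simp add: step_foldl length_le_enc)
qed

lemma computable_rev [computable_intros]:
  assumes "computable l"
  shows "computable (\<lambda>x. rev (l x))"
proof -
  have "computable (\<lambda>x. foldl (\<lambda>s y. y # s) [] (l x))"
    by (intro computable_intros assms)
  then show ?thesis by (simp add: foldl_conv_fold fold_Cons_rev)
qed

lemma computable_foldr [computable_intros]:
  assumes "computable (\<lambda>p. f (fst p) (fst (snd p)) (snd (snd p)))" "computable a" "computable l"
  shows "computable (\<lambda>x. foldr (\<lambda>y s. f x y s) (l x) (a x))"
proof -
  have "computable (\<lambda>x. foldl (\<lambda>s y. f x y s) (a x) (rev (l x)))"
    by (intro computable_intros assms(2,3)
      computable_comp3[OF assms(1)])
  then show ?thesis by (simp add: foldr_conv_foldl)
qed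

lemma computable_map [computable_intros]:
  assumes "computable (\<lambda>p. f (fst p) (snd p))" "computable l"
  shows "computable (\<lambda>x. map (\<lambda>y. f x y) (l x))"
proof -
  have "computable (\<lambda>x. foldr (\<lambda>y s. f x y # s) (l x) [])"
    by (intro computable_intros assms(2)
      computable_comp2[OF assms(1)])
  moreover have "foldr (\<lambda>y s. h y # s) ys [] = map h ys" for h :: "'b \<Rightarrow> 'c" and ys
    by (induction ys) auto
  ultimately show ?thesis by simp
qed

lemma computable_append [computable_intros]:
  assumes "computable f" "computable g"
  shows "computable (\<lambda>x. f x @ g x)"
proof -
  have "computable (\<lambda>x. foldr (\<lambda>y s. y # s) (f x) (g x))"
    by (intro computable_intros assms)
  moreover have "foldr (\<lambda>y s. y # s) ys zs = ys @ zs" for ys zs :: "'b list"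
    by (induction ys) auto
  ultimately show ?thesis by simp
qed

lemma computable_concat [computable_intros]:
  assumes "computable l"
  shows "computable (\<lambda>x. concat (l x))"
proof -
  have "computable (\<lambda>x. foldr (\<lambda>y s. y @ s) (l x) [])"
    by (intro computable_intros assms)
  moreover have "foldr (\<lambda>y s. y @ s) ys [] = concat ys" for ys :: "'b list list"
    by (induction ys) auto
  ultimately show ?thesis by simp
qed

lemma computable_length [computable_intros]:
  assumes "computable l"
  shows "computable (\<lambda>x. length (l x))"
proof -
  have "computable (\<lambda>x. foldr (\<lambda>_ s. Suc s) (l x) 0)"
    by (intro computable_intros assms)
  moreover have "foldr (\<lambda>_ s. Suc s) ys 0 = length ys" for ys :: "'b list"
    by (induction ys) auto
  ultimately show ?thesis by simp
qed

lemma computable_upt [computable_intros]: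
  assumes "computable n"
  shows "computable (\<lambda>x. [0..<n x])"
proof -
  have "computable (\<lambda>x. rec_nat [] (\<lambda>k s. s @ [k]) (n x))"
    by (intro computable_intros assms)
  moreover have "rec_nat [] (\<lambda>k s. s @ [k]) m = [0..<m]" for m
    by (induction m) auto
  ultimately show ?thesis by simp
qed

lemma computable_replicate [computable_intros]:
  assumes "computable n" "computable f"
  shows "computable (\<lambda>x. replicate (n x) (f x))"
proof -
  have "computable (\<lambda>x. map (\<lambda>_. f x) [0..<n x])"
    by (intro computable_intros assms computable_comp[OF assms(2)])
  then show ?thesis by (simp add: map_replicate_const)
qed

text \<open>Unlike \<^term>\<open>xs ! i\<close>, which is unspecified for \<open>i \<ge> length xs\<close>, this is a computable function.\<close>

definition nth_default :: "'a \<Rightarrow> 'a list \<Rightarrow> nat \<Rightarrow> 'a" where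
  "nth_default d xs i = (if i < length xs then xs ! i else d)"

lemma nth_default_nth [simp]: "i < length xs \<Longrightarrow> nth_default d xs i = xs ! i"
  by (simp add: nth_default_def)

lemma computable_nth_default [computable_intros]:
  fixes l :: "'a :: coded \<Rightarrow> 'b :: coded list"
  assumes "computable d" "computable l" "computable n"
  shows "computable (\<lambda>x. nth_default (d x) (l x) (n x))"
proof -
  have "computable (\<lambda>x. case rec_nat (l x) (\<lambda>k s. case s of [] \<Rightarrow> [] | y # ys \<Rightarrow> ys) (n x) of
      [] \<Rightarrow> d x | y # ys \<Rightarrow> y)"
    by (intro computable_intros assms)
  moreover have "rec_nat xs (\<lambda>k s. case s of [] \<Rightarrow> [] | y # ys \<Rightarrow> ys) m = drop m xs"
    for xs :: "'b list" and m
  proof (induction m)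
    case (Suc m)
    have "drop (Suc m) xs = tl (drop m xs)" by (simp add: drop_Suc drop_tl)
    with Suc show ?case by (simp add: tl_def)
  qed simp
  moreover have "(case drop m xs of [] \<Rightarrow> e | y # ys \<Rightarrow> y) = nth_default e xs m"
    for e :: 'b and xs and m :: nat
    by (auto simp: nth_default_def split: list.splits) (metis hd_drop_conv_nth list.sel(1))
  ultimately show ?thesis by simp
qed

lemma decidable_Ball [computable_intros]:
  assumes "decidable (\<lambda>p. P (fst p) (snd p))" "computable l"
  shows "decidable (\<lambda>x. \<forall>y\<in>set (l x). P x y)"
proof -
  have "computable (\<lambda>x. foldr (\<lambda>y s. if P x y then s else 0) (l x) (1 :: nat))"
    by (intro computable_intros assms(2)
      decidable_comp2[OF assms(1)])
  moreover have "foldr (\<lambda>y s. if Q y then s else 0) ys (1 :: nat) = of_bool (\<forall>y\<in>set ys. Q y)"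
    for Q and ys :: "'b list"
    by (induction ys) auto
  ultimately show ?thesis by (simp add: decidable_def)
qed

lemma decidable_Bex [computable_intros]:
  assumes "decidable (\<lambda>p. P (fst p) (snd p))" "computable l"
  shows "decidable (\<lambda>x. \<exists>y\<in>set (l x). P x y)"
proof -
  have "decidable (\<lambda>x. \<not> (\<forall>y\<in>set (l x). \<not> P x y))"
    by (intro computable_intros assms)
  then show ?thesis by simp
qed

lemma decidable_all_less [computable_intros]:
  fixes n :: "'a :: coded \<Rightarrow> nat"
  assumes "decidable (\<lambda>p. P (fst p) (snd p))" "computable n"
  shows "decidable (\<lambda>x. \<forall>i<n x. P x i)"
proof -
  have "decidable (\<lambda>x. \<forall>i\<in>set [0..<n x]. P x i)"
    by (intro computable_intros assms)
  then show ?thesis by (simp add: Ball_def)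
qed

lemma decidable_ex_less [computable_intros]:
  fixes n :: "'a :: coded \<Rightarrow> nat"
  assumes "decidable (\<lambda>p. P (fst p) (snd p))" "computable n"
  shows "decidable (\<lambda>x. \<exists>i<n x. P x i)"
proof -
  have "decidable (\<lambda>x. \<exists>i\<in>set [0..<n x]. P x i)"
    by (intro computable_intros assms)
  then show ?thesis by (simp add: Bex_def)
qed

lemma decidable_member [computable_intros]:
  assumes "computable f" "computable l"
  shows "decidable (\<lambda>x. f x \<in> set (l x))"
proof -
  have "decidable (\<lambda>x. \<exists>y\<in>set (l x). f x = y)"
    by (intro computable_intros assms computable_comp[OF assms(1)])
  then show ?thesis by simp
qed

lemma decidable_distinct [computable_intros]:
  assumes "computable l"
  shows "decidable (\<lambda>x. distinct (l x))"
proof -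
  have "decidable (\<lambda>x. \<forall>i<length (l x). \<forall>j<length (l x).
      enc (nth_default (dec 0) (l x) i) = enc (nth_default (dec 0) (l x) j) \<longrightarrow> i = j)"
    by (intro computable_intros assms computable_comp[OF assms])
  moreover have "(\<forall>i<length xs. \<forall>j<length xs.
      enc (nth_default (dec 0) xs i) = enc (nth_default (dec 0) xs j) \<longrightarrow> i = j) \<longleftrightarrow> distinct xs"
    for xs :: "'b list"
    by (auto simp: distinct_conv_nth)
  ultimately show ?thesis by simp
qed

text \<open>The only use of minimisation besides the decoding of pairs.  The result need not be computable as a total
  function, as the program diverges where no \<open>k\<close> exists.\<close>

lemma unbounded_search:
  fixes P :: "'a :: coded \<Rightarrow> 'b :: coded \<Rightarrow> bool"
  assumes "decidable (\<lambda>p. P (fst p) (snd p))"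
  shows "\<exists>A. \<forall>x. (\<exists>k. P x k) \<longrightarrow> (\<exists>k. P x k \<and> computes A [enc x] (enc k))"
proof -
  have "computable (\<lambda>p. if P (fst p) (snd p) then 0 else Suc 0)"
    by (intro computable_intros assms)
  then obtain A where "\<And>x k. computes A [enc (x, k)] (if P x k then 0 else Suc 0)"
    by (fastforce simp: computable_def)
  from this[of _ "dec _"]
  have A: "computes A [prod_encode (enc x, k)] (if P x (dec k) then 0 else Suc 0)" for x k
    by (simp add: enc_Pair)
  let ?f = "Comp A [Comp pair_prog [Proj 1, Proj 0]]"
  have f: "computes ?f [k, enc x] (if P x (dec k) then 0 else Suc 0)" for x k
    by (rule computes_intros computes_pair A)+
  have "\<exists>k. P x k \<and> computes (Mu ?f) [enc x] (enc k)" if "P x k0" for x k0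
  proof -
    define k where "k = (LEAST k. P x (dec k))"
    have k: "P x (dec k)"
      unfolding k_def by (rule LeastI[of "\<lambda>k. P x (dec k)" "enc k0"]) (use that in simp)
    have "\<not> P x (dec i)" if "i < k" for i
      using not_less_Least that unfolding k_def by blast
    with f[of _ x] have "\<forall>i<k. \<exists>y. computes ?f [i, enc x] (Suc y)" by metis
    moreover from f[of k x] k have "computes ?f [k, enc x] 0" by simp
    ultimately have "computes (Mu ?f) [enc x] k" by (rule computes.Mu[rotated])
    with k show ?thesis by (metis enc_dec)
  qed
  then show ?thesis by blast
qed

section \<open>Iterated sums in an abelian monoid\<close>

lemma (in abelian_monoid) finsum_Sigma:
  assumes "finite I" "\<And>i. i \<in> I \<Longrightarrow> finite (A i)"
    and "\<And>i a. i \<in> I \<Longrightarrow> a \<in> A i \<Longrightarrow> f i a \<in> carrier G"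
  shows "(\<Oplus>i\<in>I. \<Oplus>a\<in>A i. f i a) = (\<Oplus>p\<in>Sigma I A. f (fst p) (snd p))"
proof -
  have "(\<Oplus>p\<in>Sigma I A. f (fst p) (snd p)) = (\<Oplus>p\<in>(\<Union>i\<in>I. Pair i ` A i). f (fst p) (snd p))"
    by (rule arg_cong[of _ _ "finsum G _"]) auto
  also have "\<dots> = (\<Oplus>i\<in>I. \<Oplus>p\<in>Pair i ` A i. f (fst p) (snd p))"
    using assms by (intro add.finprod_UN_disjoint) (auto simp: pairwise_def disjnt_def)
  also have "\<dots> = (\<Oplus>i\<in>I. \<Oplus>a\<in>A i. f i a)"
  proof (intro finsum_cong' refl)
    fix i assume "i \<in> I"
    with assms(3) show "(\<Oplus>p\<in>Pair i ` A i. f (fst p) (snd p)) = (\<Oplus>a\<in>A i. f i a)"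
      by (subst finsum_reindex) (auto simp: inj_on_def)
  qed (use assms(3) in auto)
  finally show ?thesis ..
qed

lemma (in abelian_monoid) finsum_swap:
  assumes "finite I" "finite J" "\<And>i j. i \<in> I \<Longrightarrow> j \<in> J \<Longrightarrow> f i j \<in> carrier G"
  shows "(\<Oplus>i\<in>I. \<Oplus>j\<in>J. f i j) = (\<Oplus>j\<in>J. \<Oplus>i\<in>I. f i j)"
proof -
  have "(\<Oplus>i\<in>I. \<Oplus>j\<in>J. f i j) = (\<Oplus>p\<in>I \<times> J. f (fst p) (snd p))"
    using assms by (intro finsum_Sigma)
  also have "\<dots> = (\<Oplus>p\<in>prod.swap ` (J \<times> I). f (fst p) (snd p))"
    by (simp only: product_swap)
  also have "\<dots> = (\<Oplus>p\<in>J \<times> I. f (snd p) (fst p))"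
    using assms by (subst finsum_reindex) auto
  also have "\<dots> = (\<Oplus>j\<in>J. \<Oplus>i\<in>I. f i j)"
    using assms by (intro finsum_Sigma[symmetric])
  finally show ?thesis .
qed

section \<open>Kronecker substitution\<close>

definition weight :: "nat \<Rightarrow> nat multiset \<Rightarrow> nat" where
  "weight B M = (\<Sum>i\<in>#M. B ^ i)"

lemma weight_empty [simp]: "weight B {#} = 0"
  and weight_add: "weight B (M + N) = weight B M + weight B N"
  by (simp_all add: weight_def)

lemma size_le_weight: "B > 0 \<Longrightarrow> size M \<le> weight B M"
proof (induction M)
  case (add i M)
  have "weight B (add_mset i M) = B ^ i + weight B M" by (simp add: weight_def)
  moreover have "Suc 0 \<le> B ^ i" using add.prems by (simp add: Suc_le_eq)
  ultimately show ?case using add.IH[OF add.prems] by (simp only: size_add_mset)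
qed simp

lemma base_digits_unique:
  fixes B :: nat
  assumes "\<And>i. i < m \<Longrightarrow> a i < B" "\<And>i. i < m \<Longrightarrow> b i < B"
    and "(\<Sum>i<m. a i * B ^ i) = (\<Sum>i<m. b i * B ^ i)" "i < m"
  shows "a i = b i"
  using assms
proof (induction m arbitrary: a b i)
  case (Suc m)
  have shift: "(\<Sum>i<Suc m. c i * B ^ i) = c 0 + B * (\<Sum>i<m. c (Suc i) * B ^ i)" for c :: "nat \<Rightarrow> nat"
    by (simp only: sum.lessThan_Suc_shift) (simp add: sum_distrib_left algebra_simps)
  have eq: "a 0 + B * (\<Sum>i<m. a (Suc i) * B ^ i) = b 0 + B * (\<Sum>i<m. b (Suc i) * B ^ i)"
    using Suc.prems(3) by (simp only: shift)
  have lt: "a 0 < B" "b 0 < B" using Suc.prems by auto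
  have "a 0 = (a 0 + B * (\<Sum>i<m. a (Suc i) * B ^ i)) mod B" using lt by simp
  also have "\<dots> = b 0" using lt by (simp add: eq)
  finally have 0: "a 0 = b 0" .
  with eq lt have "(\<Sum>i<m. a (Suc i) * B ^ i) = (\<Sum>i<m. b (Suc i) * B ^ i)" by simp
  then have "a (Suc i) = b (Suc i)" if "i < m" for i
    using that Suc.prems(1,2) by (intro Suc.IH[of "\<lambda>i. a (Suc i)" "\<lambda>i. b (Suc i)"]) auto
  with 0 Suc.prems(4) show ?case by (cases i) auto
qed simp

lemma weight_conv_sum:
  assumes "set_mset M \<subseteq> {..<m}"
  shows "weight B M = (\<Sum>i<m. count M i * B ^ i)"
  using assms
proof (induction M)
  case (add j M)
  then have "(\<Sum>i<m. count (add_mset j M) i * B ^ i)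
      = (\<Sum>i<m. count M i * B ^ i + (if i = j then B ^ j else 0))"
    by (intro sum.cong) auto
  also have "\<dots> = (\<Sum>i<m. count M i * B ^ i) + B ^ j"
    using add.prems by (simp add: sum.distrib)
  finally show ?case using add by (simp add: weight_def)
qed (simp add: weight_def)

lemma weight_inj:
  assumes "set_mset M \<subseteq> {..<m}" "set_mset N \<subseteq> {..<m}" "\<And>i. count M i < B" "\<And>i. count N i < B"
    and "weight B M = weight B N"
  shows "M = N"
proof (rule multiset_eqI)
  fix i
  show "count M i = count N i"
  proof (cases "i < m")
    case True
    with assms show ?thesis
      by (intro base_digits_unique[of m "count M" B "count N"]) (simp_all add: weight_conv_sum)
  next
    case False
    with assms(1,2) have "i \<notin># M" "i \<notin># N" by auto
    then show ?thesis by (simp add: not_in_iff)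
  qed
qed

text \<open>For \<open>B > 0\<close> every variable has positive weight, which makes these sets finite: the substitution
  is defined coefficient by coefficient, as for power series.\<close>

definition weight_fiber :: "nat \<Rightarrow> nat \<Rightarrow> nat \<Rightarrow> nat multiset set" where
  "weight_fiber B m k = {M. set_mset M \<subseteq> {..<m} \<and> weight B M = k}"

lemma finite_weight_fiber [simp]:
  assumes "B > 0"
  shows "finite (weight_fiber B m k)"
proof (rule finite_subset)
  show "weight_fiber B m k \<subseteq> mset ` {xs. set xs \<subseteq> {..<m} \<and> length xs \<le> k}"
  proof
    fix M assume M: "M \<in> weight_fiber B m k"
    obtain xs where "mset xs = M" using ex_mset by blast
    with M size_le_weight[OF assms, of M] show "M \<in> mset ` {xs. set xs \<subseteq> {..<m} \<and> length xs \<le> k}"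
      by (auto simp: weight_fiber_def)
  qed
  show "finite (mset ` {xs. set xs \<subseteq> {..<m} \<and> length xs \<le> k})"
    by (intro finite_imageI finite_lists_length_le) simp
qed

text \<open>The substitution \<open>X\<^sub>i := T ^ (B ^ i)\<close>: the monomials of weight \<open>k\<close> become \<open>T ^ k\<close>.\<close>

definition kronecker :: "('a, 'b) ring_scheme \<Rightarrow> nat \<Rightarrow> nat \<Rightarrow> (nat multiset \<Rightarrow> 'a) \<Rightarrow> nat \<Rightarrow> 'a" where
  "kronecker R B m P = (\<lambda>k. \<Oplus>\<^bsub>R\<^esub>M\<in>weight_fiber B m k. P M)"

context cring
begin

lemma mpoly_carrier_single:
  assumes "c \<in> carrier R" "set_mset M \<subseteq> {..<m}"
  shows "(\<lambda>N. if N = M then c else \<zero>) \<in> carrier (mpoly_ring R m)"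
  using assms(2)
proof (induction M)
  case empty
  have "indexed_const c \<in> carrier (mpoly_ring R m)"
    using assms(1) by (auto simp: mpoly_ring_def intro: indexed_pset.indexed_const)
  then show ?case by (simp add: indexed_const_def)
next
  case (add i M)
  have "(\<lambda>N. if N = add_mset i M then c else \<zero>)
      = indexed_pmult (\<lambda>N. if N = M then c else \<zero>) i"
    by (auto simp: indexed_pmult_def fun_eq_iff dest!: multi_member_split)
  with add show ?case
    by (auto simp: mpoly_ring_def intro: indexed_pset.indexed_pmult)
qed

text \<open>The inductive carrier consists of the coefficient functions of finite support; in this form closure under
  multiplication is visible.\<close>

lemma mpoly_carrier_iff:
  "P \<in> carrier (mpoly_ring R m) \<longleftrightarrow>
     (\<forall>M. P M \<in> carrier R) \<and> finite {M. P M \<noteq> \<zero>} \<and> (\<forall>M. P M \<noteq> \<zero> \<longrightarrow> set_mset M \<subseteq> {..<m})"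
proof
  assume "P \<in> carrier (mpoly_ring R m)"
  then have "P \<in> indexed_pset {..<m} (carrier R)" by (simp add: mpoly_ring_def)
  then show "(\<forall>M. P M \<in> carrier R) \<and> finite {M. P M \<noteq> \<zero>} \<and> (\<forall>M. P M \<noteq> \<zero> \<longrightarrow> set_mset M \<subseteq> {..<m})"
  proof (induction rule: indexed_pset.induct)
    case (indexed_const k)
    have "{M :: nat multiset. indexed_const k M \<noteq> \<zero>} \<subseteq> {{#}}" by (auto simp: indexed_const_def)
    with indexed_const show ?case
      by (auto simp: indexed_const_def dest: finite_subset)
  next
    case (indexed_padd P Q)
    have "{M. indexed_padd P Q M \<noteq> \<zero>} \<subseteq> {M. P M \<noteq> \<zero>} \<union> {M. Q M \<noteq> \<zero>}"
      by (auto simp: indexed_padd_def)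
    with indexed_padd have "finite {M. indexed_padd P Q M \<noteq> \<zero>}" by (auto dest: finite_subset)
    moreover have "set_mset M \<subseteq> {..<m}" if "indexed_padd P Q M \<noteq> \<zero>" for M
    proof -
      from that have "P M \<noteq> \<zero> \<or> Q M \<noteq> \<zero>" by (auto simp: indexed_padd_def)
      with indexed_padd.IH show ?thesis by blast
    qed
    ultimately show ?case using indexed_padd.IH by (simp add: indexed_padd_def)
  next
    case (indexed_pmult P i)
    have "{M. indexed_pmult P i M \<noteq> \<zero>} \<subseteq> add_mset i ` {M. P M \<noteq> \<zero>}"
      by (auto simp: indexed_pmult_def image_iff split: if_splits) (metis insert_DiffM)
    with indexed_pmult have "finite {M. indexed_pmult P i M \<noteq> \<zero>}"
      by (meson finite_imageI finite_subset)
    moreover have "set_mset M \<subseteq> {..<m}" if "indexed_pmult P i M \<noteq> \<zero>" for M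
    proof -
      from that have "i \<in># M" "P (M - {#i#}) \<noteq> \<zero>" by (auto simp: indexed_pmult_def split: if_splits)
      with indexed_pmult have "set_mset (M - {#i#}) \<subseteq> {..<m}" "i < m" by auto
      with \<open>i \<in># M\<close> show ?thesis
        by (metis insert_DiffM insert_subset lessThan_iff set_mset_add_mset_insert)
    qed
    ultimately show ?case using indexed_pmult by (auto simp: indexed_pmult_def)
  qed
next
  assume P: "(\<forall>M. P M \<in> carrier R) \<and> finite {M. P M \<noteq> \<zero>} \<and> (\<forall>M. P M \<noteq> \<zero> \<longrightarrow> set_mset M \<subseteq> {..<m})"
  have "(\<lambda>M. if M \<in> F then P M else \<zero>) \<in> carrier (mpoly_ring R m)" if "finite F" "F \<subseteq> {M. P M \<noteq> \<zero>}" for F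
    using that
  proof (induction F)
    case empty
    then show ?case using mpoly_carrier_single[of \<zero> "{#}" m] by simp
  next
    case (insert M F)
    then have "(\<lambda>N. if N = M then P M else \<zero>) \<in> carrier (mpoly_ring R m)"
      using P by (intro mpoly_carrier_single) auto
    with insert have "indexed_padd (\<lambda>N. if N = M then P M else \<zero>) (\<lambda>M. if M \<in> F then P M else \<zero>)
        \<in> carrier (mpoly_ring R m)"
      by (auto simp: mpoly_ring_def intro: indexed_pset.indexed_padd)
    also have "indexed_padd (\<lambda>N. if N = M then P M else \<zero>) (\<lambda>M. if M \<in> F then P M else \<zero>)
        = (\<lambda>N. if N \<in> insert M F then P N else \<zero>)"
      using insert.hyps P by (auto simp: indexed_padd_def)
    finally show ?case .
  qed
  from this[of "{M. P M \<noteq> \<zero>}"] P have "(\<lambda>M. if P M \<noteq> \<zero> then P M else \<zero>) \<in> carrier (mpoly_ring R m)"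
    by simp
  moreover have "(\<lambda>M. if P M \<noteq> \<zero> then P M else \<zero>) = P" by auto
  ultimately show "P \<in> carrier (mpoly_ring R m)" by simp
qed

lemma mpoly_closed: "P \<in> carrier (mpoly_ring R m) \<Longrightarrow> P M \<in> carrier R"
  by (simp add: mpoly_carrier_iff)

lemma mpoly_add: "(P \<oplus>\<^bsub>mpoly_ring R m\<^esub> Q) M = P M \<oplus> Q M"
  by (simp add: mpoly_ring_def indexed_padd_def)

lemma mpoly_mult:
  "(P \<otimes>\<^bsub>mpoly_ring R m\<^esub> Q) M = (\<Oplus>A\<in>{A. A \<subseteq># M}. P A \<otimes> Q (M - A))"
  by (simp add: mpoly_ring_def)

lemma mpoly_zero: "\<zero>\<^bsub>mpoly_ring R m\<^esub> M = \<zero>"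
  by (simp add: mpoly_ring_def indexed_const_def)

lemma mpoly_one: "\<one>\<^bsub>mpoly_ring R m\<^esub> M = (if M = {#} then \<one> else \<zero>)"
  by (simp add: mpoly_ring_def indexed_const_def)

lemma mpoly_add_closed:
  assumes "P \<in> carrier (mpoly_ring R m)" "Q \<in> carrier (mpoly_ring R m)"
  shows "P \<oplus>\<^bsub>mpoly_ring R m\<^esub> Q \<in> carrier (mpoly_ring R m)"
  using assms by (auto simp: mpoly_ring_def intro: indexed_pset.indexed_padd)

lemma mpoly_zero_closed: "\<zero>\<^bsub>mpoly_ring R m\<^esub> \<in> carrier (mpoly_ring R m)"
  and mpoly_one_closed: "\<one>\<^bsub>mpoly_ring R m\<^esub> \<in> carrier (mpoly_ring R m)"
  by (auto simp: mpoly_ring_def intro: indexed_pset.indexed_const)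

lemma finite_submultisets: "finite {A. A \<subseteq># M}"
proof (rule finite_subset)
  show "{A. A \<subseteq># M} \<subseteq> mset ` {xs. set xs \<subseteq> set_mset M \<and> length xs \<le> size M}"
  proof
    fix A assume A: "A \<in> {A. A \<subseteq># M}"
    obtain xs where "mset xs = A" using ex_mset by blast
    with A show "A \<in> mset ` {xs. set xs \<subseteq> set_mset M \<and> length xs \<le> size M}"
      using set_mset_mono[of A M] size_mset_mono[of A M] by auto
  qed
  show "finite (mset ` {xs. set xs \<subseteq> set_mset M \<and> length xs \<le> size M})"
    by (intro finite_imageI finite_lists_length_le) simp
qed

lemma mpoly_mult_closed:
  assumes P: "P \<in> carrier (mpoly_ring R m)" and Q: "Q \<in> carrier (mpoly_ring R m)"
  shows "P \<otimes>\<^bsub>mpoly_ring R m\<^esub> Q \<in> carrier (mpoly_ring R m)"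
proof -
  let ?PQ = "P \<otimes>\<^bsub>mpoly_ring R m\<^esub> Q"
  have nz: "\<exists>A. A \<subseteq># M \<and> P A \<noteq> \<zero> \<and> Q (M - A) \<noteq> \<zero>" if "?PQ M \<noteq> \<zero>" for M
  proof (rule ccontr)
    assume neg: "\<not> ?thesis"
    have "P A \<otimes> Q (M - A) = \<zero>" if "A \<subseteq># M" for A
      using neg that mpoly_closed[OF P, of A] mpoly_closed[OF Q, of "M - A"] by (metis l_null r_null)
    then have "(\<Oplus>A\<in>{A. A \<subseteq># M}. P A \<otimes> Q (M - A)) = (\<Oplus>A\<in>{A. A \<subseteq># M}. \<zero>)"
      by (intro finsum_cong') auto
    with that show False by (simp add: mpoly_mult)
  qed
  have "{M. ?PQ M \<noteq> \<zero>} \<subseteq> (\<lambda>(A, C). A + C) ` ({M. P M \<noteq> \<zero>} \<times> {M. Q M \<noteq> \<zero>})"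
  proof
    fix M assume "M \<in> {M. ?PQ M \<noteq> \<zero>}"
    with nz obtain A where "A \<subseteq># M" "P A \<noteq> \<zero>" "Q (M - A) \<noteq> \<zero>" by blast
    then show "M \<in> (\<lambda>(A, C). A + C) ` ({M. P M \<noteq> \<zero>} \<times> {M. Q M \<noteq> \<zero>})"
      by (intro image_eqI[of _ _ "(A, M - A)"]) auto
  qed
  then have "finite {M. ?PQ M \<noteq> \<zero>}"
    by (rule finite_subset) (use P Q in \<open>auto simp: mpoly_carrier_iff\<close>)
  moreover have "set_mset M \<subseteq> {..<m}" if nz': "?PQ M \<noteq> \<zero>" for M
  proof -
    from nz[OF nz'] obtain A where A: "A \<subseteq># M" "P A \<noteq> \<zero>" "Q (M - A) \<noteq> \<zero>" by blast
    then have "set_mset A \<subseteq> {..<m}" "set_mset (M - A) \<subseteq> {..<m}"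
      using P Q unfolding mpoly_carrier_iff by blast+
    then have "set_mset (A + (M - A)) \<subseteq> {..<m}" by simp
    with A(1) show ?thesis by simp
  qed
  moreover have "?PQ M \<in> carrier R" for M
    using mpoly_closed[OF P] mpoly_closed[OF Q] by (simp add: mpoly_mult Pi_def)
  ultimately show ?thesis by (simp add: mpoly_carrier_iff)
qed

lemma kronecker_closed:
  assumes "P \<in> carrier (mpoly_ring R m)" "B > 0"
  shows "kronecker R B m P \<in> carrier (UP R)"
proof -
  let ?S = "weight B ` {M. P M \<noteq> \<zero>}"
  have fin: "finite ?S" using assms(1) by (simp add: mpoly_carrier_iff)
  have "kronecker R B m P k = \<zero>" if "Max (insert 0 ?S) < k" for k
  proof -
    have "P M = \<zero>" if "M \<in> weight_fiber B m k" for M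
      using that fin \<open>Max (insert 0 ?S) < k\<close> by (auto simp: weight_fiber_def)
    then show ?thesis by (simp add: kronecker_def cong: finsum_cong)
  qed
  then have "bound \<zero> (Max (insert 0 ?S)) (kronecker R B m P)" by (auto intro: bound.intro)
  moreover have "kronecker R B m P k \<in> carrier R" for k
    using mpoly_closed[OF assms(1)] by (auto simp: kronecker_def intro!: finsum_closed)
  ultimately show ?thesis by (auto simp: UP_def up_def)
qed

lemma kronecker_add:
  assumes "P \<in> carrier (mpoly_ring R m)" "Q \<in> carrier (mpoly_ring R m)" "B > 0"
  shows "kronecker R B m (P \<oplus>\<^bsub>mpoly_ring R m\<^esub> Q) = kronecker R B m P \<oplus>\<^bsub>UP R\<^esub> kronecker R B m Q"
proof
  fix k
  have "kronecker R B m (P \<oplus>\<^bsub>mpoly_ring R m\<^esub> Q) k = kronecker R B m P k \<oplus> kronecker R B m Q k"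
    using mpoly_closed assms by (simp add: kronecker_def mpoly_add finsum_addf Pi_def)
  then show "kronecker R B m (P \<oplus>\<^bsub>mpoly_ring R m\<^esub> Q) k = (kronecker R B m P \<oplus>\<^bsub>UP R\<^esub> kronecker R B m Q) k"
    using kronecker_closed[OF assms(1,3)] kronecker_closed[OF assms(2,3)] by (simp add: UP_def)
qed

lemma kronecker_one:
  assumes "B > 0"
  shows "kronecker R B m \<one>\<^bsub>mpoly_ring R m\<^esub> = \<one>\<^bsub>UP R\<^esub>"
proof
  fix k
  have empty: "M = {#}" if "M \<in> weight_fiber B m 0" for M
    using that size_le_weight[OF assms, of M] by (auto simp: weight_fiber_def)
  have "kronecker R B m \<one>\<^bsub>mpoly_ring R m\<^esub> k = (if k = 0 then \<one> else \<zero>)"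
  proof (cases "k = 0")
    case True
    have "weight_fiber B m 0 = {{#}}" using empty by (auto simp: weight_fiber_def)
    with True show ?thesis by (simp add: kronecker_def mpoly_one)
  next
    case False
    then have "{#} \<notin> weight_fiber B m k" by (simp add: weight_fiber_def)
    then have "kronecker R B m \<one>\<^bsub>mpoly_ring R m\<^esub> k = (\<Oplus>M\<in>weight_fiber B m k. \<zero>)"
      unfolding kronecker_def by (intro finsum_cong') (auto simp: mpoly_one)
    with False show ?thesis by simp
  qed
  then show "kronecker R B m \<one>\<^bsub>mpoly_ring R m\<^esub> k = \<one>\<^bsub>UP R\<^esub> k" by (simp add: UP_def)
qed

text \<open>Both sides sum \<open>P A \<otimes> Q C\<close> over the pairs of monomials with total weight \<open>k\<close>, grouped by the product of
  the monomials on the left and by the weight of \<open>A\<close> on the right.\<close>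

lemma kronecker_mult:
  assumes P: "P \<in> carrier (mpoly_ring R m)" and Q: "Q \<in> carrier (mpoly_ring R m)" and B: "B > 0"
  shows "kronecker R B m (P \<otimes>\<^bsub>mpoly_ring R m\<^esub> Q) = kronecker R B m P \<otimes>\<^bsub>UP R\<^esub> kronecker R B m Q"
proof
  fix k
  note cl [simp] = mpoly_closed[OF P] mpoly_closed[OF Q]
  let ?F = "weight_fiber B m"
  let ?f = "\<lambda>p. P (fst p) \<otimes> Q (snd p)"
  let ?S = "Sigma (?F k) (\<lambda>M. {A. A \<subseteq># M})"
  let ?T = "Sigma {..k} (\<lambda>i. ?F i \<times> ?F (k - i))"
  let ?U = "{(A, C). set_mset A \<subseteq> {..<m} \<and> set_mset C \<subseteq> {..<m} \<and> weight B A + weight B C = k}"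
  have S: "(\<lambda>(M, A). (A, M - A)) ` ?S = ?U"
  proof (intro equalityI subsetI)
    fix p assume "p \<in> (\<lambda>(M, A). (A, M - A)) ` ?S"
    then obtain M A where p: "p = (A, M - A)" "set_mset M \<subseteq> {..<m}" "weight B M = k" "A \<subseteq># M"
      by (auto simp: weight_fiber_def)
    moreover have "weight B A + weight B (M - A) = weight B M"
      using p(4) by (simp add: weight_add[symmetric])
    ultimately show "p \<in> ?U" using set_mset_mono[OF p(4)] in_diffD[of _ M A] by fastforce
  next
    fix p assume "p \<in> ?U"
    then obtain A C where "p = (A, C)" "set_mset A \<subseteq> {..<m}" "set_mset C \<subseteq> {..<m}"
      "weight B A + weight B C = k" by blast
    then show "p \<in> (\<lambda>(M, A). (A, M - A)) ` ?S"
      by (intro image_eqI[of _ _ "(A + C, A)"]) (auto simp: weight_fiber_def weight_add)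
  qed
  have T: "snd ` ?T = ?U"
    by (auto simp: weight_fiber_def image_iff)
  have injS: "inj_on (\<lambda>(M, A). (A, M - A)) ?S"
  proof (rule inj_onI, clarsimp)
    fix M M' A :: "nat multiset"
    assume "A \<subseteq># M" "A \<subseteq># M'" "M - A = M' - A"
    then show "M = M'" by (metis subset_mset.diff_add)
  qed
  have injT: "inj_on snd ?T"
    by (auto simp: inj_on_def weight_fiber_def)
  have "kronecker R B m (P \<otimes>\<^bsub>mpoly_ring R m\<^esub> Q) k
      = (\<Oplus>M\<in>?F k. \<Oplus>A\<in>{A. A \<subseteq># M}. P A \<otimes> Q (M - A))"
    by (simp add: kronecker_def mpoly_mult)
  also have "\<dots> = (\<Oplus>p\<in>?S. P (snd p) \<otimes> Q (fst p - snd p))"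
    using B by (intro finsum_Sigma) (auto simp: finite_submultisets)
  also have "\<dots> = (\<Oplus>p\<in>?S. ?f ((\<lambda>(M, A). (A, M - A)) p))"
    by (simp add: case_prod_beta)
  also have "\<dots> = (\<Oplus>p\<in>?U. ?f p)"
    using injS by (subst finsum_reindex[symmetric]) (auto simp: S)
  also have "\<dots> = (\<Oplus>p\<in>?T. ?f (snd p))"
    using injT by (subst finsum_reindex[symmetric]) (auto simp: T)
  also have "\<dots> = (\<Oplus>i\<in>{..k}. \<Oplus>p\<in>?F i \<times> ?F (k - i). ?f p)"
    using B by (intro finsum_Sigma[symmetric]) auto
  also have "\<dots> = (\<Oplus>i\<in>{..k}. \<Oplus>A\<in>?F i. \<Oplus>C\<in>?F (k - i). P A \<otimes> Q C)"
    using B by (intro finsum_cong' refl) (auto intro!: finsum_closed finsum_Sigma[symmetric])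
  also have "\<dots> = (\<Oplus>i\<in>{..k}. kronecker R B m P i \<otimes> kronecker R B m Q (k - i))"
  proof (intro finsum_cong' refl)
    fix i
    have "(\<Oplus>A\<in>?F i. \<Oplus>C\<in>?F (k - i). P A \<otimes> Q C) = (\<Oplus>A\<in>?F i. P A \<otimes> (\<Oplus>C\<in>?F (k - i). Q C))"
      using B by (simp add: finsum_rdistr Pi_def)
    also have "\<dots> = kronecker R B m P i \<otimes> kronecker R B m Q (k - i)"
      using B by (simp add: kronecker_def finsum_ldistr Pi_def finsum_closed)
    finally show "(\<Oplus>A\<in>?F i. \<Oplus>C\<in>?F (k - i). P A \<otimes> Q C)
        = kronecker R B m P i \<otimes> kronecker R B m Q (k - i)" .
  qed (use B in \<open>auto simp: kronecker_def intro!: finsum_closed\<close>)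
  finally show "kronecker R B m (P \<otimes>\<^bsub>mpoly_ring R m\<^esub> Q) k
      = (kronecker R B m P \<otimes>\<^bsub>UP R\<^esub> kronecker R B m Q) k"
    using kronecker_closed[OF P B] kronecker_closed[OF Q B] by (simp add: UP_def)
qed

end

context cring
begin

lemma kronecker_zero: "kronecker R B m \<zero>\<^bsub>mpoly_ring R m\<^esub> = \<zero>\<^bsub>UP R\<^esub>"
  by (simp add: kronecker_def mpoly_zero UP_def)

text \<open>If the exponents are digits in base \<open>B\<close>, then a monomial that occurs is the only one of its weight, and its
  coefficient can be read off after the substitution.\<close>

lemma kronecker_inj:
  assumes P: "P \<in> carrier (mpoly_ring R m)" and Q: "Q \<in> carrier (mpoly_ring R m)" and B: "B > 0"
    and small: "\<And>M i. P M \<noteq> \<zero> \<or> Q M \<noteq> \<zero> \<Longrightarrow> count M i < B"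
    and eq: "kronecker R B m P = kronecker R B m Q"
  shows "P = Q"
proof (rule ccontr)
  assume "P \<noteq> Q"
  then obtain M where M: "P M \<noteq> Q M" by blast
  then have nz: "P M \<noteq> \<zero> \<or> Q M \<noteq> \<zero>" by auto
  have vars: "set_mset N \<subseteq> {..<m}" if "P N \<noteq> \<zero> \<or> Q N \<noteq> \<zero>" for N
    using that P Q unfolding mpoly_carrier_iff by blast
  have coeff: "kronecker R B m S (weight B M) = S M" if "S = P \<or> S = Q" for S
  proof -
    have S: "S N \<in> carrier R" for N using that mpoly_closed[OF P] mpoly_closed[OF Q] by auto
    have "S N = (if M = N then S N else \<zero>)" if N: "N \<in> weight_fiber B m (weight B M)" for N
    proof (cases "S N = \<zero>")
      case False
      then have "P N \<noteq> \<zero> \<or> Q N \<noteq> \<zero>" using \<open>S = P \<or> S = Q\<close> by auto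
      with N have "M = N" using vars[OF nz] small[OF nz] small[of N]
        by (intro weight_inj[of M m N B]) (auto simp: weight_fiber_def)
      then show ?thesis by simp
    qed simp
    then have "kronecker R B m S (weight B M)
        = (\<Oplus>N\<in>weight_fiber B m (weight B M). if M = N then S N else \<zero>)"
      unfolding kronecker_def by (intro finsum_cong') (use S in auto)
    also have "\<dots> = S M"
      using vars[OF nz] S B by (intro finsum_singleton) (simp_all add: weight_fiber_def[of B m "weight B M"]
          finite_weight_fiber[unfolded weight_fiber_def])
    finally show ?thesis .
  qed
  from eq coeff[of P] coeff[of Q] M show False by simp
qed

lemma exponents_bounded:
  assumes "finite E" "E \<subseteq> carrier (mpoly_ring R m)"
  shows "\<exists>B>0. \<forall>P\<in>E. \<forall>M. P M \<noteq> \<zero> \<longrightarrow> (\<forall>i. count M i < B)"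
proof -
  let ?S = "\<Union>P\<in>E. {M. P M \<noteq> \<zero>}"
  have fin: "finite ?S" using assms by (auto simp: mpoly_carrier_iff)
  define B where "B = Suc (Max (insert 0 (size ` ?S)))"
  have "count M i < B" if "P \<in> E" "P M \<noteq> \<zero>" for P M i
  proof -
    have "size M \<le> Max (insert 0 (size ` ?S))" using fin that by (intro Max_ge) auto
    with count_le_size[of M i] show ?thesis by (simp add: B_def)
  qed
  then show ?thesis by (intro exI[of _ B]) (auto simp: B_def)
qed

text \<open>For two given polynomials some \<open>B\<close> exceeds all exponents.  So an identity between polynomials in several
  variables follows from the identities in one variable that the substitutions make of it.\<close>

lemma mpoly_eqI:
  assumes "P \<in> carrier (mpoly_ring R m)" "Q \<in> carrier (mpoly_ring R m)"
    and "\<And>B. B > 0 \<Longrightarrow> kronecker R B m P = kronecker R B m Q"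
  shows "P = Q"
proof -
  obtain B where "B > 0" "\<forall>S\<in>{P, Q}. \<forall>M. S M \<noteq> \<zero> \<longrightarrow> (\<forall>i. count M i < B)"
    using exponents_bounded[of "{P, Q}" m] assms(1,2) by auto
  with assms show ?thesis by (intro kronecker_inj[of P m Q B]) auto
qed

lemma mpoly_cring: "cring (mpoly_ring R m)"
proof -
  let ?A = "mpoly_ring R m"
  interpret U: UP_cring R "UP R" by unfold_locales simp
  note closed [simp, intro] = mpoly_add_closed mpoly_mult_closed mpoly_zero_closed mpoly_one_closed
    kronecker_closed
  note hom [simp] = kronecker_add kronecker_mult kronecker_zero kronecker_one
  show ?thesis
  proof (rule cringI)
    show "abelian_group ?A"
    proof (rule abelian_groupI)
      fix P assume P: "P \<in> carrier ?A"
      have "{M. \<ominus> P M \<noteq> \<zero>} \<subseteq> {M. P M \<noteq> \<zero>}" by auto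
      with P have neg: "(\<lambda>M. \<ominus> P M) \<in> carrier ?A"
        by (auto simp: mpoly_carrier_iff dest: finite_subset)
      have "(\<lambda>M. \<ominus> P M) \<oplus>\<^bsub>?A\<^esub> P = \<zero>\<^bsub>?A\<^esub>"
        by (rule ext) (use mpoly_closed[OF P] in \<open>simp add: mpoly_add mpoly_zero l_neg\<close>)
      with neg show "\<exists>Q\<in>carrier ?A. Q \<oplus>\<^bsub>?A\<^esub> P = \<zero>\<^bsub>?A\<^esub>" by blast
    next
      fix P Q S
      assume "P \<in> carrier ?A" "Q \<in> carrier ?A" "S \<in> carrier ?A"
      then show "P \<oplus>\<^bsub>?A\<^esub> Q \<oplus>\<^bsub>?A\<^esub> S
          = P \<oplus>\<^bsub>?A\<^esub> (Q \<oplus>\<^bsub>?A\<^esub> S)"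
        by (intro mpoly_eqI[of _ m]) (auto simp: U.P.a_assoc)
    next
      fix P Q
      assume "P \<in> carrier ?A" "Q \<in> carrier ?A"
      then show "P \<oplus>\<^bsub>?A\<^esub> Q = Q \<oplus>\<^bsub>?A\<^esub> P"
        by (intro mpoly_eqI[of _ m]) (auto simp: U.P.a_comm)
    next
      fix P assume "P \<in> carrier ?A"
      then show "\<zero>\<^bsub>?A\<^esub> \<oplus>\<^bsub>?A\<^esub> P = P"
        by (intro mpoly_eqI[of _ m]) auto
    qed auto
    show "comm_monoid ?A"
    proof (rule comm_monoidI)
      fix P Q S
      assume "P \<in> carrier ?A" "Q \<in> carrier ?A" "S \<in> carrier ?A"
      then show "P \<otimes>\<^bsub>?A\<^esub> Q \<otimes>\<^bsub>?A\<^esub> S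
          = P \<otimes>\<^bsub>?A\<^esub> (Q \<otimes>\<^bsub>?A\<^esub> S)"
        by (intro mpoly_eqI[of _ m]) (auto simp: U.P.m_assoc)
    next
      fix P Q
      assume "P \<in> carrier ?A" "Q \<in> carrier ?A"
      then show "P \<otimes>\<^bsub>?A\<^esub> Q = Q \<otimes>\<^bsub>?A\<^esub> P"
        by (intro mpoly_eqI[of _ m]) (auto simp: U.P.m_comm)
    next
      fix P assume "P \<in> carrier ?A"
      then show "\<one>\<^bsub>?A\<^esub> \<otimes>\<^bsub>?A\<^esub> P = P"
        by (intro mpoly_eqI[of _ m]) auto
    qed auto
    fix P Q S
    assume "P \<in> carrier ?A" "Q \<in> carrier ?A" "S \<in> carrier ?A"
    then show "(P \<oplus>\<^bsub>?A\<^esub> Q) \<otimes>\<^bsub>?A\<^esub> S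
        = P \<otimes>\<^bsub>?A\<^esub> S \<oplus>\<^bsub>?A\<^esub> Q \<otimes>\<^bsub>?A\<^esub> S"
      by (intro mpoly_eqI[of _ m]) (auto simp: U.P.l_distr)
  qed
qed

lemma kronecker_hom: "B > 0 \<Longrightarrow> kronecker R B m \<in> Ring.ring_hom (mpoly_ring R m) (UP R)"
  by (intro ring_hom_memI) (auto simp: kronecker_closed kronecker_add kronecker_mult kronecker_one)

end

context domain
begin

lemma mpoly_domain: "domain (mpoly_ring R m)"
proof -
  let ?A = "mpoly_ring R m"
  interpret U: UP_domain R "UP R" by unfold_locales simp
  interpret A: cring ?A by (rule mpoly_cring)
  show ?thesis
  proof (rule domainI)
    show "cring ?A" by (rule mpoly_cring)
    have "\<one>\<^bsub>?A\<^esub> {#} \<noteq> \<zero>\<^bsub>?A\<^esub> {#}"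
      by (simp add: mpoly_one mpoly_zero)
    then show "\<one>\<^bsub>?A\<^esub> \<noteq> \<zero>\<^bsub>?A\<^esub>" by metis
    fix P Q
    assume PQ: "P \<otimes>\<^bsub>?A\<^esub> Q = \<zero>\<^bsub>?A\<^esub>"
      and P: "P \<in> carrier ?A" and Q: "Q \<in> carrier ?A"
    obtain B where B: "B > 0" and small: "\<forall>S\<in>{P, Q}. \<forall>M. S M \<noteq> \<zero> \<longrightarrow> (\<forall>i. count M i < B)"
      using exponents_bounded[of "{P, Q}" m] P Q by auto
    have "kronecker R B m P \<otimes>\<^bsub>UP R\<^esub> kronecker R B m Q = \<zero>\<^bsub>UP R\<^esub>"
      using kronecker_mult[OF P Q B] PQ by (simp add: kronecker_zero)
    then have "kronecker R B m P = \<zero>\<^bsub>UP R\<^esub> \<or> kronecker R B m Q = \<zero>\<^bsub>UP R\<^esub>"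
      using kronecker_closed[OF P B] kronecker_closed[OF Q B] domain.integral[OF U.UP_domain] by blast
    moreover have "S = \<zero>\<^bsub>?A\<^esub>" if "S \<in> {P, Q}" "kronecker R B m S = \<zero>\<^bsub>UP R\<^esub>" for S
      using that small P Q B
      by (intro kronecker_inj[of S m _ B]) (auto simp: kronecker_zero mpoly_zero)
    ultimately show "P = \<zero>\<^bsub>?A\<^esub> \<or> Q = \<zero>\<^bsub>?A\<^esub>" by blast
  qed
qed

end

section \<open>Specialisation to a finite field\<close>

text \<open>Pseudo-division multiplies the dividend by a power of the leading coefficient of \<open>g\<close>, which is a unit.\<close>

lemma (in field) UP_finite_remainder:
  assumes g: "g \<in> carrier (UP R)" "g \<noteq> \<zero>\<^bsub>UP R\<^esub>" and p: "p \<in> carrier (UP R)"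
  shows "\<exists>q r. q \<in> carrier (UP R) \<and> r \<in> carrier (UP R) \<and> deg R r \<le> deg R g \<and>
    p = g \<otimes>\<^bsub>UP R\<^esub> q \<oplus>\<^bsub>UP R\<^esub> r"
proof -
  interpret U: UP_domain R "UP R" by unfold_locales simp
  obtain q r and k :: nat where qr: "q \<in> carrier (UP R)" "r \<in> carrier (UP R)"
    "U.lcoeff g [^] k \<odot>\<^bsub>UP R\<^esub> p = g \<otimes>\<^bsub>UP R\<^esub> q \<oplus>\<^bsub>UP R\<^esub> r"
    "r = \<zero>\<^bsub>UP R\<^esub> \<or> deg R r < deg R g"
    using U.long_div_theorem[OF g(1) p g(2)] by blast
  have lc: "U.lcoeff g \<in> carrier R" "U.lcoeff g \<noteq> \<zero>"
    using U.lcoeff_closed[OF g(1)] U.lcoeff_nonzero2[OF g] by auto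
  then have "U.lcoeff g \<in> Units R" by (simp add: field_Units)
  then have "U.lcoeff g [^] k \<in> Units R" by (rule Units_pow_closed)
  then obtain u where u: "u \<in> carrier R" "u \<otimes> U.lcoeff g [^] k = \<one>"
    using lc Units_l_inv_ex by blast
  have "p = u \<odot>\<^bsub>UP R\<^esub> (U.lcoeff g [^] k \<odot>\<^bsub>UP R\<^esub> p)"
    using u lc p by (simp add: U.UP_smult_assoc1[symmetric] del: U.UP_smult_assoc1)
  also have "\<dots> = u \<odot>\<^bsub>UP R\<^esub> (q \<otimes>\<^bsub>UP R\<^esub> g) \<oplus>\<^bsub>UP R\<^esub> u \<odot>\<^bsub>UP R\<^esub> r"
    using qr(1,2) g(1) u(1) by (simp add: qr(3) U.UP_smult_r_distr U.P.m_comm)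
  also have "\<dots> = g \<otimes>\<^bsub>UP R\<^esub> (u \<odot>\<^bsub>UP R\<^esub> q) \<oplus>\<^bsub>UP R\<^esub> u \<odot>\<^bsub>UP R\<^esub> r"
    using qr(1,2) g(1) u(1) U.UP_smult_assoc2[of u q g]
    by (simp add: U.P.m_comm[of g "u \<odot>\<^bsub>UP R\<^esub> q"] del: U.UP_smult_assoc2)
  finally have "p = g \<otimes>\<^bsub>UP R\<^esub> (u \<odot>\<^bsub>UP R\<^esub> q) \<oplus>\<^bsub>UP R\<^esub> u \<odot>\<^bsub>UP R\<^esub> r" .
  moreover have "deg R (u \<odot>\<^bsub>UP R\<^esub> r) \<le> deg R g"
    using U.deg_smult_decr[OF u(1) qr(2)] qr(4) u(1) by (auto simp: U.smult_r_null)
  ultimately show ?thesis using u(1) qr(1,2) by blast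
qed

text \<open>Let \<open>g = T f + 1\<close>.  An ideal containing both \<open>f\<close> and \<open>g\<close> contains \<open>1\<close>, so that it suffices to find a maximal
  ideal containing \<open>g\<close>.  Since remainders modulo \<open>g\<close> form a finite set, only finitely many ideals contain \<open>g\<close>
  and the residue rings modulo them are finite.\<close>

lemma (in field) UP_finite_quotient:
  assumes fin: "finite (carrier R)" and f: "f \<in> carrier (UP R)" "f \<noteq> \<zero>\<^bsub>UP R\<^esub>"
  shows "\<exists>J. maximalideal J (UP R) \<and> f \<notin> J \<and> finite (carrier (UP R Quot J))"
proof -
  interpret U: UP_domain R "UP R" by unfold_locales simp
  define x where "x = up_ring.monom (UP R) \<one> 1"
  define g where "g = x \<otimes>\<^bsub>UP R\<^esub> f \<oplus>\<^bsub>UP R\<^esub> \<one>\<^bsub>UP R\<^esub>"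
  have x: "x \<in> carrier (UP R)" by (simp add: x_def)
  have g: "g \<in> carrier (UP R)" using x f(1) by (simp add: g_def)
  have coeff_xf: "up_ring.coeff (UP R) (x \<otimes>\<^bsub>UP R\<^esub> f) (n + 1) = up_ring.coeff (UP R) f n" for n
    using U.coeff_monom_mult[of \<one> f 1 n] f(1) by (simp add: x_def)
  have "up_ring.coeff (UP R) g (deg R f + 1) \<noteq> \<zero>"
    using coeff_xf[of "deg R f"] f x U.lcoeff_nonzero2[OF f] by (simp add: g_def)
  then have deg_g: "deg R f + 1 \<le> deg R g" using g by (intro U.deg_belowI)
  then have g_nz: "g \<noteq> \<zero>\<^bsub>UP R\<^esub>" by auto
  define Rep where "Rep = {r \<in> carrier (UP R). deg R r \<le> deg R g}"
  have "inj_on (\<lambda>r. map (up_ring.coeff (UP R) r) [0..<Suc (deg R g)]) Rep"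
  proof (rule inj_onI)
    fix r s assume rs: "r \<in> Rep" "s \<in> Rep"
      "map (up_ring.coeff (UP R) r) [0..<Suc (deg R g)] = map (up_ring.coeff (UP R) s) [0..<Suc (deg R g)]"
    have "up_ring.coeff (UP R) r n = up_ring.coeff (UP R) s n" for n
    proof (cases "n \<le> deg R g")
      case True
      with rs(3) show ?thesis by (auto simp: map_eq_conv)
    next
      case False
      with rs(1,2) show ?thesis by (simp add: Rep_def U.deg_aboveD)
    qed
    with rs(1,2) show "r = s" by (intro U.up_eqI) (auto simp: Rep_def)
  qed
  moreover have "(\<lambda>r. map (up_ring.coeff (UP R) r) [0..<Suc (deg R g)]) ` Rep
      \<subseteq> {xs. set xs \<subseteq> carrier R \<and> length xs = Suc (deg R g)}"
    by (auto simp: Rep_def)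
  ultimately have fin_Rep: "finite Rep"
    using finite_lists_length_eq[OF fin] by (meson inj_on_finite)
  have reduce: "\<exists>q\<in>carrier (UP R). \<exists>r\<in>Rep. p = g \<otimes>\<^bsub>UP R\<^esub> q \<oplus>\<^bsub>UP R\<^esub> r"
    if "p \<in> carrier (UP R)" for p
    using UP_finite_remainder[OF g g_nz that] by (auto simp: Rep_def)
  define \<J> where "\<J> = {J. ideal J (UP R) \<and> g \<in> J \<and> \<one>\<^bsub>UP R\<^esub> \<notin> J}"
  have mem_iff: "g \<otimes>\<^bsub>UP R\<^esub> q \<oplus>\<^bsub>UP R\<^esub> r \<in> J \<longleftrightarrow> r \<in> J"
    if "J \<in> \<J>" "q \<in> carrier (UP R)" "r \<in> carrier (UP R)" for J q r
  proof -
    interpret J: ideal J "UP R" using that(1) by (simp add: \<J>_def)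
    have gq: "g \<otimes>\<^bsub>UP R\<^esub> q \<in> J" using that by (intro J.I_r_closed) (auto simp: \<J>_def)
    have "r = \<ominus>\<^bsub>UP R\<^esub> (g \<otimes>\<^bsub>UP R\<^esub> q) \<oplus>\<^bsub>UP R\<^esub> (g \<otimes>\<^bsub>UP R\<^esub> q \<oplus>\<^bsub>UP R\<^esub> r)"
      using that g by (simp add: U.P.r_neg1)
    with gq show ?thesis by (metis J.a_closed J.a_inv_closed)
  qed
  \<comment> \<open>An ideal containing \<open>g\<close> is determined by the remainders in it.\<close>
  have "inj_on (\<lambda>J. J \<inter> Rep) \<J>"
  proof (rule inj_onI)
    have sub: "J \<subseteq> J'" if J: "J \<in> \<J>" "J' \<in> \<J>" "J \<inter> Rep = J' \<inter> Rep" for J J'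
    proof
      fix p assume p: "p \<in> J"
      interpret J: ideal J "UP R" using J(1) by (simp add: \<J>_def)
      obtain q r where qr: "q \<in> carrier (UP R)" "r \<in> Rep" "p = g \<otimes>\<^bsub>UP R\<^esub> q \<oplus>\<^bsub>UP R\<^esub> r"
        using reduce[OF J.Icarr[OF p]] by blast
      then have "r \<in> carrier (UP R)" by (simp add: Rep_def)
      with qr p mem_iff[OF J(1)] mem_iff[OF J(2)] J(3) show "p \<in> J'" by blast
    qed
    fix J J' assume "J \<in> \<J>" "J' \<in> \<J>" "J \<inter> Rep = J' \<inter> Rep"
    then show "J = J'" using sub by blast
  qed
  then have fin_\<J>: "finite \<J>"
    by (rule inj_on_finite[of _ _ "Pow Rep"]) (use fin_Rep in auto)
  have "\<one>\<^bsub>UP R\<^esub> \<notin> PIdl\<^bsub>UP R\<^esub> g"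
  proof
    assume "\<one>\<^bsub>UP R\<^esub> \<in> PIdl\<^bsub>UP R\<^esub> g"
    then obtain q where q: "q \<in> carrier (UP R)" "\<one>\<^bsub>UP R\<^esub> = q \<otimes>\<^bsub>UP R\<^esub> g" by (auto simp: cgenideal_def)
    then have "q \<noteq> \<zero>\<^bsub>UP R\<^esub>" using g domain.one_not_zero[OF U.UP_domain] by auto
    then have "deg R \<one>\<^bsub>UP R\<^esub> = deg R q + deg R g" using q g g_nz by simp
    with deg_g show False by simp
  qed
  then have "PIdl\<^bsub>UP R\<^esub> g \<in> \<J>"
    using g by (simp add: \<J>_def U.P.cgenideal_ideal U.P.cgenideal_self)
  with fin_\<J> obtain J where J: "J \<in> \<J>" and max: "\<And>J'. J' \<in> \<J> \<Longrightarrow> J \<subseteq> J' \<Longrightarrow> J' = J"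
    by (metis (no_types, lifting) empty_iff finite_has_maximal)
  interpret J: ideal J "UP R" using J by (simp add: \<J>_def)
  have "maximalideal J (UP R)"
  proof (rule maximalidealI)
    show "ideal J (UP R)" by (rule J.is_ideal)
    show "carrier (UP R) \<noteq> J" using J by (auto simp: \<J>_def)
    fix J' assume J': "ideal J' (UP R)" "J \<subseteq> J'" "J' \<subseteq> carrier (UP R)"
    show "J' = J \<or> J' = carrier (UP R)"
    proof (cases "\<one>\<^bsub>UP R\<^esub> \<in> J'")
      case True
      then show ?thesis using ideal.one_imp_carrier[OF J'(1)] by simp
    next
      case False
      with J J' have "J' \<in> \<J>" by (auto simp: \<J>_def)
      with max J'(2) show ?thesis by blast
    qed
  qed
  moreover have "f \<notin> J"
  proof
    assume "f \<in> J"
    then have "x \<otimes>\<^bsub>UP R\<^esub> f \<in> J" using x by (rule J.I_l_closed)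
    moreover have "\<one>\<^bsub>UP R\<^esub> = \<ominus>\<^bsub>UP R\<^esub> (x \<otimes>\<^bsub>UP R\<^esub> f) \<oplus>\<^bsub>UP R\<^esub> g"
      using x f by (simp add: g_def U.P.r_neg1)
    moreover have "g \<in> J" using J by (simp add: \<J>_def)
    ultimately have "\<one>\<^bsub>UP R\<^esub> \<in> J" by (metis J.a_closed J.a_inv_closed)
    with J show False by (simp add: \<J>_def)
  qed
  moreover have "finite (carrier (UP R Quot J))"
  proof (rule finite_subset)
    show "carrier (UP R Quot J) \<subseteq> (\<lambda>r. J +>\<^bsub>UP R\<^esub> r) ` Rep"
    proof
      fix C assume "C \<in> carrier (UP R Quot J)"
      then obtain p where p: "p \<in> carrier (UP R)" "C = J +>\<^bsub>UP R\<^esub> p"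
        by (auto simp: FactRing_def A_RCOSETS_def')
      obtain q r where qr: "q \<in> carrier (UP R)" "r \<in> Rep" "p = g \<otimes>\<^bsub>UP R\<^esub> q \<oplus>\<^bsub>UP R\<^esub> r"
        using reduce[OF p(1)] by blast
      then have r: "r \<in> carrier (UP R)" by (simp add: Rep_def)
      have "p \<ominus>\<^bsub>UP R\<^esub> r = g \<otimes>\<^bsub>UP R\<^esub> q"
        using qr r g by (simp add: U.P.minus_eq U.P.a_assoc U.P.r_neg)
      also have "\<dots> \<in> J" using J qr(1) by (intro J.I_r_closed) (auto simp: \<J>_def)
      finally have "C = J +>\<^bsub>UP R\<^esub> r"
        using U.P.quotient_eq_iff_same_a_r_cos[OF J.is_ideal p(1) r] p(2) by simp
      with qr(2) show "C \<in> (\<lambda>r. J +>\<^bsub>UP R\<^esub> r) ` Rep" by blast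
    qed
  qed (use fin_Rep in simp)
  ultimately show ?thesis by blast
qed

lemma (in field) mpoly_specialisation:
  assumes fin: "finite (carrier R)" and D: "D \<in> carrier (mpoly_ring R m)" "D \<noteq> \<zero>\<^bsub>mpoly_ring R m\<^esub>"
  shows "\<exists>(Q :: (nat \<Rightarrow> 'a) set ring) h. field Q \<and> finite (carrier Q) \<and>
    h \<in> Ring.ring_hom (mpoly_ring R m) Q \<and> h D \<noteq> \<zero>\<^bsub>Q\<^esub>"
proof -
  interpret U: UP_domain R "UP R" by unfold_locales simp
  obtain B where B: "B > 0" and small: "\<forall>M. D M \<noteq> \<zero> \<longrightarrow> (\<forall>i. count M i < B)"
    using exponents_bounded[of "{D}" m] D by auto
  have "kronecker R B m D \<noteq> \<zero>\<^bsub>UP R\<^esub>"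
  proof
    assume "kronecker R B m D = \<zero>\<^bsub>UP R\<^esub>"
    with small D B have "D = \<zero>\<^bsub>mpoly_ring R m\<^esub>"
      by (intro kronecker_inj[of D m _ B]) (auto simp: kronecker_zero mpoly_zero mpoly_zero_closed)
    with D(2) show False ..
  qed
  then obtain J where J: "maximalideal J (UP R)" "kronecker R B m D \<notin> J" "finite (carrier (UP R Quot J))"
    using UP_finite_quotient[OF fin kronecker_closed[OF D(1) B]] by blast
  interpret J: maximalideal J "UP R" by (rule J(1))
  let ?h = "(+>\<^bsub>UP R\<^esub>) J \<circ> kronecker R B m"
  have "?h \<in> Ring.ring_hom (mpoly_ring R m) (UP R Quot J)"
    using kronecker_hom[OF B] J.rcos_ring_hom by (rule ring_hom_trans)
  moreover have "?h D \<noteq> \<zero>\<^bsub>UP R Quot J\<^esub>"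
  proof
    assume "?h D = \<zero>\<^bsub>UP R Quot J\<^esub>"
    then have "J +>\<^bsub>UP R\<^esub> kronecker R B m D = J" by (simp add: FactRing_def)
    then have "kronecker R B m D \<in> J"
      using kronecker_closed[OF D(1) B] J.rcos_const_imp_mem by blast
    with J(2) show False ..
  qed
  moreover have "field (UP R Quot J)" using U.UP_cring by (rule J.quotient_is_field)
  ultimately show ?thesis using J(3) by blast
qed

section \<open>Finite fields given by tables\<close>

type_synonym field_data = "nat \<times> nat \<times> nat list list \<times> nat list list"

definition rows_entry :: "'a \<Rightarrow> 'a list list \<Rightarrow> nat \<Rightarrow> nat \<Rightarrow> 'a" where
  "rows_entry d A i j = nth_default d (nth_default [] A i) j"

definition rows_of :: "nat \<Rightarrow> (nat \<Rightarrow> nat \<Rightarrow> 'a) \<Rightarrow> 'a list list" where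
  "rows_of n f = map (\<lambda>i. map (\<lambda>j. f i j) [0..<n]) [0..<n]"

lemma rows_entry_rows_of [simp]: "i < n \<Longrightarrow> j < n \<Longrightarrow> rows_entry d (rows_of n f) i j = f i j"
  by (simp add: rows_entry_def rows_of_def)

text \<open>The operations are meant on \<open>{..<q}\<close> only; outside the tables they return the default value of
  \<open>rows_entry\<close>.\<close>

definition table_ring :: "nat \<Rightarrow> field_data \<Rightarrow> nat ring" where
  "table_ring q d =
    \<lparr>carrier = {..<q}, monoid.mult = rows_entry 0 (snd (snd (snd d))), one = fst (snd d),
     zero = fst d, add = rows_entry 0 (fst (snd (snd d)))\<rparr>"

lemma finite_field_table:
  assumes "field Q" "finite (carrier Q)"
  shows "\<exists>r d b. field (table_ring r d) \<and> b \<in> ring_iso Q (table_ring r d)"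
proof -
  interpret Q: field Q by fact
  obtain b where b: "bij_betw b (carrier Q) {0..<card (carrier Q)}"
    using ex_bij_betw_finite_nat[OF assms(2)] by blast
  define r where "r = card (carrier Q)"
  define c where "c = inv_into (carrier Q) b"
  define d where "d = (b \<zero>\<^bsub>Q\<^esub>, b \<one>\<^bsub>Q\<^esub>, rows_of r (\<lambda>i j. b (c i \<oplus>\<^bsub>Q\<^esub> c j)), rows_of r (\<lambda>i j. b (c i \<otimes>\<^bsub>Q\<^esub> c j)))"
  have b_less: "b x < r" if "x \<in> carrier Q" for x
    using bij_betwE[OF b] that by (auto simp: r_def)
  have c: "c (b x) = x" if "x \<in> carrier Q" for x
    using bij_betw_inv_into_left[OF b that] by (simp add: c_def)
  have "b \<in> ring_iso Q (table_ring r d)"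
    using b b_less c by (intro ring_iso_memI) (auto simp: table_ring_def d_def r_def lessThan_atLeast0)
  moreover from this have "field (table_ring r d \<lparr>zero := b \<zero>\<^bsub>Q\<^esub>\<rparr>)"
    by (rule Q.ring_iso_imp_img_field)
  then have "field (table_ring r d)" by (simp add: table_ring_def d_def)
  ultimately show ?thesis by blast
qed

lemma (in field) mpoly_specialisation_table:
  assumes "finite (carrier R)" "D \<in> carrier (mpoly_ring R m)" "D \<noteq> \<zero>\<^bsub>mpoly_ring R m\<^esub>"
  shows "\<exists>r d h. field (table_ring r d) \<and> h \<in> Ring.ring_hom (mpoly_ring R m) (table_ring r d) \<and>
    h D \<noteq> \<zero>\<^bsub>table_ring r d\<^esub>"
proof -
  obtain Q :: "(nat \<Rightarrow> 'a) set ring" and h where Q: "field Q" "finite (carrier Q)"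
    and h: "h \<in> Ring.ring_hom (mpoly_ring R m) Q" "h D \<noteq> \<zero>\<^bsub>Q\<^esub>"
    using mpoly_specialisation[OF assms] by blast
  obtain r d b where L: "field (table_ring r d)" and b: "b \<in> ring_iso Q (table_ring r d)"
    using finite_field_table[OF Q] by blast
  interpret Q: field Q by fact
  interpret L: field "table_ring r d" by fact
  have b_hom: "b \<in> Ring.ring_hom Q (table_ring r d)" and inj: "inj_on b (carrier Q)"
    using b by (auto simp: ring_iso_def bij_betw_def)
  have "b \<zero>\<^bsub>Q\<^esub> = \<zero>\<^bsub>table_ring r d\<^esub>"
    using ring_hom_zero[OF b_hom Q.ring_axioms L.ring_axioms] .
  then have "b (h D) \<noteq> \<zero>\<^bsub>table_ring r d\<^esub>"
    using inj h ring_hom_closed[OF h(1) assms(2)] Q.zero_closed by (metis inj_onD)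
  moreover have "b \<circ> h \<in> Ring.ring_hom (mpoly_ring R m) (table_ring r d)"
    using h(1) b_hom by (rule ring_hom_trans)
  ultimately show ?thesis using L by (intro exI[of _ r] exI[of _ d] exI[of _ "b \<circ> h"]) simp
qed

section \<open>The field of fractions\<close>

context domain
begin

lemma equiv_frac_rel: "equiv (carrier R \<times> (carrier R - {\<zero>})) (frac_rel R)"
proof (rule equivI)
  show "frac_rel R \<subseteq> (carrier R \<times> (carrier R - {\<zero>})) \<times> (carrier R \<times> (carrier R - {\<zero>}))"
    by (auto simp: frac_rel_def)
  show "refl_on (carrier R \<times> (carrier R - {\<zero>})) (frac_rel R)"
    by (auto simp: refl_on_def frac_rel_def)
  show "sym (frac_rel R)"
    by (auto simp: sym_def frac_rel_def)
  show "trans (frac_rel R)"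
  proof (rule transI, clarsimp simp: frac_rel_def)
    fix a b c d e f
    assume cl: "a \<in> carrier R" "b \<in> carrier R" "c \<in> carrier R" "d \<in> carrier R" "e \<in> carrier R" "f \<in> carrier R"
      and d: "d \<noteq> \<zero>" and eq: "a \<otimes> d = c \<otimes> b" "c \<otimes> f = e \<otimes> d"
    have "d \<otimes> (a \<otimes> f) = (a \<otimes> d) \<otimes> f" using cl by (simp add: m_ac)
    also have "\<dots> = (c \<otimes> f) \<otimes> b" unfolding eq(1) using cl by (simp add: m_ac)
    also have "\<dots> = d \<otimes> (e \<otimes> b)" unfolding eq(2) using cl by (simp add: m_ac)
    finally show "a \<otimes> f = e \<otimes> b" using cl d by (simp add: m_lcancel)
  qed
qed

lemma fraction_eq_iff:
  assumes "a \<in> carrier R" "b \<in> carrier R" "b \<noteq> \<zero>" "c \<in> carrier R" "d \<in> carrier R" "d \<noteq> \<zero>"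
  shows "fraction R a b = fraction R c d \<longleftrightarrow> a \<otimes> d = c \<otimes> b"
  using eq_equiv_class_iff[OF equiv_frac_rel, of "(a, b)" "(c, d)"] assms
  by (simp add: fraction_def) (auto simp: frac_rel_def)

lemma fraction_field_carrierE:
  assumes "x \<in> carrier (fraction_field R)"
  obtains a b where "a \<in> carrier R" "b \<in> carrier R" "b \<noteq> \<zero>" "x = fraction R a b"
  using assms by (auto simp: fraction_field_def quotient_def fraction_def)

lemma fraction_closed:
  "a \<in> carrier R \<Longrightarrow> b \<in> carrier R \<Longrightarrow> b \<noteq> \<zero> \<Longrightarrow> fraction R a b \<in> carrier (fraction_field R)"
  by (auto simp: fraction_field_def quotient_def fraction_def)

lemma mem_fraction:
  assumes "a \<in> carrier R" "b \<in> carrier R" "b \<noteq> \<zero>"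
  shows "(a', b') \<in> fraction R a b \<longleftrightarrow> a' \<in> carrier R \<and> b' \<in> carrier R \<and> b' \<noteq> \<zero> \<and> a \<otimes> b' = a' \<otimes> b"
  using assms by (auto simp: fraction_def frac_rel_def)

text \<open>The operations on fractions are unions over all representatives; they are computed by a single pair of
  representatives if the result does not depend on the choice.\<close>

lemma UN_fraction:
  assumes cl: "a \<in> carrier R" "b \<in> carrier R" "b \<noteq> \<zero>" "c \<in> carrier R" "d \<in> carrier R" "d \<noteq> \<zero>"
    and const: "\<And>a' b' c' d'. a' \<in> carrier R \<Longrightarrow> b' \<in> carrier R \<Longrightarrow> b' \<noteq> \<zero> \<Longrightarrow> a \<otimes> b' = a' \<otimes> b \<Longrightarrow>
      c' \<in> carrier R \<Longrightarrow> d' \<in> carrier R \<Longrightarrow> d' \<noteq> \<zero> \<Longrightarrow> c \<otimes> d' = c' \<otimes> d \<Longrightarrow> f a' b' c' d' = f a b c d"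
  shows "(\<Union>(a', b')\<in>fraction R a b. \<Union>(c', d')\<in>fraction R c d. f a' b' c' d') = f a b c d"
proof -
  have mem: "(a, b) \<in> fraction R a b" "(c, d) \<in> fraction R c d"
    using cl by (auto simp: mem_fraction)
  have eq: "f a' b' c' d' = f a b c d"
    if "(a', b') \<in> fraction R a b" "(c', d') \<in> fraction R c d" for a' b' c' d'
    using that cl by (intro const) (auto simp: mem_fraction)
  have inner: "(\<Union>(c', d')\<in>fraction R c d. f a' b' c' d') = f a b c d"
    if ab: "(a', b') \<in> fraction R a b" for a' b'
  proof (rule SUP_eq_const)
    show "fraction R c d \<noteq> {}" using mem(2) by blast
    fix q assume "q \<in> fraction R c d"
    then show "(case q of (c', d') \<Rightarrow> f a' b' c' d') = f a b c d"
      by (cases q) (simp add: eq[OF ab])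
  qed
  show ?thesis
  proof (rule SUP_eq_const)
    show "fraction R a b \<noteq> {}" using mem(1) by blast
    fix q assume "q \<in> fraction R a b"
    then show "(case q of (a', b') \<Rightarrow> \<Union>(c', d')\<in>fraction R c d. f a' b' c' d') = f a b c d"
      by (cases q) (simp only: prod.case inner)
  qed
qed

lemma fraction_mult:
  assumes cl: "a \<in> carrier R" "b \<in> carrier R" "b \<noteq> \<zero>" "c \<in> carrier R" "d \<in> carrier R" "d \<noteq> \<zero>"
  shows "fraction R a b \<otimes>\<^bsub>fraction_field R\<^esub> fraction R c d = fraction R (a \<otimes> c) (b \<otimes> d)"
proof -
  have "(\<Union>(a', b')\<in>fraction R a b. \<Union>(c', d')\<in>fraction R c d. fraction R (a' \<otimes> c') (b' \<otimes> d'))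
      = fraction R (a \<otimes> c) (b \<otimes> d)"
  proof (rule UN_fraction[OF cl])
    fix a' b' c' d'
    assume cl': "a' \<in> carrier R" "b' \<in> carrier R" "b' \<noteq> \<zero>" "c' \<in> carrier R" "d' \<in> carrier R" "d' \<noteq> \<zero>"
      and eq: "a \<otimes> b' = a' \<otimes> b" "c \<otimes> d' = c' \<otimes> d"
    have "(a' \<otimes> c') \<otimes> (b \<otimes> d) = (a' \<otimes> b) \<otimes> (c' \<otimes> d)" using cl cl' by (simp add: m_ac)
    also have "\<dots> = (a \<otimes> c) \<otimes> (b' \<otimes> d')" unfolding eq[symmetric] using cl cl' by (simp add: m_ac)
    finally show "fraction R (a' \<otimes> c') (b' \<otimes> d') = fraction R (a \<otimes> c) (b \<otimes> d)"
      using cl cl' by (subst fraction_eq_iff) (auto simp: integral_iff)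
  qed
  then show ?thesis by (simp add: fraction_field_def)
qed

lemma fraction_add:
  assumes cl: "a \<in> carrier R" "b \<in> carrier R" "b \<noteq> \<zero>" "c \<in> carrier R" "d \<in> carrier R" "d \<noteq> \<zero>"
  shows "fraction R a b \<oplus>\<^bsub>fraction_field R\<^esub> fraction R c d = fraction R (a \<otimes> d \<oplus> c \<otimes> b) (b \<otimes> d)"
proof -
  have "(\<Union>(a', b')\<in>fraction R a b. \<Union>(c', d')\<in>fraction R c d. fraction R (a' \<otimes> d' \<oplus> c' \<otimes> b') (b' \<otimes> d'))
      = fraction R (a \<otimes> d \<oplus> c \<otimes> b) (b \<otimes> d)"
  proof (rule UN_fraction[OF cl])
    fix a' b' c' d'
    assume cl': "a' \<in> carrier R" "b' \<in> carrier R" "b' \<noteq> \<zero>" "c' \<in> carrier R" "d' \<in> carrier R" "d' \<noteq> \<zero>"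
      and eq: "a \<otimes> b' = a' \<otimes> b" "c \<otimes> d' = c' \<otimes> d"
    have "(a' \<otimes> d' \<oplus> c' \<otimes> b') \<otimes> (b \<otimes> d) = (a' \<otimes> b) \<otimes> (d \<otimes> d') \<oplus> (c' \<otimes> d) \<otimes> (b \<otimes> b')"
      using cl cl' by (simp add: m_ac l_distr r_distr)
    also have "\<dots> = (a \<otimes> d \<oplus> c \<otimes> b) \<otimes> (b' \<otimes> d')"
      unfolding eq[symmetric] using cl cl' by (simp add: m_ac l_distr r_distr)
    finally show "fraction R (a' \<otimes> d' \<oplus> c' \<otimes> b') (b' \<otimes> d') = fraction R (a \<otimes> d \<oplus> c \<otimes> b) (b \<otimes> d)"
      using cl cl' by (subst fraction_eq_iff) (auto simp: integral_iff)
  qed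
  then show ?thesis by (simp add: fraction_field_def)
qed

lemma fraction_zero: "\<zero>\<^bsub>fraction_field R\<^esub> = fraction R \<zero> \<one>"
  and fraction_one: "\<one>\<^bsub>fraction_field R\<^esub> = fraction R \<one> \<one>"
  by (simp_all add: fraction_field_def)

lemma fraction_field_cring: "cring (fraction_field R)"
proof -
  let ?F = "fraction_field R"
  note simps = fraction_mult fraction_add fraction_zero fraction_one fraction_closed fraction_eq_iff
    integral_iff
  show ?thesis
  proof (rule cringI)
    show "abelian_group ?F"
    proof (rule abelian_groupI)
      show "\<zero>\<^bsub>?F\<^esub> \<in> carrier ?F" by (simp add: simps)
    next
      fix x y assume "x \<in> carrier ?F" "y \<in> carrier ?F"
      then show "x \<oplus>\<^bsub>?F\<^esub> y \<in> carrier ?F"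
        by (auto elim!: fraction_field_carrierE simp: simps)
    next
      fix x y assume "x \<in> carrier ?F" "y \<in> carrier ?F"
      then show "x \<oplus>\<^bsub>?F\<^esub> y = y \<oplus>\<^bsub>?F\<^esub> x"
        by (auto elim!: fraction_field_carrierE simp: simps a_comm m_comm)
    next
      fix x y z
      assume "x \<in> carrier ?F" "y \<in> carrier ?F" "z \<in> carrier ?F"
      then show "x \<oplus>\<^bsub>?F\<^esub> y \<oplus>\<^bsub>?F\<^esub> z
          = x \<oplus>\<^bsub>?F\<^esub> (y \<oplus>\<^bsub>?F\<^esub> z)"
        by (elim fraction_field_carrierE) (simp add: simps l_distr r_distr a_ac m_ac)
    next
      fix x assume "x \<in> carrier ?F"
      then show "\<zero>\<^bsub>?F\<^esub> \<oplus>\<^bsub>?F\<^esub> x = x"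
        by (elim fraction_field_carrierE) (simp add: simps)
    next
      fix x assume "x \<in> carrier ?F"
      then obtain a b where ab: "a \<in> carrier R" "b \<in> carrier R" "b \<noteq> \<zero>" "x = fraction R a b"
        by (elim fraction_field_carrierE)
      then have "fraction R (\<ominus> a) b \<oplus>\<^bsub>?F\<^esub> x = \<zero>\<^bsub>?F\<^esub>"
        by (simp add: simps l_minus l_neg)
      with ab show "\<exists>y\<in>carrier ?F. y \<oplus>\<^bsub>?F\<^esub> x = \<zero>\<^bsub>?F\<^esub>"
        by (intro bexI[of _ "fraction R (\<ominus> a) b"]) (simp_all add: simps)
    qed
    show "comm_monoid ?F"
    proof (rule comm_monoidI)
      show "\<one>\<^bsub>?F\<^esub> \<in> carrier ?F" by (simp add: simps)
    next
      fix x y assume "x \<in> carrier ?F" "y \<in> carrier ?F"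
      then show "x \<otimes>\<^bsub>?F\<^esub> y \<in> carrier ?F"
        by (auto elim!: fraction_field_carrierE simp: simps)
    next
      fix x y assume "x \<in> carrier ?F" "y \<in> carrier ?F"
      then show "x \<otimes>\<^bsub>?F\<^esub> y = y \<otimes>\<^bsub>?F\<^esub> x"
        by (auto elim!: fraction_field_carrierE simp: simps m_comm)
    next
      fix x y z
      assume "x \<in> carrier ?F" "y \<in> carrier ?F" "z \<in> carrier ?F"
      then show "x \<otimes>\<^bsub>?F\<^esub> y \<otimes>\<^bsub>?F\<^esub> z
          = x \<otimes>\<^bsub>?F\<^esub> (y \<otimes>\<^bsub>?F\<^esub> z)"
        by (elim fraction_field_carrierE) (simp add: simps m_ac)
    next
      fix x assume "x \<in> carrier ?F"
      then show "\<one>\<^bsub>?F\<^esub> \<otimes>\<^bsub>?F\<^esub> x = x"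
        by (elim fraction_field_carrierE) (simp add: simps)
    qed
    fix x y z
    assume "x \<in> carrier ?F" "y \<in> carrier ?F" "z \<in> carrier ?F"
    then show "(x \<oplus>\<^bsub>?F\<^esub> y) \<otimes>\<^bsub>?F\<^esub> z
        = x \<otimes>\<^bsub>?F\<^esub> z \<oplus>\<^bsub>?F\<^esub> y \<otimes>\<^bsub>?F\<^esub> z"
      by (elim fraction_field_carrierE) (simp add: simps l_distr r_distr a_ac m_ac)
  qed
qed

end

text \<open>The localisation of \<open>R\<close> at the elements that \<open>h\<close> does not kill, as a subset of the field of fractions,
  and the extension of \<open>h\<close> to it.\<close>

definition local_part :: "('a, 'b) ring_scheme \<Rightarrow> ('c, 'd) ring_scheme \<Rightarrow> ('a \<Rightarrow> 'c) \<Rightarrow> ('a \<times> 'a) set set" where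
  "local_part R L h = {fraction R a b |a b. a \<in> carrier R \<and> b \<in> carrier R \<and> h b \<noteq> \<zero>\<^bsub>L\<^esub>}"

definition local_eval :: "('a, 'b) ring_scheme \<Rightarrow> ('c, 'd) ring_scheme \<Rightarrow> ('a \<Rightarrow> 'c) \<Rightarrow> ('a \<times> 'a) set \<Rightarrow> 'c" where
  "local_eval R L h x = (SOME c. \<exists>a b. a \<in> carrier R \<and> b \<in> carrier R \<and> h b \<noteq> \<zero>\<^bsub>L\<^esub> \<and>
     x = fraction R a b \<and> c = h a \<otimes>\<^bsub>L\<^esub> inv\<^bsub>L\<^esub> h b)"

locale specialisation = R?: domain R + L?: field L for R and L (structure) +
  fixes h
  assumes hom: "h \<in> Ring.ring_hom R L"
begin

sublocale h?: ring_hom_cring R L h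
  by (intro ring_hom_cring.intro ring_hom_cring_axioms.intro R.is_cring L.is_cring hom)

lemma nonzero: "b \<in> carrier R \<Longrightarrow> h b \<noteq> \<zero> \<Longrightarrow> b \<noteq> \<zero>\<^bsub>R\<^esub>"
  using h.hom_zero by blast

lemma inverse: "x \<in> carrier L \<Longrightarrow> x \<noteq> \<zero> \<Longrightarrow> inv x \<in> carrier L \<and> x \<otimes> inv x = \<one>"
  using L.field_Units by (auto intro: L.Units_inv_closed L.Units_r_inv)

lemma quotient_eq_iff:
  assumes "x \<in> carrier L" "y \<in> carrier L" "y \<noteq> \<zero>" "z \<in> carrier L" "w \<in> carrier L" "w \<noteq> \<zero>"
  shows "x \<otimes> inv y = z \<otimes> inv w \<longleftrightarrow> x \<otimes> w = z \<otimes> y"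
proof -
  note y = inverse[OF assms(2,3)] and w = inverse[OF assms(5,6)]
  have yw: "y \<otimes> w \<in> carrier L" "y \<otimes> w \<noteq> \<zero>" using assms by (auto simp: L.integral_iff)
  have "(y \<otimes> w) \<otimes> (x \<otimes> inv y) = (x \<otimes> w) \<otimes> (y \<otimes> inv y)"
    using assms conjunct1[OF y] by (simp add: L.m_ac)
  moreover have "(y \<otimes> w) \<otimes> (z \<otimes> inv w) = (z \<otimes> y) \<otimes> (w \<otimes> inv w)"
    using assms conjunct1[OF w] by (simp add: L.m_ac)
  ultimately show ?thesis
    using assms y w L.m_lcancel[OF yw(2,1), of "x \<otimes> inv y" "z \<otimes> inv w"] by simp
qed

lemma local_eval_fraction:
  assumes "a \<in> carrier R" "b \<in> carrier R" "h b \<noteq> \<zero>"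
  shows "local_eval R L h (fraction R a b) = h a \<otimes> inv h b"
  unfolding local_eval_def
proof (rule some_equality)
  fix c
  assume "\<exists>a' b'. a' \<in> carrier R \<and> b' \<in> carrier R \<and> h b' \<noteq> \<zero> \<and>
     fraction R a b = fraction R a' b' \<and> c = h a' \<otimes> inv h b'"
  then obtain a' b' where *: "a' \<in> carrier R" "b' \<in> carrier R" "h b' \<noteq> \<zero>"
    "fraction R a b = fraction R a' b'" "c = h a' \<otimes> inv h b'" by blast
  then have "a \<otimes>\<^bsub>R\<^esub> b' = a' \<otimes>\<^bsub>R\<^esub> b"
    using assms nonzero by (simp add: R.fraction_eq_iff)
  then have "h (a \<otimes>\<^bsub>R\<^esub> b') = h (a' \<otimes>\<^bsub>R\<^esub> b)" by simp
  then have "h a \<otimes> h b' = h a' \<otimes> h b" using assms * by simp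
  with * assms show "c = h a \<otimes> inv h b" by (simp add: quotient_eq_iff)
qed (use assms in blast)

lemma local_partE:
  assumes "x \<in> local_part R L h"
  obtains a b where "a \<in> carrier R" "b \<in> carrier R" "h b \<noteq> \<zero>" "b \<noteq> \<zero>\<^bsub>R\<^esub>" "x = fraction R a b"
  using assms nonzero by (auto simp: local_part_def)

lemma local_partI:
  "a \<in> carrier R \<Longrightarrow> b \<in> carrier R \<Longrightarrow> h b \<noteq> \<zero> \<Longrightarrow> fraction R a b \<in> local_part R L h"
  by (auto simp: local_part_def)

lemma local_part_subset: "local_part R L h \<subseteq> carrier (fraction_field R)"
  by (auto elim!: local_partE intro: R.fraction_closed)

lemma local_eval_closed: "x \<in> local_part R L h \<Longrightarrow> local_eval R L h x \<in> carrier L"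
  by (auto elim!: local_partE simp: local_eval_fraction inverse)

lemma local_zero: "\<zero>\<^bsub>fraction_field R\<^esub> \<in> local_part R L h \<and> local_eval R L h \<zero>\<^bsub>fraction_field R\<^esub> = \<zero>"
  using inverse[of "\<one>"] by (simp add: R.fraction_zero local_partI local_eval_fraction)

lemma local_one: "\<one>\<^bsub>fraction_field R\<^esub> \<in> local_part R L h \<and> local_eval R L h \<one>\<^bsub>fraction_field R\<^esub> = \<one>"
  using inverse[of "\<one>"] by (simp add: R.fraction_one local_partI local_eval_fraction)

lemma local_mult:
  assumes "x \<in> local_part R L h" "y \<in> local_part R L h"
  shows "x \<otimes>\<^bsub>fraction_field R\<^esub> y \<in> local_part R L h \<and>
    local_eval R L h (x \<otimes>\<^bsub>fraction_field R\<^esub> y) = local_eval R L h x \<otimes> local_eval R L h y"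
proof -
  from assms obtain a b c d where *: "a \<in> carrier R" "b \<in> carrier R" "h b \<noteq> \<zero>" "b \<noteq> \<zero>\<^bsub>R\<^esub>"
    "x = fraction R a b" "c \<in> carrier R" "d \<in> carrier R" "h d \<noteq> \<zero>" "d \<noteq> \<zero>\<^bsub>R\<^esub>" "y = fraction R c d"
    by (elim local_partE)
  have bd: "h (b \<otimes>\<^bsub>R\<^esub> d) \<noteq> \<zero>" using * by (simp add: L.integral_iff)
  have hb: "inv h b \<in> carrier L" "h b \<otimes> inv h b = \<one>"
    and hd: "inv h d \<in> carrier L" "h d \<otimes> inv h d = \<one>"
    using * inverse by auto
  have "(h b \<otimes> h d) \<otimes> (inv h b \<otimes> inv h d)
      = (h b \<otimes> inv h b) \<otimes> (h d \<otimes> inv h d)"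
    using hb(1) hd(1) * by (simp add: L.m_ac)
  then have "inv (h b \<otimes> h d) = inv h b \<otimes> inv h d"
    using hb hd * by (intro L.comm_inv_char) auto
  moreover have "x \<otimes>\<^bsub>fraction_field R\<^esub> y = fraction R (a \<otimes>\<^bsub>R\<^esub> c) (b \<otimes>\<^bsub>R\<^esub> d)"
    using * by (simp add: R.fraction_mult)
  ultimately show ?thesis
    using * bd hb(1) hd(1) by (auto simp: local_partI local_eval_fraction L.m_ac)
qed

lemma local_add:
  assumes "x \<in> local_part R L h" "y \<in> local_part R L h"
  shows "x \<oplus>\<^bsub>fraction_field R\<^esub> y \<in> local_part R L h \<and>
    local_eval R L h (x \<oplus>\<^bsub>fraction_field R\<^esub> y) = local_eval R L h x \<oplus> local_eval R L h y"
proof -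
  from assms obtain a b c d where *: "a \<in> carrier R" "b \<in> carrier R" "h b \<noteq> \<zero>" "b \<noteq> \<zero>\<^bsub>R\<^esub>"
    "x = fraction R a b" "c \<in> carrier R" "d \<in> carrier R" "h d \<noteq> \<zero>" "d \<noteq> \<zero>\<^bsub>R\<^esub>" "y = fraction R c d"
    by (elim local_partE)
  have bd: "h (b \<otimes>\<^bsub>R\<^esub> d) \<noteq> \<zero>" using * by (simp add: L.integral_iff)
  note hb = inverse[of "h b"] and hd = inverse[of "h d"] and hbd = inverse[of "h (b \<otimes>\<^bsub>R\<^esub> d)"]
  have eq: "x \<oplus>\<^bsub>fraction_field R\<^esub> y = fraction R (a \<otimes>\<^bsub>R\<^esub> d \<oplus>\<^bsub>R\<^esub> c \<otimes>\<^bsub>R\<^esub> b) (b \<otimes>\<^bsub>R\<^esub> d)"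
    using * by (simp add: R.fraction_add)
  have inv: "inv h b \<in> carrier L" "inv h d \<in> carrier L" "inv h (b \<otimes>\<^bsub>R\<^esub> d) \<in> carrier L"
    using * bd hb hd hbd by auto
  have "h a \<otimes> inv h b = h (a \<otimes>\<^bsub>R\<^esub> d) \<otimes> inv h (b \<otimes>\<^bsub>R\<^esub> d)"
    "h c \<otimes> inv h d = h (c \<otimes>\<^bsub>R\<^esub> b) \<otimes> inv h (b \<otimes>\<^bsub>R\<^esub> d)"
    using * bd by (subst quotient_eq_iff; simp add: L.m_ac)+
  with * bd inv show ?thesis
    unfolding eq by (simp add: local_partI local_eval_fraction L.l_distr)
qed

lemma local_eval_eqD:
  assumes "a \<in> carrier R" "b \<in> carrier R" "h b \<noteq> \<zero>" "c \<in> carrier R" "d \<in> carrier R" "h d \<noteq> \<zero>"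
    and "local_eval R L h (fraction R a b) = local_eval R L h (fraction R c d)"
  shows "h (a \<otimes>\<^bsub>R\<^esub> d \<ominus>\<^bsub>R\<^esub> c \<otimes>\<^bsub>R\<^esub> b) = \<zero>"
proof -
  have "h a \<otimes> h d = h c \<otimes> h b"
    using assms by (simp add: local_eval_fraction quotient_eq_iff)
  with assms show ?thesis by (simp add: R.minus_eq L.r_neg)
qed

end

lemma (in domain) finprod_nonzero:
  assumes "finite I" "\<And>i. i \<in> I \<Longrightarrow> f i \<in> carrier R" "\<And>i. i \<in> I \<Longrightarrow> f i \<noteq> \<zero>"
  shows "finprod R f I \<noteq> \<zero>"
  using assms by (induction I) (auto simp: integral_iff Pi_def)

lemma (in ring_hom_cring) hom_finprod_zero:
  assumes "finite I" "\<And>i. i \<in> I \<Longrightarrow> f i \<in> carrier R" "i \<in> I" "h (f i) = \<zero>\<^bsub>S\<^esub>"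
  shows "h (finprod R f I) = \<zero>\<^bsub>S\<^esub>"
proof -
  have cl: "finprod R f (I - {i}) \<in> carrier R" using assms(2) by (intro R.finprod_closed) auto
  have "finprod R f (insert i (I - {i})) = f i \<otimes>\<^bsub>R\<^esub> finprod R f (I - {i})"
    using assms by (intro R.finprod_insert) auto
  moreover have "insert i (I - {i}) = I" using assms(3) by blast
  ultimately show ?thesis using assms cl by simp
qed

text \<open>The nonzero polynomial \<open>D1 \<otimes> D2\<close> collects the denominators and the numerators of the differences, none of
  which may vanish under the specialisation.\<close>

lemma (in field) ratfun_specialisation:
  assumes fin: "finite (carrier R)" and E: "finite E" "E \<subseteq> carrier (ratfun_field R m)"
  shows "\<exists>r d h. specialisation (mpoly_ring R m) (table_ring r d) h \<and>
    E \<subseteq> local_part (mpoly_ring R m) (table_ring r d) h \<and>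
    inj_on (local_eval (mpoly_ring R m) (table_ring r d) h) E"
proof -
  let ?A = "mpoly_ring R m"
  interpret A: domain ?A by (rule mpoly_domain)
  have "\<forall>x\<in>E. \<exists>p. fst p \<in> carrier ?A \<and> snd p \<in> carrier ?A \<and>
      snd p \<noteq> \<zero>\<^bsub>?A\<^esub> \<and> x = fraction ?A (fst p) (snd p)"
  proof
    fix x assume "x \<in> E"
    then have "x \<in> carrier (fraction_field ?A)" using E(2) by (auto simp: ratfun_field_def)
    then obtain a b where "a \<in> carrier ?A" "b \<in> carrier ?A"
      "b \<noteq> \<zero>\<^bsub>?A\<^esub>" "x = fraction ?A a b"
      by (rule A.fraction_field_carrierE)
    then show "\<exists>p. fst p \<in> carrier ?A \<and> snd p \<in> carrier ?A \<and>
        snd p \<noteq> \<zero>\<^bsub>?A\<^esub> \<and> x = fraction ?A (fst p) (snd p)"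
      by (intro exI[of _ "(a, b)"]) simp
  qed
  from bchoice[OF this] obtain p where
    p: "\<And>x. x \<in> E \<Longrightarrow> fst (p x) \<in> carrier ?A" "\<And>x. x \<in> E \<Longrightarrow> snd (p x) \<in> carrier ?A"
      "\<And>x. x \<in> E \<Longrightarrow> snd (p x) \<noteq> \<zero>\<^bsub>?A\<^esub>"
      "\<And>x. x \<in> E \<Longrightarrow> x = fraction ?A (fst (p x)) (snd (p x))" by blast
  define \<Delta> where "\<Delta> = (\<lambda>(x, y). fst (p x) \<otimes>\<^bsub>?A\<^esub> snd (p y)
      \<ominus>\<^bsub>?A\<^esub> fst (p y) \<otimes>\<^bsub>?A\<^esub> snd (p x))"
  define D1 where "D1 = finprod ?A (\<lambda>x. snd (p x)) E"
  define D2 where "D2 = finprod ?A \<Delta> (E \<times> E - Id)"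
  have \<Delta>: "\<Delta> xy \<in> carrier ?A" "\<Delta> xy \<noteq> \<zero>\<^bsub>?A\<^esub>" if xy: "xy \<in> E \<times> E - Id" for xy
  proof -
    obtain x y where xy': "xy = (x, y)" "x \<in> E" "y \<in> E" "x \<noteq> y" using xy by auto
    note px = p(1-3)[OF xy'(2)] and py = p(1-3)[OF xy'(3)]
    have "fraction ?A (fst (p x)) (snd (p x))
        \<noteq> fraction ?A (fst (p y)) (snd (p y))" using xy' p(4) by metis
    then have "fst (p x) \<otimes>\<^bsub>?A\<^esub> snd (p y) \<noteq> fst (p y) \<otimes>\<^bsub>?A\<^esub> snd (p x)"
      using A.fraction_eq_iff[OF px py] by simp
    then show "\<Delta> xy \<in> carrier ?A" "\<Delta> xy \<noteq> \<zero>\<^bsub>?A\<^esub>"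
      using px py by (simp_all add: \<Delta>_def xy'(1))
  qed
  have D1: "D1 \<in> carrier ?A" "D1 \<noteq> \<zero>\<^bsub>?A\<^esub>"
    unfolding D1_def using p(2,3) E(1) by (intro A.finprod_closed A.finprod_nonzero; blast)+
  have D2: "D2 \<in> carrier ?A" "D2 \<noteq> \<zero>\<^bsub>?A\<^esub>"
    unfolding D2_def using \<Delta> E(1) by (intro A.finprod_closed A.finprod_nonzero; blast)+
  obtain r d h where Q: "field (table_ring r d)"
    and h: "h \<in> Ring.ring_hom ?A (table_ring r d)"
      "h (D1 \<otimes>\<^bsub>?A\<^esub> D2) \<noteq> \<zero>\<^bsub>table_ring r d\<^esub>"
    using mpoly_specialisation_table[OF fin, of "D1 \<otimes>\<^bsub>?A\<^esub> D2" m] D1 D2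
    by (auto simp: A.integral_iff)
  have spec: "specialisation ?A (table_ring r d) h"
    by (rule specialisation.intro[OF A.domain_axioms Q specialisation_axioms.intro[OF h(1)]])
  interpret S: specialisation ?A "table_ring r d" h by (rule spec)
  have "h D1 \<otimes>\<^bsub>table_ring r d\<^esub> h D2 \<noteq> \<zero>\<^bsub>table_ring r d\<^esub>" "h D1 \<in> carrier (table_ring r d)" "h D2 \<in> carrier (table_ring r d)"
    using h(2) S.h.hom_mult[OF D1(1) D2(1)] S.h.hom_closed[OF D1(1)] S.h.hom_closed[OF D2(1)] by simp_all
  then have hD: "h D1 \<noteq> \<zero>\<^bsub>table_ring r d\<^esub>" "h D2 \<noteq> \<zero>\<^bsub>table_ring r d\<^esub>" using S.L.l_null S.L.r_null by metis+
  have den: "h (snd (p x)) \<noteq> \<zero>\<^bsub>table_ring r d\<^esub>" if "x \<in> E" for x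
    using S.h.hom_finprod_zero[OF E(1), of "\<lambda>x. snd (p x)" x] p(2) that hD(1) unfolding D1_def by blast
  have diff: "h (\<Delta> xy) \<noteq> \<zero>\<^bsub>table_ring r d\<^esub>" if "xy \<in> E \<times> E - Id" for xy
    using S.h.hom_finprod_zero[of "E \<times> E - Id" \<Delta> xy] E(1) \<Delta>(1) that hD(2) unfolding D2_def by blast
  have "E \<subseteq> local_part ?A (table_ring r d) h"
    using p den S.local_partI by (metis subsetI)
  moreover have "inj_on (local_eval ?A (table_ring r d) h) E"
  proof (rule inj_onI, rule ccontr)
    fix x y assume xy: "x \<in> E" "y \<in> E" "x \<noteq> y"
      and "local_eval ?A (table_ring r d) h x = local_eval ?A (table_ring r d) h y"
    then have eq: "local_eval ?A (table_ring r d) h (fraction ?A (fst (p x)) (snd (p x)))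
        = local_eval ?A (table_ring r d) h (fraction ?A (fst (p y)) (snd (p y)))"
      using p(4) by metis
    have "h (\<Delta> (x, y)) = \<zero>\<^bsub>table_ring r d\<^esub>"
      unfolding \<Delta>_def prod.case
      by (rule S.local_eval_eqD[OF p(1,2)[OF xy(1)] den[OF xy(1)] p(1,2)[OF xy(2)] den[OF xy(2)] eq])
    with diff[of "(x, y)"] xy show False by simp
  qed
  ultimately show ?thesis using spec by blast
qed

section \<open>Words in the generators\<close>

definition word_value :: "('a, 'b) monoid_scheme \<Rightarrow> ('c \<Rightarrow> 'a) \<Rightarrow> 'c list \<Rightarrow> 'a" where
  "word_value M f w = foldr (\<lambda>x y. f x \<otimes>\<^bsub>M\<^esub> y) w \<one>\<^bsub>M\<^esub>"

lemma word_value_Nil [simp]: "word_value M f [] = \<one>\<^bsub>M\<^esub>"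
  and word_value_Cons [simp]: "word_value M f (x # w) = f x \<otimes>\<^bsub>M\<^esub> word_value M f w"
  by (simp_all add: word_value_def)

lemma (in monoid) word_value_closed:
  "(\<And>x. x \<in> set w \<Longrightarrow> f x \<in> carrier G) \<Longrightarrow> word_value G f w \<in> carrier G"
  by (induction w) auto

lemma (in monoid) word_value_append:
  assumes "\<And>x. x \<in> set v \<Longrightarrow> f x \<in> carrier G" "\<And>x. x \<in> set w \<Longrightarrow> f x \<in> carrier G"
  shows "word_value G f (v @ w) = word_value G f v \<otimes> word_value G f w"
  using assms by (induction v) (auto simp: m_assoc word_value_closed)

lemma (in monoid) word_value_replicate:
  assumes "f x \<in> carrier G"
  shows "word_value G f (replicate k x) = f x [^] k"
proof (induction k)
  case (Suc k)
  then show ?case by (simp only: replicate_Suc word_value_Cons nat_pow_Suc2[OF assms])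
qed simp

text \<open>If each generator has an inverse among the words, then inverses are superfluous in the generation of the
  group.\<close>

lemma (in monoid) generate_eq_words:
  assumes unit: "\<And>x. x \<in> Y \<Longrightarrow> f x \<in> Units G"
    and inverse: "\<And>x. x \<in> Y \<Longrightarrow> \<exists>w. set w \<subseteq> Y \<and> f x \<otimes> word_value G f w = \<one>"
  shows "generate (units_of G) (f ` Y) = {word_value G f w |w. set w \<subseteq> Y}"
proof (intro equalityI subsetI)
  interpret U: group "units_of G" by (rule units_group)
  have cl: "f x \<in> carrier G" if "x \<in> Y" for x using unit[OF that] by (rule Units_closed)
  fix g assume "g \<in> generate (units_of G) (f ` Y)"
  then show "g \<in> {word_value G f w |w. set w \<subseteq> Y}"
  proof (induction rule: generate.induct)
    case one
    show ?case by (auto simp: units_of_one intro: exI[of _ "[]"])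
  next
    case (incl h)
    then obtain x where "x \<in> Y" "h = f x" by blast
    then show ?case using cl by (auto intro!: exI[of _ "[x]"])
  next
    case (inv h)
    then obtain x where x: "x \<in> Y" "h = f x" by blast
    then obtain w where w: "set w \<subseteq> Y" "f x \<otimes> word_value G f w = \<one>" using inverse by blast
    have wv: "word_value G f w \<in> carrier G" using w(1) cl by (intro word_value_closed) auto
    have "inv f x = inv f x \<otimes> (f x \<otimes> word_value G f w)"
      using w(2) unit[OF x(1)] by simp
    also have "\<dots> = word_value G f w"
      using unit[OF x(1)] cl[OF x(1)] wv by (simp add: m_assoc[symmetric])
    finally have "inv\<^bsub>units_of G\<^esub> h = word_value G f w"
      using x unit by (simp add: units_of_inv)
    with w(1) show ?case by blast
  next
    case (eng h1 h2)
    then obtain v w where "set v \<subseteq> Y" "h1 = word_value G f v" "set w \<subseteq> Y" "h2 = word_value G f w" by blast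
    then show ?case using cl
      by (auto simp: units_of_mult subset_iff intro!: exI[of _ "v @ w"] word_value_append[symmetric])
  qed
next
  fix g assume "g \<in> {word_value G f w |w. set w \<subseteq> Y}"
  then obtain w where w: "set w \<subseteq> Y" "g = word_value G f w" by blast
  from w(1) have "word_value G f w \<in> generate (units_of G) (f ` Y)"
  proof (induction w)
    case Nil
    show ?case using generate.one[of "units_of G"] by (simp add: units_of_one)
  next
    case (Cons x w)
    then have "f x \<in> generate (units_of G) (f ` Y)" "word_value G f w \<in> generate (units_of G) (f ` Y)"
      by (auto intro: generate.incl)
    then have "f x \<otimes>\<^bsub>units_of G\<^esub> word_value G f w \<in> generate (units_of G) (f ` Y)"
      by (rule generate.eng)
    then show ?case by (simp add: units_of_mult)
  qed
  with w(2) show "g \<in> generate (units_of G) (f ` Y)" by simp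
qed

text \<open>In a finite group the inverse of \<open>x\<close> is a power of \<open>x\<close>.\<close>

lemma (in monoid) finite_generate_eq_words:
  assumes unit: "\<And>x. x \<in> Y \<Longrightarrow> f x \<in> Units G" and fin: "finite (generate (units_of G) (f ` Y))"
  shows "generate (units_of G) (f ` Y) = {word_value G f w |w. set w \<subseteq> Y}"
    and "\<And>x. x \<in> Y \<Longrightarrow> \<exists>w. set w \<subseteq> Y \<and> f x \<otimes> word_value G f w = \<one>"
proof -
  interpret U: group "units_of G" by (rule units_group)
  interpret S: group "subgroup_generated (units_of G) (f ` Y)" by (rule U.group_subgroup_generated)
  have sub: "f ` Y \<subseteq> carrier (units_of G)" using unit by (auto simp: units_of_carrier)
  have carr: "carrier (subgroup_generated (units_of G) (f ` Y)) = generate (units_of G) (f ` Y)"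
    using sub by (simp add: carrier_subgroup_generated Int_absorb1)
  show inv: "\<exists>w. set w \<subseteq> Y \<and> f x \<otimes> word_value G f w = \<one>" if x: "x \<in> Y" for x
  proof -
    let ?S = "subgroup_generated (units_of G) (f ` Y)"
    have fx: "f x \<in> carrier ?S" using x by (auto simp: carr intro: generate.incl)
    have cl: "f x \<in> carrier G" using unit[OF x] by (rule Units_closed)
    have "order ?S > 0" using S.order_gt_0_iff_finite fin by (simp add: carr)
    then obtain k where k: "order ?S = Suc k" by (cases "order ?S") auto
    have pow: "f x [^]\<^bsub>?S\<^esub> j = f x [^] j" for j :: nat
      by (induction j) (simp_all add: subgroup_generated_def units_of_def nat_pow_def)
    have "f x [^]\<^bsub>?S\<^esub> Suc k = \<one>\<^bsub>?S\<^esub>" using S.pow_order_eq_1[OF fx] by (simp only: k)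
    then have "f x [^] Suc k = \<one>"
      by (simp only: pow) (simp add: subgroup_generated_def units_of_def)
    then have "f x \<otimes> word_value G f (replicate k x) = \<one>"
      using cl nat_pow_Suc2[OF cl, of k] by (simp add: word_value_replicate)
    with x show ?thesis by (intro exI[of _ "replicate k x"]) (auto simp: set_replicate_conv_if)
  qed
  show "generate (units_of G) (f ` Y) = {word_value G f w |w. set w \<subseteq> Y}"
    using unit inv by (rule generate_eq_words)
qed

definition word_closure :: "'c list \<Rightarrow> 'c list list \<Rightarrow> 'c list list" where
  "word_closure Y W = W @ concat (map (\<lambda>x. map (\<lambda>w. x # w) W) Y)"

lemma set_word_closure: "set (word_closure Y W) = set W \<union> {x # w |x w. x \<in> set Y \<and> w \<in> set W}"
  by (auto simp: word_closure_def)

text \<open>The finite condition that a certificate has to satisfy: over \<open>M\<close> and over \<open>N\<close> the same equations hold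
  between words of \<open>W\<close> and their left multiples, and \<open>W\<close> contains exactly one representative of each value over
  \<open>N\<close>.\<close>

definition word_system ::
    "('a, 'b) monoid_scheme \<Rightarrow> ('d, 'e) monoid_scheme \<Rightarrow> ('c \<Rightarrow> 'a) \<Rightarrow> ('c \<Rightarrow> 'd) \<Rightarrow> 'c list \<Rightarrow> 'c list list \<Rightarrow> bool"
  where
  "word_system M N f g Y W \<longleftrightarrow> [] \<in> set W \<and> (\<forall>w\<in>set W. \<forall>x\<in>set w. x \<in> set Y) \<and>
     (\<forall>u\<in>set (word_closure Y W). \<forall>v\<in>set (word_closure Y W).
        word_value M f u = word_value M f v \<longleftrightarrow> word_value N g u = word_value N g v) \<and>
     (\<forall>u\<in>set (word_closure Y W). \<exists>w\<in>set W. word_value N g u = word_value N g w) \<and>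
     distinct (map (word_value N g) W)"

text \<open>Reducing a word to \<open>W\<close> starting from its last letter uses only equations between words of the closure, so
  that it takes place over \<open>M\<close> and over \<open>N\<close> at the same time (\<open>reduce\<close>).  Hence all words, not only those
  of the closure, satisfy the same equations on both sides (\<open>eq_iff\<close>).  In particular the images of the
  generators are invertible, as the inverses in the finite group on the left are words.\<close>

lemma word_system_iso:
  assumes "monoid M" "monoid N"
    and f: "\<And>x. x \<in> set Y \<Longrightarrow> f x \<in> Units M" and g: "\<And>x. x \<in> set Y \<Longrightarrow> g x \<in> carrier N"
    and fin: "finite (generate (units_of M) (f ` set Y))"
    and W: "word_system M N f g Y W"
  shows "order (subgroup_generated (units_of M) (f ` set Y)) = length W"
    and "g ` set Y \<subseteq> carrier (units_of N)"
    and "subgroup_generated (units_of M) (f ` set Y) \<cong> subgroup_generated (units_of N) (g ` set Y)"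
proof -
  interpret M: monoid M by fact
  interpret N: monoid N by fact
  let ?m = "word_value M f" and ?n = "word_value N g"
  note W' = W[unfolded word_system_def]
  have f_cl: "f x \<in> carrier M" if "x \<in> set Y" for x using f[OF that] by (rule M.Units_closed)
  have m_app: "?m (u @ v) = ?m u \<otimes>\<^bsub>M\<^esub> ?m v" if "set u \<subseteq> set Y" "set v \<subseteq> set Y" for u v
    using that f_cl by (intro M.word_value_append) auto
  have n_app: "?n (u @ v) = ?n u \<otimes>\<^bsub>N\<^esub> ?n v" if "set u \<subseteq> set Y" "set v \<subseteq> set Y" for u v
    using that g by (intro N.word_value_append) auto
  have n_cl: "?n u \<in> carrier N" if "set u \<subseteq> set Y" for u
    using that g by (intro N.word_value_closed) auto
  have reduce: "\<exists>w\<in>set W. ?m u = ?m w \<and> ?n u = ?n w" if "set u \<subseteq> set Y" for u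
    using that
  proof (induction u)
    case Nil
    with W' show ?case by blast
  next
    case (Cons x u)
    then obtain w where w: "w \<in> set W" "?m u = ?m w" "?n u = ?n w" by auto
    with Cons.prems have xw: "x # w \<in> set (word_closure Y W)" by (auto simp: set_word_closure)
    with W' obtain w' where w': "w' \<in> set W" "?n (x # w) = ?n w'" by blast
    then have "w' \<in> set (word_closure Y W)" by (simp add: set_word_closure)
    with W' xw w'(2) have "?m (x # w) = ?m w'" by blast
    with w w' show ?case by auto
  qed
  have eq_iff: "?m u = ?m v \<longleftrightarrow> ?n u = ?n v" if uv: "set u \<subseteq> set Y" "set v \<subseteq> set Y" for u v
  proof -
    obtain w w' where "w \<in> set W" "?m u = ?m w" "?n u = ?n w" "w' \<in> set W" "?m v = ?m w'" "?n v = ?n w'"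
      using reduce[OF uv(1)] reduce[OF uv(2)] by blast
    moreover from this have "w \<in> set (word_closure Y W)" "w' \<in> set (word_closure Y W)"
      by (simp_all add: set_word_closure)
    ultimately show ?thesis using W' by simp
  qed
  have words: "generate (units_of M) (f ` set Y) = {?m w |w. set w \<subseteq> set Y}"
    using f fin by (rule M.finite_generate_eq_words)
  have inverse: "\<exists>w. set w \<subseteq> set Y \<and> f x \<otimes>\<^bsub>M\<^esub> ?m w = \<one>\<^bsub>M\<^esub>" if "x \<in> set Y" for x
    using f fin that by (rule M.finite_generate_eq_words)
  have right_inv: "\<exists>u. set u \<subseteq> set Y \<and> g x \<otimes>\<^bsub>N\<^esub> ?n u = \<one>\<^bsub>N\<^esub> \<and> ?n u \<otimes>\<^bsub>N\<^esub> g x = \<one>\<^bsub>N\<^esub>" if x: "x \<in> set Y" for x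
  proof -
    obtain u where u: "set u \<subseteq> set Y" "f x \<otimes>\<^bsub>M\<^esub> ?m u = \<one>\<^bsub>M\<^esub>" using inverse[OF x] by blast
    have m_u: "?m u \<in> carrier M" using u(1) f_cl by (intro M.word_value_closed) auto
    have "?m u = inv\<^bsub>M\<^esub> f x \<otimes>\<^bsub>M\<^esub> (f x \<otimes>\<^bsub>M\<^esub> ?m u)"
      using f[OF x] f_cl[OF x] m_u by (simp add: M.m_assoc[symmetric])
    then have "?m u = inv\<^bsub>M\<^esub> f x" using u(2) f[OF x] by simp
    then have "?m (u @ [x]) = ?m []" using x u(1) f[OF x] f_cl by (simp add: m_app)
    then have "?n (u @ [x]) = ?n []" using x u(1) by (subst eq_iff[symmetric]) auto
    moreover have "?m (x # u) = ?m []" using u by simp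
    then have "?n (x # u) = ?n []" using x u(1) by (subst eq_iff[symmetric]) auto
    ultimately show ?thesis using u(1) x g by (auto simp: n_app)
  qed
  have gU: "g x \<in> Units N" if "x \<in> set Y" for x
    using right_inv[OF that] g[OF that] n_cl unfolding Units_def by blast
  then show "g ` set Y \<subseteq> carrier (units_of N)" by (auto simp: units_of_carrier)
  let ?G = "subgroup_generated (units_of M) (f ` set Y)"
  let ?H = "subgroup_generated (units_of N) (g ` set Y)"
  have carr_G: "carrier ?G = {?m w |w. set w \<subseteq> set Y}"
    using f words by (simp add: carrier_subgroup_generated Int_absorb1 units_of_carrier image_subset_iff)
  have "generate (units_of N) (g ` set Y) = {?n w |w. set w \<subseteq> set Y}"
    using gU right_inv by (intro N.generate_eq_words) blast+
  then have carr_H: "carrier ?H = {?n w |w. set w \<subseteq> set Y}"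
    using gU by (simp add: carrier_subgroup_generated Int_absorb1 units_of_carrier image_subset_iff)
  have W_words: "set w \<subseteq> set Y" if "w \<in> set W" for w using W' that by blast
  have "carrier ?G = ?m ` set W"
    unfolding carr_G using reduce W_words by blast
  moreover have "distinct (map ?m W)"
    using W' W_words eq_iff by (auto simp: distinct_map inj_on_def)
  ultimately show "order ?G = length W"
    by (metis distinct_card length_map order_def set_map)
  define \<phi> where "\<phi> x = ?n (SOME w. set w \<subseteq> set Y \<and> ?m w = x)" for x
  have \<phi>: "\<phi> (?m w) = ?n w" if "set w \<subseteq> set Y" for w
  proof -
    have "set (SOME v. set v \<subseteq> set Y \<and> ?m v = ?m w) \<subseteq> set Y \<and> ?m (SOME v. set v \<subseteq> set Y \<and> ?m v = ?m w) = ?m w"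
      by (rule someI[of _ w]) (use that in simp)
    with that show ?thesis unfolding \<phi>_def using eq_iff by blast
  qed
  have "\<phi> \<in> iso ?G ?H"
  proof (rule isoI)
    show "\<phi> \<in> hom ?G ?H"
    proof (rule homI)
      fix x y assume "x \<in> carrier ?G" "y \<in> carrier ?G"
      then obtain u v where uv: "set u \<subseteq> set Y" "x = ?m u" "set v \<subseteq> set Y" "y = ?m v"
        by (auto simp: carr_G)
      have "\<phi> (?m (u @ v)) = ?n (u @ v)" using uv by (intro \<phi>) auto
      then have "\<phi> (x \<otimes>\<^bsub>M\<^esub> y) = \<phi> x \<otimes>\<^bsub>N\<^esub> \<phi> y"
        using uv by (simp add: m_app n_app \<phi>)
      then show "\<phi> (x \<otimes>\<^bsub>?G\<^esub> y) = \<phi> x \<otimes>\<^bsub>?H\<^esub> \<phi> y"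
        by (simp add: subgroup_generated_def units_of_def)
    qed (auto simp: carr_G carr_H \<phi>)
    show "bij_betw \<phi> (carrier ?G) (carrier ?H)"
    proof (rule bij_betw_imageI)
      show "inj_on \<phi> (carrier ?G)"
        by (rule inj_onI) (auto simp: carr_G \<phi> eq_iff)
      show "\<phi> ` carrier ?G = carrier ?H"
        by (auto simp: carr_G carr_H \<phi> image_iff) (metis \<phi>)
    qed
  qed
  then show "?G \<cong> ?H" by (auto simp: is_iso_def)
qed

lemma word_system_exists:
  assumes "monoid M" "monoid N"
    and f: "\<And>x. x \<in> set Y \<Longrightarrow> f x \<in> Units M"
    and fin: "finite (generate (units_of M) (f ` set Y))"
    and \<phi>_one: "\<phi> \<one>\<^bsub>M\<^esub> = \<one>\<^bsub>N\<^esub>"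
    and \<phi>_mult: "\<And>x y. x \<in> generate (units_of M) (f ` set Y) \<Longrightarrow> y \<in> generate (units_of M) (f ` set Y) \<Longrightarrow>
      \<phi> (x \<otimes>\<^bsub>M\<^esub> y) = \<phi> x \<otimes>\<^bsub>N\<^esub> \<phi> y"
    and \<phi>_inj: "inj_on \<phi> (generate (units_of M) (f ` set Y))"
    and g: "\<And>x. x \<in> set Y \<Longrightarrow> g x = \<phi> (f x)"
  shows "\<exists>W. word_system M N f g Y W"
proof -
  interpret M: monoid M by fact
  let ?m = "word_value M f" and ?n = "word_value N g"
  have words: "generate (units_of M) (f ` set Y) = {?m w |w. set w \<subseteq> set Y}"
    using f fin by (rule M.finite_generate_eq_words)
  have gen: "?m u \<in> generate (units_of M) (f ` set Y)" if "set u \<subseteq> set Y" for u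
    using that words by auto
  have n: "?n u = \<phi> (?m u)" if "set u \<subseteq> set Y" for u
    using that
  proof (induction u)
    case (Cons x u)
    then have "f x \<in> generate (units_of M) (f ` set Y)" by (auto intro: generate.incl)
    with Cons gen show ?case by (simp add: g \<phi>_mult)
  qed (simp add: \<phi>_one)
  \<comment> \<open>A word for each group element; a word system must contain the empty word, so it represents the identity.\<close>
  define r where "r x = (if x = \<one>\<^bsub>M\<^esub> then [] else SOME w. set w \<subseteq> set Y \<and> ?m w = x)" for x
  have r: "set (r x) \<subseteq> set Y \<and> ?m (r x) = x" if "x \<in> generate (units_of M) (f ` set Y)" for x
  proof (cases "x = \<one>\<^bsub>M\<^esub>")
    case False
    have "\<exists>w. set w \<subseteq> set Y \<and> ?m w = x" using that words by auto
    from someI_ex[OF this] False show ?thesis by (simp add: r_def)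
  qed (simp add: r_def)
  obtain xs where xs: "set xs = generate (units_of M) (f ` set Y)" "distinct xs"
    using finite_distinct_list[OF fin] by blast
  define W where "W = map r xs"
  have one: "\<one>\<^bsub>M\<^esub> \<in> set xs" using gen[of "[]"] by (simp add: xs(1))
  have W_words: "set w \<subseteq> set Y" if "w \<in> set W" for w
    using that r by (auto simp: W_def xs(1))
  have closure_words: "set u \<subseteq> set Y" if "u \<in> set (word_closure Y W)" for u
    using that W_words by (fastforce simp: set_word_closure)
  have eq_iff: "?m u = ?m v \<longleftrightarrow> ?n u = ?n v" if "set u \<subseteq> set Y" "set v \<subseteq> set Y" for u v
    using that gen by (simp add: n inj_on_eq_iff[OF \<phi>_inj])
  have "word_system M N f g Y W"
    unfolding word_system_def
  proof (intro conjI ballI)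
    show "[] \<in> set W" using one by (auto simp: W_def r_def image_iff intro!: bexI[of _ "\<one>\<^bsub>M\<^esub>"])
    fix u assume u: "u \<in> set (word_closure Y W)"
    have "r (?m u) \<in> set W" "?m (r (?m u)) = ?m u" "set (r (?m u)) \<subseteq> set Y"
      using r[OF gen[OF closure_words[OF u]]] gen[OF closure_words[OF u]] by (auto simp: W_def xs(1))
    then show "\<exists>w\<in>set W. ?n u = ?n w" using n closure_words[OF u] by metis
  next
    have "map ?m W = xs" unfolding W_def map_map by (rule map_idI) (simp add: r xs(1))
    then have "distinct (map ?m W)" using xs(2) by simp
    then show "distinct (map ?n W)"
      using W_words eq_iff by (auto simp: distinct_map inj_on_def)
  qed (use W_words closure_words eq_iff in auto)
  then show ?thesis ..
qed

section \<open>Matrices over a ring\<close>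

lemma elements_mat_subset_iff:
  assumes "A \<in> carrier_mat m n"
  shows "elements_mat A \<subseteq> S \<longleftrightarrow> (\<forall>i<m. \<forall>j<n. A $$ (i, j) \<in> S)"
proof
  assume "elements_mat A \<subseteq> S"
  then show "\<forall>i<m. \<forall>j<n. A $$ (i, j) \<in> S" using elements_matI[OF assms] by blast
next
  assume "\<forall>i<m. \<forall>j<n. A $$ (i, j) \<in> S"
  then show "elements_mat A \<subseteq> S" using assms by (auto dest!: elements_matD)
qed

lemma mat_monoid_carrier_iff:
  "A \<in> carrier (mat_monoid n R) \<longleftrightarrow> A \<in> carrier_mat n n \<and> (\<forall>i<n. \<forall>j<n. A $$ (i, j) \<in> carrier R)"
  by (auto simp: mat_monoid_def elements_mat_subset_iff)

lemma mat_monoid_mult: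
  "A \<otimes>\<^bsub>mat_monoid n R\<^esub> B = mat n n (\<lambda>(i, j). \<Oplus>\<^bsub>R\<^esub>k\<in>{..<n}. A $$ (i, k) \<otimes>\<^bsub>R\<^esub> B $$ (k, j))"
  by (simp add: mat_monoid_def)

lemma mat_monoid_one:
  "\<one>\<^bsub>mat_monoid n R\<^esub> = mat n n (\<lambda>(i, j). if i = j then \<one>\<^bsub>R\<^esub> else \<zero>\<^bsub>R\<^esub>)"
  by (simp add: mat_monoid_def)

lemma (in ring) mat_monoid_monoid: "monoid (mat_monoid n R)"
proof (rule monoidI)
  show "\<one>\<^bsub>mat_monoid n R\<^esub> \<in> carrier (mat_monoid n R)"
    by (simp add: mat_monoid_carrier_iff mat_monoid_one)
next
  fix A B assume "A \<in> carrier (mat_monoid n R)" "B \<in> carrier (mat_monoid n R)"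
  then show "A \<otimes>\<^bsub>mat_monoid n R\<^esub> B \<in> carrier (mat_monoid n R)"
    by (simp add: mat_monoid_carrier_iff mat_monoid_mult Pi_def)
next
  fix A assume A: "A \<in> carrier (mat_monoid n R)"
  have "(\<Oplus>k\<in>{..<n}. (if i = k then \<one> else \<zero>) \<otimes> A $$ (k, j)) = A $$ (i, j)" if "i < n" "j < n" for i j
  proof -
    have "(\<Oplus>k\<in>{..<n}. (if i = k then \<one> else \<zero>) \<otimes> A $$ (k, j))
        = (\<Oplus>k\<in>{..<n}. if i = k then A $$ (k, j) else \<zero>)"
      using A that by (intro finsum_cong') (auto simp: mat_monoid_carrier_iff)
    with A that show ?thesis
      using finsum_singleton[of i "{..<n}" "\<lambda>k. A $$ (k, j)"] by (auto simp: mat_monoid_carrier_iff Pi_def)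
  qed
  with A show "\<one>\<^bsub>mat_monoid n R\<^esub> \<otimes>\<^bsub>mat_monoid n R\<^esub> A = A"
    by (intro eq_matI) (auto simp: mat_monoid_carrier_iff mat_monoid_mult mat_monoid_one cong: finsum_cong)
  have "(\<Oplus>k\<in>{..<n}. A $$ (i, k) \<otimes> (if k = j then \<one> else \<zero>)) = A $$ (i, j)" if "i < n" "j < n" for i j
  proof -
    have "(\<Oplus>k\<in>{..<n}. A $$ (i, k) \<otimes> (if k = j then \<one> else \<zero>))
        = (\<Oplus>k\<in>{..<n}. if j = k then A $$ (i, k) else \<zero>)"
      using A that by (intro finsum_cong') (auto simp: mat_monoid_carrier_iff)
    with A that show ?thesis
      using finsum_singleton[of j "{..<n}" "\<lambda>k. A $$ (i, k)"] by (auto simp: mat_monoid_carrier_iff Pi_def)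
  qed
  with A show "A \<otimes>\<^bsub>mat_monoid n R\<^esub> \<one>\<^bsub>mat_monoid n R\<^esub> = A"
    by (intro eq_matI) (auto simp: mat_monoid_carrier_iff mat_monoid_mult mat_monoid_one cong: finsum_cong)
next
  fix A B C
  assume ABC: "A \<in> carrier (mat_monoid n R)" "B \<in> carrier (mat_monoid n R)" "C \<in> carrier (mat_monoid n R)"
  have cl: "A $$ (i, j) \<in> carrier R" "B $$ (i, j) \<in> carrier R" "C $$ (i, j) \<in> carrier R" if "i < n" "j < n" for i j
    using ABC that by (auto simp: mat_monoid_carrier_iff)
  let ?M = "mat_monoid n R"
  have "(\<Oplus>l\<in>{..<n}. (A \<otimes>\<^bsub>?M\<^esub> B) $$ (i, l) \<otimes> C $$ (l, j))
      = (\<Oplus>k\<in>{..<n}. A $$ (i, k) \<otimes> (B \<otimes>\<^bsub>?M\<^esub> C) $$ (k, j))" if "i < n" "j < n" for i j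
  proof -
    have "(\<Oplus>l\<in>{..<n}. (A \<otimes>\<^bsub>?M\<^esub> B) $$ (i, l) \<otimes> C $$ (l, j))
        = (\<Oplus>l\<in>{..<n}. (\<Oplus>k\<in>{..<n}. A $$ (i, k) \<otimes> B $$ (k, l)) \<otimes> C $$ (l, j))"
      using that cl by (intro finsum_cong') (auto simp: mat_monoid_mult intro!: finsum_closed)
    also have "(\<Oplus>l\<in>{..<n}. (\<Oplus>k\<in>{..<n}. A $$ (i, k) \<otimes> B $$ (k, l)) \<otimes> C $$ (l, j))
        = (\<Oplus>l\<in>{..<n}. \<Oplus>k\<in>{..<n}. A $$ (i, k) \<otimes> B $$ (k, l) \<otimes> C $$ (l, j))"
      using that cl by (intro finsum_cong' refl finsum_ldistr) (auto intro!: finsum_closed)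
    also have "\<dots> = (\<Oplus>k\<in>{..<n}. \<Oplus>l\<in>{..<n}. A $$ (i, k) \<otimes> B $$ (k, l) \<otimes> C $$ (l, j))"
      using that cl by (intro finsum_swap) auto
    also have "\<dots> = (\<Oplus>k\<in>{..<n}. \<Oplus>l\<in>{..<n}. A $$ (i, k) \<otimes> (B $$ (k, l) \<otimes> C $$ (l, j)))"
      using that cl by (intro finsum_cong') (auto intro!: finsum_closed finsum_cong' simp: m_assoc)
    also have "\<dots> = (\<Oplus>k\<in>{..<n}. A $$ (i, k) \<otimes> (\<Oplus>l\<in>{..<n}. B $$ (k, l) \<otimes> C $$ (l, j)))"
      using that cl by (intro finsum_cong' refl finsum_rdistr[symmetric]) (auto intro!: finsum_closed)
    also have "\<dots> = (\<Oplus>k\<in>{..<n}. A $$ (i, k) \<otimes> (B \<otimes>\<^bsub>?M\<^esub> C) $$ (k, j))"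
      using that cl by (intro finsum_cong') (auto simp: mat_monoid_mult intro!: finsum_closed)
    finally show ?thesis .
  qed
  then show "A \<otimes>\<^bsub>mat_monoid n R\<^esub> B \<otimes>\<^bsub>mat_monoid n R\<^esub> C
      = A \<otimes>\<^bsub>mat_monoid n R\<^esub> (B \<otimes>\<^bsub>mat_monoid n R\<^esub> C)"
    by (subst (1 3) mat_monoid_mult) (intro eq_matI; simp)
qed

context specialisation
begin

lemma local_finsum:
  assumes "finite I" "\<And>i. i \<in> I \<Longrightarrow> f i \<in> local_part R L h"
  shows "finsum (fraction_field R) f I \<in> local_part R L h \<and>
    local_eval R L h (finsum (fraction_field R) f I) = (\<Oplus>i\<in>I. local_eval R L h (f i))"
proof -
  interpret F: cring "fraction_field R" by (rule R.fraction_field_cring)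
  show ?thesis
    using assms
  proof (induction I)
    case empty
    then show ?case using local_zero by simp
  next
    case (insert i I)
    have "f j \<in> carrier (fraction_field R)" "local_eval R L h (f j) \<in> carrier L" if "j \<in> insert i I" for j
      using insert.prems[OF that] local_part_subset local_eval_closed by auto
    with insert show ?case
      using local_add[of "f i" "finsum (fraction_field R) f I"]
      by (simp add: Pi_def)
  qed
qed

lemma local_mat_mult:
  assumes "A \<in> carrier_mat n n" "elements_mat A \<subseteq> local_part R L h"
    and "B \<in> carrier_mat n n" "elements_mat B \<subseteq> local_part R L h"
  shows "map_mat (local_eval R L h) (A \<otimes>\<^bsub>mat_monoid n (fraction_field R)\<^esub> B)
    = map_mat (local_eval R L h) A \<otimes>\<^bsub>mat_monoid n L\<^esub> map_mat (local_eval R L h) B"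
proof -
  have el: "A $$ (i, j) \<in> local_part R L h" "B $$ (i, j) \<in> local_part R L h" if "i < n" "j < n" for i j
    using assms that by (simp_all add: elements_mat_subset_iff)
  have cl: "local_eval R L h (A $$ (i, j)) \<in> carrier L" "local_eval R L h (B $$ (i, j)) \<in> carrier L"
    if "i < n" "j < n" for i j
    using el that local_eval_closed by auto
  let ?e = "local_eval R L h"
  have "?e (\<Oplus>\<^bsub>fraction_field R\<^esub>k\<in>{..<n}. A $$ (i, k) \<otimes>\<^bsub>fraction_field R\<^esub> B $$ (k, j))
      = (\<Oplus>k\<in>{..<n}. map_mat ?e A $$ (i, k) \<otimes> map_mat ?e B $$ (k, j))"
    if "i < n" "j < n" for i j
  proof -
    have "?e (\<Oplus>\<^bsub>fraction_field R\<^esub>k\<in>{..<n}. A $$ (i, k) \<otimes>\<^bsub>fraction_field R\<^esub> B $$ (k, j))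
        = (\<Oplus>k\<in>{..<n}. ?e (A $$ (i, k) \<otimes>\<^bsub>fraction_field R\<^esub> B $$ (k, j)))"
      using local_mult el that by (intro conjunct2[OF local_finsum]) auto
    also have "\<dots> = (\<Oplus>k\<in>{..<n}. map_mat ?e A $$ (i, k) \<otimes> map_mat ?e B $$ (k, j))"
      using local_mult el cl that assms(1,3) by (intro L.finsum_cong') auto
    finally show ?thesis .
  qed
  with assms(1,3) show ?thesis
    by (intro eq_matI) (simp_all add: mat_monoid_mult)
qed

lemma local_mat_one:
  "map_mat (local_eval R L h) \<one>\<^bsub>mat_monoid n (fraction_field R)\<^esub> = \<one>\<^bsub>mat_monoid n L\<^esub>"
  using local_zero local_one by (intro eq_matI) (auto simp: mat_monoid_one)

end

section \<open>Arithmetic on expressions\<close>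

text \<open>The operations on expressions take the operations on coefficients from a ring \<open>R\<close>.  The algorithm uses them
  with a \<open>table_ring\<close>, while their values refer to the given field.\<close>

definition term_mult :: "nat ring \<Rightarrow> nat \<times> nat list \<Rightarrow> nat \<times> nat list \<Rightarrow> nat \<times> nat list" where
  "term_mult R s t = (fst s \<otimes>\<^bsub>R\<^esub> fst t,
     map (\<lambda>i. nth_default 0 (snd s) i + nth_default 0 (snd t) i) [0..<length (snd s)])"

definition expr_mult :: "nat ring \<Rightarrow> poly_expr \<Rightarrow> poly_expr \<Rightarrow> poly_expr" where
  "expr_mult R p r = concat (map (\<lambda>s. map (\<lambda>t. term_mult R s t) r) p)"

definition coeff_at :: "nat ring \<Rightarrow> nat list \<Rightarrow> poly_expr \<Rightarrow> nat" where
  "coeff_at R e p = foldr (\<lambda>t s. if snd t = e then fst t \<oplus>\<^bsub>R\<^esub> s else s) p \<zero>\<^bsub>R\<^esub>"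

definition expr_equal :: "nat ring \<Rightarrow> poly_expr \<Rightarrow> poly_expr \<Rightarrow> bool" where
  "expr_equal R p r \<longleftrightarrow> (\<forall>t\<in>set (p @ r). coeff_at R (snd t) p = coeff_at R (snd t) r)"

definition ratfun_mult :: "nat ring \<Rightarrow> ratfun_expr \<Rightarrow> ratfun_expr \<Rightarrow> ratfun_expr" where
  "ratfun_mult R x y = (expr_mult R (fst x) (fst y), expr_mult R (snd x) (snd y))"

definition ratfun_add :: "nat ring \<Rightarrow> ratfun_expr \<Rightarrow> ratfun_expr \<Rightarrow> ratfun_expr" where
  "ratfun_add R x y =
     (expr_mult R (fst x) (snd y) @ expr_mult R (fst y) (snd x), expr_mult R (snd x) (snd y))"

definition ratfun_equal :: "nat ring \<Rightarrow> ratfun_expr \<Rightarrow> ratfun_expr \<Rightarrow> bool" where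
  "ratfun_equal R x y \<longleftrightarrow>
     expr_equal R (expr_mult R (fst x) (snd y)) (expr_mult R (fst y) (snd x))"

definition ratfun_const :: "nat ring \<Rightarrow> nat \<Rightarrow> nat \<Rightarrow> ratfun_expr" where
  "ratfun_const R m c = ([(c, replicate m 0)], [(\<one>\<^bsub>R\<^esub>, replicate m 0)])"

definition monomial :: "nat list \<Rightarrow> nat multiset" where
  "monomial e = (\<Sum>i<length e. replicate_mset (e ! i) i)"

lemma count_monomial: "count (monomial e) j = (if j < length e then e ! j else 0)"
proof -
  have "count (monomial e) j = (\<Sum>i<length e. if j = i then e ! i else 0)"
    by (simp add: monomial_def count_sum cong: sum.cong)
  then show ?thesis by simp
qed

lemma monomial_vars: "set_mset (monomial e) \<subseteq> {..<length e}"
  by (auto simp: count_monomial simp flip: count_greater_zero_iff split: if_splits)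

lemma monomial_inj: "length e = length e' \<Longrightarrow> monomial e = monomial e' \<longleftrightarrow> e = e'"
  by (auto simp: multiset_eq_iff count_monomial intro!: nth_equalityI)

text \<open>\<open>K'\<close> is \<open>K\<close> as it can be recovered from its tables, which say nothing about arguments outside the carrier.\<close>

locale tabulated = domain K for K :: "nat ring" and K' :: "nat ring" +
  assumes tab_zero: "\<zero>\<^bsub>K'\<^esub> = \<zero>\<^bsub>K\<^esub>" and tab_one: "\<one>\<^bsub>K'\<^esub> = \<one>\<^bsub>K\<^esub>"
    and tab_add: "\<And>a b. a \<in> carrier K \<Longrightarrow> b \<in> carrier K \<Longrightarrow> a \<oplus>\<^bsub>K'\<^esub> b = a \<oplus>\<^bsub>K\<^esub> b"
    and tab_mult: "\<And>a b. a \<in> carrier K \<Longrightarrow> b \<in> carrier K \<Longrightarrow> a \<otimes>\<^bsub>K'\<^esub> b = a \<otimes>\<^bsub>K\<^esub> b"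
begin

lemma poly_exprs_Nil: "[] \<in> poly_exprs K m"
  and poly_exprs_Cons': "t # p \<in> poly_exprs K m \<longleftrightarrow>
    fst t \<in> carrier K \<and> length (snd t) = m \<and> p \<in> poly_exprs K m"
  and poly_exprs_append: "p @ r \<in> poly_exprs K m \<longleftrightarrow> p \<in> poly_exprs K m \<and> r \<in> poly_exprs K m"
  by (auto simp: poly_exprs_def)

lemma term_value_monomial: "term_value K t = (\<lambda>M. if M = monomial (snd t) then fst t else \<zero>\<^bsub>K\<^esub>)"
  by (cases t) (simp add: term_value_def monomial_def fun_eq_iff)

lemma term_value_carrier:
  "fst t \<in> carrier K \<Longrightarrow> length (snd t) = m \<Longrightarrow> term_value K t \<in> carrier (mpoly_ring K m)"
  unfolding term_value_monomial using monomial_vars[of "snd t"] by (intro mpoly_carrier_single) auto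

lemma poly_value_add: "poly_value K (t # p) = term_value K t \<oplus>\<^bsub>mpoly_ring K m\<^esub> poly_value K p"
  by (simp add: poly_value_def mpoly_ring_def)

lemma poly_value_zero: "poly_value K [] = \<zero>\<^bsub>mpoly_ring K m\<^esub>"
  by (simp add: poly_value_def mpoly_ring_def)

lemma poly_value_carrier: "p \<in> poly_exprs K m \<Longrightarrow> poly_value K p \<in> carrier (mpoly_ring K m)"
proof (induction p)
  case Nil
  then show ?case by (simp add: poly_value_zero[of m] mpoly_zero_closed)
next
  case (Cons t p)
  then show ?case
    by (simp add: poly_value_add[of t p m] poly_exprs_Cons' mpoly_add_closed term_value_carrier)
qed

lemma poly_value_append':
  assumes "p \<in> poly_exprs K m" "r \<in> poly_exprs K m"
  shows "poly_value K (p @ r) = poly_value K p \<oplus>\<^bsub>mpoly_ring K m\<^esub> poly_value K r"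
  using poly_value_append[OF ring_axioms assms] by (simp add: fun_eq_iff mpoly_add)

lemma term_mult:
  assumes s: "fst s \<in> carrier K" "length (snd s) = m" and t: "fst t \<in> carrier K" "length (snd t) = m"
  shows "fst (term_mult K' s t) \<in> carrier K" "length (snd (term_mult K' s t)) = m"
    and "term_value K (term_mult K' s t) = term_value K s \<otimes>\<^bsub>mpoly_ring K m\<^esub> term_value K t"
proof -
  show "fst (term_mult K' s t) \<in> carrier K" "length (snd (term_mult K' s t)) = m"
    using s t by (simp_all add: term_mult_def tab_mult)
  have mon: "monomial (snd (term_mult K' s t)) = monomial (snd s) + monomial (snd t)"
    using s t by (simp add: multiset_eq_iff count_monomial term_mult_def)
  show "term_value K (term_mult K' s t) = term_value K s \<otimes>\<^bsub>mpoly_ring K m\<^esub> term_value K t"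
  proof
    fix M
    let ?f = "\<lambda>A. term_value K s A \<otimes>\<^bsub>K\<^esub> term_value K t (M - A)"
    have cl: "?f A \<in> carrier K" for A using s t by (simp add: term_value_monomial)
    have "(term_value K s \<otimes>\<^bsub>mpoly_ring K m\<^esub> term_value K t) M = (\<Oplus>\<^bsub>K\<^esub>A\<in>{A. A \<subseteq># M}. ?f A)"
      by (rule mpoly_mult)
    also have "\<dots> = (\<Oplus>\<^bsub>K\<^esub>A\<in>{A. A \<subseteq># M}. if monomial (snd s) = A then ?f A else \<zero>\<^bsub>K\<^esub>)"
      using s t by (intro finsum_cong') (auto simp: term_value_monomial)
    also have "\<dots> = (if M = monomial (snd s) + monomial (snd t) then fst s \<otimes>\<^bsub>K\<^esub> fst t else \<zero>\<^bsub>K\<^esub>)"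
    proof (cases "monomial (snd s) \<subseteq># M")
      case True
      then have "(\<Oplus>\<^bsub>K\<^esub>A\<in>{A. A \<subseteq># M}. if monomial (snd s) = A then ?f A else \<zero>\<^bsub>K\<^esub>) = ?f (monomial (snd s))"
        using cl by (intro finsum_singleton) (auto simp: finite_submultisets)
      with True s t show ?thesis by (auto simp: term_value_monomial subset_mset.le_iff_add)
    next
      case False
      then have "(\<Oplus>\<^bsub>K\<^esub>A\<in>{A. A \<subseteq># M}. if monomial (snd s) = A then ?f A else \<zero>\<^bsub>K\<^esub>)
          = (\<Oplus>\<^bsub>K\<^esub>A\<in>{A. A \<subseteq># M}. \<zero>\<^bsub>K\<^esub>)"
        by (intro finsum_cong') auto
      with False show ?thesis by auto
    qed
    finally show "term_value K (term_mult K' s t) M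
        = (term_value K s \<otimes>\<^bsub>mpoly_ring K m\<^esub> term_value K t) M"
      using s t mon by (simp add: term_value_monomial) (simp add: term_mult_def tab_mult)
  qed
qed

lemma expr_mult:
  assumes p: "p \<in> poly_exprs K m" and r: "r \<in> poly_exprs K m"
  shows "expr_mult K' p r \<in> poly_exprs K m \<and>
    poly_value K (expr_mult K' p r) = poly_value K p \<otimes>\<^bsub>mpoly_ring K m\<^esub> poly_value K r"
proof -
  interpret A: cring "mpoly_ring K m" by (rule mpoly_cring)
  have row: "map (\<lambda>t. term_mult K' s t) r \<in> poly_exprs K m \<and>
      poly_value K (map (\<lambda>t. term_mult K' s t) r) = term_value K s \<otimes>\<^bsub>mpoly_ring K m\<^esub> poly_value K r"
    if s: "fst s \<in> carrier K" "length (snd s) = m" for s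
    using r
  proof (induction r)
    case Nil
    then show ?case
      using term_value_carrier[OF s] by (simp add: poly_exprs_Nil poly_value_zero[of m])
  next
    case (Cons t r)
    then have t: "fst t \<in> carrier K" "length (snd t) = m" and r: "r \<in> poly_exprs K m"
      by (simp_all add: poly_exprs_Cons')
    show ?case
      using Cons.IH[OF r] term_mult[OF s t] term_value_carrier[OF s] term_value_carrier[OF t]
        poly_value_carrier[OF r]
      by (simp add: poly_exprs_Cons' poly_value_add[of _ _ m] A.r_distr)
  qed
  show ?thesis
    using p
  proof (induction p)
    case Nil
    then show ?case
      using poly_value_carrier[OF r]
      by (simp add: expr_mult_def poly_exprs_Nil poly_value_zero[of m])
  next
    case (Cons s p)
    then have s: "fst s \<in> carrier K" "length (snd s) = m" and p: "p \<in> poly_exprs K m"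
      by (simp_all add: poly_exprs_Cons')
    have "expr_mult K' (s # p) r = map (\<lambda>t. term_mult K' s t) r @ expr_mult K' p r"
      by (simp add: expr_mult_def)
    then show ?case
      using Cons.IH[OF p] row[OF s] term_value_carrier[OF s]
        poly_value_carrier[OF r] poly_value_carrier[OF p]
      by (simp add: poly_exprs_append poly_value_append'[of _ m] poly_value_add[of _ _ m] A.l_distr)
  qed
qed

lemma coeff_at:
  assumes "p \<in> poly_exprs K m" "length e = m"
  shows "coeff_at K' e p = poly_value K p (monomial e)"
  using assms(1)
proof (induction p)
  case Nil
  then show ?case by (simp add: coeff_at_def tab_zero poly_value_Nil[OF ring_axioms])
next
  case (Cons t p)
  then have t: "fst t \<in> carrier K" "length (snd t) = m" and p: "p \<in> poly_exprs K m"
    by (simp_all add: poly_exprs_Cons')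
  have cl: "poly_value K p (monomial e) \<in> carrier K" using p by (rule poly_value_closed[OF ring_axioms])
  have eq: "coeff_at K' e p = poly_value K p (monomial e)" by (rule Cons.IH[OF p])
  have "coeff_at K' e (t # p) = (if snd t = e then fst t \<oplus>\<^bsub>K'\<^esub> coeff_at K' e p else coeff_at K' e p)"
    by (simp add: coeff_at_def)
  also have "\<dots> = term_value K t (monomial e) \<oplus>\<^bsub>K\<^esub> poly_value K p (monomial e)"
    using t cl assms(2) by (auto simp: eq tab_add term_value_monomial monomial_inj)
  finally show ?case by (simp add: poly_value_Cons[OF ring_axioms])
qed

lemma poly_value_outside:
  assumes "p \<in> poly_exprs K m" "\<And>t. t \<in> set p \<Longrightarrow> M \<noteq> monomial (snd t)"
  shows "poly_value K p M = \<zero>\<^bsub>K\<^esub>"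
  using assms
  by (induction p) (auto simp: poly_value_Nil[OF ring_axioms] poly_value_Cons[OF ring_axioms]
      term_value_monomial poly_exprs_Cons')

text \<open>Monomials may be repeated in an expression and coefficients may be zero, so equality is decided by comparing
  the accumulated coefficients of all monomials that occur on either side.\<close>

lemma expr_equal_iff:
  assumes p: "p \<in> poly_exprs K m" and r: "r \<in> poly_exprs K m"
  shows "expr_equal K' p r \<longleftrightarrow> poly_value K p = poly_value K r"
proof
  assume eq: "expr_equal K' p r"
  show "poly_value K p = poly_value K r"
  proof
    fix M
    show "poly_value K p M = poly_value K r M"
    proof (cases "\<exists>t\<in>set (p @ r). M = monomial (snd t)")
      case True
      then obtain t where t: "t \<in> set (p @ r)" "M = monomial (snd t)" by blast
      then have len: "length (snd t) = m" using p r by (auto simp: poly_exprs_def)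
      have "coeff_at K' (snd t) p = coeff_at K' (snd t) r" using t(1) eq unfolding expr_equal_def by blast
      then show ?thesis using coeff_at[OF p len] coeff_at[OF r len] t(2) by simp
    next
      case False
      then show ?thesis using poly_value_outside[OF p, of M] poly_value_outside[OF r, of M] by auto
    qed
  qed
next
  assume eq: "poly_value K p = poly_value K r"
  show "expr_equal K' p r"
    unfolding expr_equal_def
  proof
    fix t assume "t \<in> set (p @ r)"
    then have "length (snd t) = m" using p r by (auto simp: poly_exprs_def)
    with p r eq show "coeff_at K' (snd t) p = coeff_at K' (snd t) r" by (simp add: coeff_at)
  qed
qed

lemma ratfun_exprsD:
  assumes "x \<in> ratfun_exprs K m"
  shows "fst x \<in> poly_exprs K m" "snd x \<in> poly_exprs K m" "poly_value K (snd x) \<noteq> \<zero>\<^bsub>mpoly_ring K m\<^esub>"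
  using assms by (auto simp: ratfun_exprs_def)

lemma ratfun_exprsI:
  "p \<in> poly_exprs K m \<Longrightarrow> r \<in> poly_exprs K m \<Longrightarrow> poly_value K r \<noteq> \<zero>\<^bsub>mpoly_ring K m\<^esub>
    \<Longrightarrow> (p, r) \<in> ratfun_exprs K m"
  by (simp add: ratfun_exprs_def)

lemma ratfun_value_fraction:
  "ratfun_value K m x = fraction (mpoly_ring K m) (poly_value K (fst x)) (poly_value K (snd x))"
  by (simp add: ratfun_value_def case_prod_beta)

lemma ratfun_value_closed:
  assumes "x \<in> ratfun_exprs K m"
  shows "ratfun_value K m x \<in> carrier (ratfun_field K m)"
  unfolding ratfun_value_fraction ratfun_field_def
  using domain.fraction_closed[OF mpoly_domain] ratfun_exprsD[OF assms] poly_value_carrier by blast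

lemma
  assumes x: "x \<in> ratfun_exprs K m" and y: "y \<in> ratfun_exprs K m"
  shows ratfun_mult: "ratfun_mult K' x y \<in> ratfun_exprs K m \<and> ratfun_value K m (ratfun_mult K' x y)
      = ratfun_value K m x \<otimes>\<^bsub>ratfun_field K m\<^esub> ratfun_value K m y"
    and ratfun_add: "ratfun_add K' x y \<in> ratfun_exprs K m \<and> ratfun_value K m (ratfun_add K' x y)
      = ratfun_value K m x \<oplus>\<^bsub>ratfun_field K m\<^esub> ratfun_value K m y"
    and ratfun_equal: "ratfun_equal K' x y \<longleftrightarrow> ratfun_value K m x = ratfun_value K m y"
proof -
  interpret A: domain "mpoly_ring K m" by (rule mpoly_domain)
  note xD = ratfun_exprsD[OF x] and yD = ratfun_exprsD[OF y]
  note cl = poly_value_carrier[OF xD(1)] poly_value_carrier[OF xD(2)]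
    poly_value_carrier[OF yD(1)] poly_value_carrier[OF yD(2)]
  note mult = expr_mult[OF xD(1) yD(1)] expr_mult[OF xD(2) yD(2)]
    expr_mult[OF xD(1) yD(2)] expr_mult[OF yD(1) xD(2)]
  have nz: "poly_value K (snd x) \<otimes>\<^bsub>mpoly_ring K m\<^esub> poly_value K (snd y) \<noteq> \<zero>\<^bsub>mpoly_ring K m\<^esub>"
    using cl xD(3) yD(3) by (simp add: A.integral_iff)
  show "ratfun_mult K' x y \<in> ratfun_exprs K m \<and> ratfun_value K m (ratfun_mult K' x y)
      = ratfun_value K m x \<otimes>\<^bsub>ratfun_field K m\<^esub> ratfun_value K m y"
    using nz mult cl xD(3) yD(3)
    by (auto simp: ratfun_mult_def ratfun_value_fraction ratfun_field_def A.fraction_mult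
        intro!: ratfun_exprsI)
  show "ratfun_add K' x y \<in> ratfun_exprs K m \<and> ratfun_value K m (ratfun_add K' x y)
      = ratfun_value K m x \<oplus>\<^bsub>ratfun_field K m\<^esub> ratfun_value K m y"
    using nz mult cl xD(3) yD(3)
    by (auto simp: ratfun_add_def ratfun_value_fraction ratfun_field_def A.fraction_add
        poly_exprs_append poly_value_append'[of _ m] intro!: ratfun_exprsI)
  show "ratfun_equal K' x y \<longleftrightarrow> ratfun_value K m x = ratfun_value K m y"
    using mult cl xD(3) yD(3)
    by (simp add: ratfun_equal_def expr_equal_iff[of _ m] ratfun_value_fraction A.fraction_eq_iff)
qed

lemma poly_value_const:
  assumes "c \<in> carrier K"
  shows "poly_value K [(c, replicate m 0)] M = (if M = {#} then c else \<zero>\<^bsub>K\<^esub>)"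
proof -
  have "monomial (replicate m 0) = {#}" by (simp add: multiset_eq_iff count_monomial)
  with assms show ?thesis
    by (simp add: poly_value_Cons[OF ring_axioms] poly_value_Nil[OF ring_axioms] term_value_monomial)
qed

lemma
  shows ratfun_zero: "ratfun_const K' m \<zero>\<^bsub>K'\<^esub> \<in> ratfun_exprs K m \<and>
      ratfun_value K m (ratfun_const K' m \<zero>\<^bsub>K'\<^esub>) = \<zero>\<^bsub>ratfun_field K m\<^esub>"
    and ratfun_one: "ratfun_const K' m \<one>\<^bsub>K'\<^esub> \<in> ratfun_exprs K m \<and>
      ratfun_value K m (ratfun_const K' m \<one>\<^bsub>K'\<^esub>) = \<one>\<^bsub>ratfun_field K m\<^esub>"
proof -
  interpret A: domain "mpoly_ring K m" by (rule mpoly_domain)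
  have "poly_value K [(\<zero>\<^bsub>K\<^esub>, replicate m 0)] = \<zero>\<^bsub>mpoly_ring K m\<^esub>"
    "poly_value K [(\<one>\<^bsub>K\<^esub>, replicate m 0)] = \<one>\<^bsub>mpoly_ring K m\<^esub>"
    by (simp_all add: fun_eq_iff poly_value_const mpoly_zero mpoly_one)
  then show "ratfun_const K' m \<zero>\<^bsub>K'\<^esub> \<in> ratfun_exprs K m \<and>
      ratfun_value K m (ratfun_const K' m \<zero>\<^bsub>K'\<^esub>) = \<zero>\<^bsub>ratfun_field K m\<^esub>"
    "ratfun_const K' m \<one>\<^bsub>K'\<^esub> \<in> ratfun_exprs K m \<and>
      ratfun_value K m (ratfun_const K' m \<one>\<^bsub>K'\<^esub>) = \<one>\<^bsub>ratfun_field K m\<^esub>"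
    by (simp_all add: ratfun_const_def tab_zero tab_one ratfun_exprs_def ratfun_value_fraction
        ratfun_field_def A.fraction_zero A.fraction_one poly_exprs_def)
qed

end

section \<open>Matrices as lists of rows\<close>

definition rows_mult :: "('e \<Rightarrow> 'e \<Rightarrow> 'e) \<Rightarrow> ('e \<Rightarrow> 'e \<Rightarrow> 'e) \<Rightarrow> 'e \<Rightarrow> nat \<Rightarrow> 'e list list \<Rightarrow> 'e list list \<Rightarrow> 'e list list"
  where
  "rows_mult pl ml z n A B = rows_of n (\<lambda>i j.
     foldr (\<lambda>k s. pl (ml (rows_entry z A i k) (rows_entry z B k j)) s) [0..<n] z)"

definition rows_one :: "'e \<Rightarrow> 'e \<Rightarrow> nat \<Rightarrow> 'e list list" where
  "rows_one z u n = rows_of n (\<lambda>i j. if i = j then u else z)"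

definition word_rows :: "('e \<Rightarrow> 'e \<Rightarrow> 'e) \<Rightarrow> ('e \<Rightarrow> 'e \<Rightarrow> 'e) \<Rightarrow> 'e \<Rightarrow> 'e \<Rightarrow> nat \<Rightarrow> 'e list list list \<Rightarrow> 'e list list"
  where
  "word_rows pl ml z u n w = foldr (\<lambda>A B. rows_mult pl ml z n A B) w (rows_one z u n)"

definition rows_equal :: "('e \<Rightarrow> 'e \<Rightarrow> bool) \<Rightarrow> 'e \<Rightarrow> nat \<Rightarrow> 'e list list \<Rightarrow> 'e list list \<Rightarrow> bool" where
  "rows_equal eqv z n A B \<longleftrightarrow> (\<forall>i<n. \<forall>j<n. eqv (rows_entry z A i j) (rows_entry z B i j))"

text \<open>Expressions for elements of a ring, with computable operations and a computable equality.  It covers both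
  rational functions, where many expressions have the same value, and the elements of a field given by tables,
  which present themselves.\<close>

locale ring_presentation = ring R for R (structure) +
  fixes E :: "'e set" and v :: "'e \<Rightarrow> 'a" and padd pmul :: "'e \<Rightarrow> 'e \<Rightarrow> 'e" and z u :: 'e
    and eqv :: "'e \<Rightarrow> 'e \<Rightarrow> bool"
  assumes v_closed: "x \<in> E \<Longrightarrow> v x \<in> carrier R"
    and z: "z \<in> E \<and> v z = \<zero>" and u: "u \<in> E \<and> v u = \<one>"
    and padd: "x \<in> E \<Longrightarrow> y \<in> E \<Longrightarrow> padd x y \<in> E \<and> v (padd x y) = v x \<oplus> v y"
    and pmul: "x \<in> E \<Longrightarrow> y \<in> E \<Longrightarrow> pmul x y \<in> E \<and> v (pmul x y) = v x \<otimes> v y"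
    and eqv: "x \<in> E \<Longrightarrow> y \<in> E \<Longrightarrow> eqv x y \<longleftrightarrow> v x = v y"
begin

definition valid_rows :: "nat \<Rightarrow> 'e list list \<Rightarrow> bool" where
  "valid_rows n A \<longleftrightarrow> (\<forall>i<n. \<forall>j<n. rows_entry z A i j \<in> E)"

definition rows_value :: "nat \<Rightarrow> 'e list list \<Rightarrow> 'a mat" where
  "rows_value n A = mat n n (\<lambda>(i, j). v (rows_entry z A i j))"

lemma foldr_padd:
  assumes "distinct ks" "\<And>k. k \<in> set ks \<Longrightarrow> f k \<in> E"
  shows "foldr (\<lambda>k s. padd (f k) s) ks z \<in> E \<and>
    v (foldr (\<lambda>k s. padd (f k) s) ks z) = (\<Oplus>k\<in>set ks. v (f k))"
  using assms by (induction ks) (simp_all add: z padd v_closed Pi_def)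

lemma rows_mult:
  assumes "valid_rows n A" "valid_rows n B"
  shows "valid_rows n (rows_mult padd pmul z n A B) \<and>
    rows_value n (rows_mult padd pmul z n A B) = rows_value n A \<otimes>\<^bsub>mat_monoid n R\<^esub> rows_value n B"
proof -
  have fold: "foldr (\<lambda>k s. padd (pmul (rows_entry z A i k) (rows_entry z B k j)) s) [0..<n] z \<in> E \<and>
      v (foldr (\<lambda>k s. padd (pmul (rows_entry z A i k) (rows_entry z B k j)) s) [0..<n] z)
      = (\<Oplus>k\<in>{..<n}. rows_value n A $$ (i, k) \<otimes> rows_value n B $$ (k, j))"
    if "i < n" "j < n" for i j
  proof -
    have "(\<Oplus>k\<in>set [0..<n]. v (pmul (rows_entry z A i k) (rows_entry z B k j)))
        = (\<Oplus>k\<in>{..<n}. rows_value n A $$ (i, k) \<otimes> rows_value n B $$ (k, j))"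
      using assms that by (intro finsum_cong') (auto simp: valid_rows_def rows_value_def pmul v_closed)
    with foldr_padd[of "[0..<n]" "\<lambda>k. pmul (rows_entry z A i k) (rows_entry z B k j)"] assms that pmul
    show ?thesis by (auto simp: valid_rows_def)
  qed
  show ?thesis
  proof
    show "valid_rows n (rows_mult padd pmul z n A B)"
      using fold by (simp add: valid_rows_def rows_mult_def)
    show "rows_value n (rows_mult padd pmul z n A B) = rows_value n A \<otimes>\<^bsub>mat_monoid n R\<^esub> rows_value n B"
      by (intro eq_matI) (simp_all add: mat_monoid_mult rows_mult_def fold
          rows_value_def[of n "rows_of n _"] rows_value_def[of n "rows_mult _ _ _ _ _ _"])
  qed
qed

lemma rows_one:
  "valid_rows n (rows_one z u n) \<and> rows_value n (rows_one z u n) = \<one>\<^bsub>mat_monoid n R\<^esub>"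
  using z u by (auto simp: valid_rows_def rows_value_def rows_one_def mat_monoid_one intro!: eq_matI)

lemma word_rows:
  assumes "\<And>x. x \<in> set w \<Longrightarrow> valid_rows n (f x)"
  shows "valid_rows n (word_rows padd pmul z u n (map f w)) \<and>
    rows_value n (word_rows padd pmul z u n (map f w)) = word_value (mat_monoid n R) (\<lambda>x. rows_value n (f x)) w"
  using assms
proof (induction w)
  case Nil
  then show ?case using rows_one by (simp add: word_rows_def)
next
  case (Cons x w)
  then show ?case using rows_mult[of n "f x" "word_rows padd pmul z u n (map f w)"] by (simp add: word_rows_def)
qed

lemma rows_equal:
  assumes "valid_rows n A" "valid_rows n B"
  shows "rows_equal eqv z n A B \<longleftrightarrow> rows_value n A = rows_value n B"
  using assms by (auto simp: rows_equal_def rows_value_def valid_rows_def mat_eq_iff eqv)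

end

section \<open>The algorithm\<close>

text \<open>A letter is a generator together with its proposed image over the finite field.\<close>

type_synonym letter = "ratfun_expr list list \<times> nat list list"

definition field_data_of :: "nat \<Rightarrow> field_data" where
  "field_data_of c = (nth_default 0 (dec c) 0, nth_default 0 (dec c) 1,
     dec (nth_default 0 (dec c) 2), dec (nth_default 0 (dec c) 3))"

definition field_conditions :: "nat \<Rightarrow> nat ring \<Rightarrow> bool" where
  "field_conditions r L \<longleftrightarrow> \<zero>\<^bsub>L\<^esub> < r \<and> \<one>\<^bsub>L\<^esub> < r \<and> \<zero>\<^bsub>L\<^esub> \<noteq> \<one>\<^bsub>L\<^esub> \<and>
     (\<forall>a<r. \<zero>\<^bsub>L\<^esub> \<oplus>\<^bsub>L\<^esub> a = a \<and> \<one>\<^bsub>L\<^esub> \<otimes>\<^bsub>L\<^esub> a = a \<and> (\<exists>b<r. b \<oplus>\<^bsub>L\<^esub> a = \<zero>\<^bsub>L\<^esub>) \<and>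
        (a \<noteq> \<zero>\<^bsub>L\<^esub> \<longrightarrow> (\<exists>b<r. b \<otimes>\<^bsub>L\<^esub> a = \<one>\<^bsub>L\<^esub>)) \<and>
        (\<forall>b<r. a \<oplus>\<^bsub>L\<^esub> b < r \<and> a \<otimes>\<^bsub>L\<^esub> b < r \<and> a \<oplus>\<^bsub>L\<^esub> b = b \<oplus>\<^bsub>L\<^esub> a \<and> a \<otimes>\<^bsub>L\<^esub> b = b \<otimes>\<^bsub>L\<^esub> a \<and>
          (\<forall>c<r. a \<oplus>\<^bsub>L\<^esub> b \<oplus>\<^bsub>L\<^esub> c = a \<oplus>\<^bsub>L\<^esub> (b \<oplus>\<^bsub>L\<^esub> c) \<and> a \<otimes>\<^bsub>L\<^esub> b \<otimes>\<^bsub>L\<^esub> c = a \<otimes>\<^bsub>L\<^esub> (b \<otimes>\<^bsub>L\<^esub> c) \<and>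
             (a \<oplus>\<^bsub>L\<^esub> b) \<otimes>\<^bsub>L\<^esub> c = a \<otimes>\<^bsub>L\<^esub> c \<oplus>\<^bsub>L\<^esub> b \<otimes>\<^bsub>L\<^esub> c)))"

definition ratfun_word :: "nat ring \<Rightarrow> nat \<Rightarrow> nat \<Rightarrow> letter list \<Rightarrow> ratfun_expr list list" where
  "ratfun_word K m n w = word_rows (ratfun_add K) (ratfun_mult K)
     (ratfun_const K m \<zero>\<^bsub>K\<^esub>) (ratfun_const K m \<one>\<^bsub>K\<^esub>) n (map fst w)"

definition field_word :: "nat ring \<Rightarrow> nat \<Rightarrow> letter list \<Rightarrow> nat list list" where
  "field_word L n w = word_rows (add L) (monoid.mult L) \<zero>\<^bsub>L\<^esub> \<one>\<^bsub>L\<^esub> n (map snd w)"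

definition same_ratfun_word :: "nat ring \<Rightarrow> nat \<Rightarrow> nat \<Rightarrow> letter list \<Rightarrow> letter list \<Rightarrow> bool" where
  "same_ratfun_word K m n v w \<longleftrightarrow> rows_equal (ratfun_equal K) (ratfun_const K m \<zero>\<^bsub>K\<^esub>) n
     (ratfun_word K m n v) (ratfun_word K m n w)"

definition same_field_word :: "nat ring \<Rightarrow> nat \<Rightarrow> letter list \<Rightarrow> letter list \<Rightarrow> bool" where
  "same_field_word L n v w \<longleftrightarrow> rows_equal (=) \<zero>\<^bsub>L\<^esub> n (field_word L n v) (field_word L n w)"

text \<open>The given generators \<open>Ds\<close> come with proposed images in \<open>Y\<close>; the remaining conditions are those of
  \<open>word_system\<close>, with the values of words computed from expressions and tables.\<close>

definition certifies ::
    "nat ring \<Rightarrow> nat \<Rightarrow> nat \<Rightarrow> ratfun_expr list list list \<Rightarrow> nat \<Rightarrow> nat ring \<Rightarrow> letter list \<Rightarrow> letter list list \<Rightarrow> bool"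
  where
  "certifies K m n Ds r L Y W \<longleftrightarrow> field_conditions r L \<and> map fst Y = Ds \<and>
     (\<forall>x\<in>set Y. \<forall>i<n. \<forall>j<n. rows_entry \<zero>\<^bsub>L\<^esub> (snd x) i j < r) \<and>
     [] \<in> set W \<and> (\<forall>w\<in>set W. \<forall>x\<in>set w. x \<in> set Y) \<and>
     (\<forall>u\<in>set (word_closure Y W). \<forall>v\<in>set (word_closure Y W).
        same_ratfun_word K m n u v \<longleftrightarrow> same_field_word L n u v) \<and>
     (\<forall>u\<in>set (word_closure Y W). \<exists>w\<in>set W. same_field_word L n u w) \<and>
     distinct W \<and> (\<forall>u\<in>set W. \<forall>v\<in>set W. same_field_word L n u v \<longrightarrow> u = v)"

definition result :: "nat \<Rightarrow> nat \<Rightarrow> nat ring \<Rightarrow> letter list \<Rightarrow> letter list list \<Rightarrow> nat" where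
  "result n r L Y W = enc [length W, r,
     enc [\<zero>\<^bsub>L\<^esub>, \<one>\<^bsub>L\<^esub>, enc (rows_of r (\<lambda>a b. a \<oplus>\<^bsub>L\<^esub> b)), enc (rows_of r (\<lambda>a b. a \<otimes>\<^bsub>L\<^esub> b))],
     enc (map (\<lambda>x. rows_of n (\<lambda>i j. rows_entry \<zero>\<^bsub>L\<^esub> (snd x) i j)) Y)]"

subsection \<open>Computability\<close>

lemma computable_rows_entry [computable_intros]:
  "computable z \<Longrightarrow> computable A \<Longrightarrow> computable i \<Longrightarrow> computable j
    \<Longrightarrow> computable (\<lambda>x. rows_entry (z x) (A x) (i x) (j x))"
  unfolding rows_entry_def by (intro computable_intros)

lemma computable_rows_of [computable_intros]:
  assumes "computable (\<lambda>p. f (fst p) (fst (snd p)) (snd (snd p)))" "computable n"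
  shows "computable (\<lambda>x. rows_of (n x) (\<lambda>i j. f x i j))"
  unfolding rows_of_def
  by (intro computable_intros assms(2)[THEN computable_comp]
    computable_comp3[OF assms(1)])

lemma computable_table_zero [computable_intros]:
  "computable d \<Longrightarrow> computable (\<lambda>x. \<zero>\<^bsub>table_ring (q x) (d x)\<^esub>)"
  and computable_table_one [computable_intros]:
  "computable d \<Longrightarrow> computable (\<lambda>x. \<one>\<^bsub>table_ring (q x) (d x)\<^esub>)"
  and computable_table_add [computable_intros]:
  "computable d \<Longrightarrow> computable a \<Longrightarrow> computable b
    \<Longrightarrow> computable (\<lambda>x. a x \<oplus>\<^bsub>table_ring (q x) (d x)\<^esub> b x)"
  and computable_table_mult [computable_intros]:
  "computable d \<Longrightarrow> computable a \<Longrightarrow> computable b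
    \<Longrightarrow> computable (\<lambda>x. a x \<otimes>\<^bsub>table_ring (q x) (d x)\<^esub> b x)"
  unfolding table_ring_def ring_record_simps by (intro computable_intros; assumption)+

lemma computable_field_data_of [computable_intros]:
  "computable c \<Longrightarrow> computable (\<lambda>x. field_data_of (c x))"
  unfolding field_data_of_def by (intro computable_intros)

lemma computable_term_mult [computable_intros]:
  assumes "computable d" "computable s" "computable t"
  shows "computable (\<lambda>x. term_mult (table_ring (q x) (d x)) (s x) (t x))"
  unfolding term_mult_def by (intro computable_intros assms[THEN computable_comp])

lemma computable_expr_mult [computable_intros]:
  assumes "computable d" "computable s" "computable t"
  shows "computable (\<lambda>x. expr_mult (table_ring (q x) (d x)) (s x) (t x))"
  unfolding expr_mult_def by (intro computable_intros assms[THEN computable_comp])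

lemma computable_coeff_at [computable_intros]:
  assumes "computable d" "computable s" "computable t"
  shows "computable (\<lambda>x. coeff_at (table_ring (q x) (d x)) (s x) (t x))"
  unfolding coeff_at_def by (intro computable_intros assms[THEN computable_comp])

lemma decidable_expr_equal [computable_intros]:
  assumes "computable d" "computable s" "computable t"
  shows "decidable (\<lambda>x. expr_equal (table_ring (q x) (d x)) (s x) (t x))"
  unfolding expr_equal_def by (intro computable_intros assms[THEN computable_comp])

lemma computable_ratfun_mult [computable_intros]:
  assumes "computable d" "computable s" "computable t"
  shows "computable (\<lambda>x. ratfun_mult (table_ring (q x) (d x)) (s x) (t x))"
  unfolding ratfun_mult_def by (intro computable_intros assms)

lemma computable_ratfun_add [computable_intros]:
  assumes "computable d" "computable s" "computable t"
  shows "computable (\<lambda>x. ratfun_add (table_ring (q x) (d x)) (s x) (t x))"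
  unfolding ratfun_add_def by (intro computable_intros assms)

lemma decidable_ratfun_equal [computable_intros]:
  assumes "computable d" "computable s" "computable t"
  shows "decidable (\<lambda>x. ratfun_equal (table_ring (q x) (d x)) (s x) (t x))"
  unfolding ratfun_equal_def by (intro computable_intros assms)

lemma computable_ratfun_const [computable_intros]:
  assumes "computable d" "computable m" "computable c"
  shows "computable (\<lambda>x. ratfun_const (table_ring (q x) (d x)) (m x) (c x))"
  unfolding ratfun_const_def by (intro computable_intros assms)

lemma computable_rows_mult [computable_intros]:
  assumes "computable (\<lambda>p. pl (fst p) (fst (snd p)) (snd (snd p)))"
    and "computable (\<lambda>p. ml (fst p) (fst (snd p)) (snd (snd p)))"
    and "computable z" "computable n" "computable A" "computable B"
  shows "computable (\<lambda>x. rows_mult (pl x) (ml x) (z x) (n x) (A x) (B x))"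
  unfolding rows_mult_def
  by (intro computable_intros assms(1,2)[THEN computable_comp3] assms(3-)[THEN computable_comp])

lemma computable_word_rows [computable_intros]:
  assumes "computable (\<lambda>p. pl (fst p) (fst (snd p)) (snd (snd p)))"
    and "computable (\<lambda>p. ml (fst p) (fst (snd p)) (snd (snd p)))"
    and "computable z" "computable u" "computable n" "computable w"
  shows "computable (\<lambda>x. word_rows (pl x) (ml x) (z x) (u x) (n x) (w x))"
  unfolding word_rows_def rows_one_def
  by (intro computable_intros assms(1,2)[THEN computable_comp3] assms(3-)[THEN computable_comp])

lemma decidable_rows_equal [computable_intros]:
  assumes "decidable (\<lambda>p. eqv (fst p) (fst (snd p)) (snd (snd p)))"
    and "computable z" "computable n" "computable A" "computable B"
  shows "decidable (\<lambda>x. rows_equal (eqv x) (z x) (n x) (A x) (B x))"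
  unfolding rows_equal_def
  by (intro computable_intros decidable_comp3[OF assms(1)] assms(2-)[THEN computable_comp])

lemma decidable_same_ratfun_word [computable_intros]:
  assumes "computable d" "computable m" "computable n" "computable v" "computable w"
  shows "decidable (\<lambda>x. same_ratfun_word (table_ring (q x) (d x)) (m x) (n x) (v x) (w x))"
  unfolding same_ratfun_word_def ratfun_word_def
  by (intro computable_intros assms[THEN computable_comp])

lemma decidable_same_field_word [computable_intros]:
  assumes "computable d" "computable n" "computable v" "computable w"
  shows "decidable (\<lambda>x. same_field_word (table_ring (q x) (d x)) (n x) (v x) (w x))"
  unfolding same_field_word_def field_word_def
  by (intro computable_intros assms[THEN computable_comp])

lemma computable_word_closure [computable_intros]:
  assumes "computable Y" "computable W"
  shows "computable (\<lambda>x. word_closure (Y x) (W x))"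
  unfolding word_closure_def by (intro computable_intros assms[THEN computable_comp])

lemma decidable_field_conditions [computable_intros]:
  assumes "computable r" "computable d"
  shows "decidable (\<lambda>x. field_conditions (r x) (table_ring (q x) (d x)))"
  unfolding field_conditions_def by (intro computable_intros assms[THEN computable_comp])

lemma decidable_certifies [computable_intros]:
  assumes "computable c" "computable m" "computable n" "computable Ds" "computable r" "computable d"
    "computable Y" "computable W"
  shows "decidable (\<lambda>x. certifies (table_ring (q x) (c x)) (m x) (n x) (Ds x)
    (r x) (table_ring (s x) (d x)) (Y x) (W x))"
  unfolding certifies_def by (intro computable_intros assms[THEN computable_comp])

lemma computable_result [computable_intros]:
  assumes "computable n" "computable r" "computable d" "computable Y" "computable W"
  shows "computable (\<lambda>x. result (n x) (r x) (table_ring (s x) (d x)) (Y x) (W x))"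
  unfolding result_def by (intro computable_intros assms[THEN computable_comp])

section \<open>Correctness\<close>

lemma field_conditions_iff:
  fixes L :: "nat ring"
  assumes carr: "carrier L = {..<r}"
  shows "field_conditions r L \<longleftrightarrow> field L"
proof
  assume *: "field_conditions r L"
  note ax = *[unfolded field_conditions_def]
  have constants: "\<zero>\<^bsub>L\<^esub> < r" "\<one>\<^bsub>L\<^esub> < r" "\<zero>\<^bsub>L\<^esub> \<noteq> \<one>\<^bsub>L\<^esub>" using ax by blast+
  have unary: "\<zero>\<^bsub>L\<^esub> \<oplus>\<^bsub>L\<^esub> a = a" "\<one>\<^bsub>L\<^esub> \<otimes>\<^bsub>L\<^esub> a = a" "\<exists>b<r. b \<oplus>\<^bsub>L\<^esub> a = \<zero>\<^bsub>L\<^esub>"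
    "a \<noteq> \<zero>\<^bsub>L\<^esub> \<Longrightarrow> \<exists>b<r. b \<otimes>\<^bsub>L\<^esub> a = \<one>\<^bsub>L\<^esub>" if "a < r" for a
    using ax that by blast+
  have binary: "a \<oplus>\<^bsub>L\<^esub> b < r" "a \<otimes>\<^bsub>L\<^esub> b < r" "a \<oplus>\<^bsub>L\<^esub> b = b \<oplus>\<^bsub>L\<^esub> a" "a \<otimes>\<^bsub>L\<^esub> b = b \<otimes>\<^bsub>L\<^esub> a"
    if "a < r" "b < r" for a b
    using ax that by blast+
  have ternary: "a \<oplus>\<^bsub>L\<^esub> b \<oplus>\<^bsub>L\<^esub> c = a \<oplus>\<^bsub>L\<^esub> (b \<oplus>\<^bsub>L\<^esub> c)" "a \<otimes>\<^bsub>L\<^esub> b \<otimes>\<^bsub>L\<^esub> c = a \<otimes>\<^bsub>L\<^esub> (b \<otimes>\<^bsub>L\<^esub> c)"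
    "(a \<oplus>\<^bsub>L\<^esub> b) \<otimes>\<^bsub>L\<^esub> c = a \<otimes>\<^bsub>L\<^esub> c \<oplus>\<^bsub>L\<^esub> b \<otimes>\<^bsub>L\<^esub> c" if "a < r" "b < r" "c < r" for a b c
    using ax that by blast+
  have "cring L"
  proof (rule cringI)
    show "abelian_group L"
    proof (rule abelian_groupI)
      show "\<exists>b\<in>carrier L. b \<oplus>\<^bsub>L\<^esub> a = \<zero>\<^bsub>L\<^esub>" if "a \<in> carrier L" for a
        using unary(3)[of a] that unfolding carr by blast
    qed (unfold carr lessThan_iff, (fact constants unary binary ternary)+)
    show "comm_monoid L"
      by (rule comm_monoidI; unfold carr lessThan_iff; fact constants unary binary ternary)
  qed (unfold carr lessThan_iff, fact ternary)
  then interpret cring L .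
  have "x \<in> Units L \<longleftrightarrow> x \<in> carrier L - {\<zero>\<^bsub>L\<^esub>}" for x
  proof
    assume x: "x \<in> Units L"
    then obtain y where y: "y \<in> carrier L" "y \<otimes>\<^bsub>L\<^esub> x = \<one>\<^bsub>L\<^esub>" using Units_l_inv_ex by blast
    then have "x \<noteq> \<zero>\<^bsub>L\<^esub>" using constants(3) r_null[OF y(1)] by metis
    then show "x \<in> carrier L - {\<zero>\<^bsub>L\<^esub>}" using Units_closed[OF x] by blast
  next
    assume x: "x \<in> carrier L - {\<zero>\<^bsub>L\<^esub>}"
    then obtain y where y: "y \<in> carrier L" "y \<otimes>\<^bsub>L\<^esub> x = \<one>\<^bsub>L\<^esub>" using unary(4)[of x] unfolding carr by blast
    then have "x \<otimes>\<^bsub>L\<^esub> y = \<one>\<^bsub>L\<^esub>" using x m_comm by simp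
    with x y show "x \<in> Units L" unfolding Units_def by blast
  qed
  then have "Units L = carrier L - {\<zero>\<^bsub>L\<^esub>}" by blast
  then show "field L" by (rule cring_fieldI)
next
  assume "field L"
  then interpret field L .
  have inv: "\<exists>b<r. b \<otimes>\<^bsub>L\<^esub> a = \<one>\<^bsub>L\<^esub>" if "a < r" "a \<noteq> \<zero>\<^bsub>L\<^esub>" for a
  proof -
    have "a \<in> Units L" using that by (simp add: field_Units carr)
    then obtain b where "b \<in> carrier L" "b \<otimes>\<^bsub>L\<^esub> a = \<one>\<^bsub>L\<^esub>" using Units_l_inv_ex by blast
    then show ?thesis unfolding carr by blast
  qed
  have neg: "\<exists>b<r. b \<oplus>\<^bsub>L\<^esub> a = \<zero>\<^bsub>L\<^esub>" if "a < r" for a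
  proof -
    have "a \<in> carrier L" using that by (simp add: carr)
    then have "\<ominus>\<^bsub>L\<^esub> a \<in> carrier L" "\<ominus>\<^bsub>L\<^esub> a \<oplus>\<^bsub>L\<^esub> a = \<zero>\<^bsub>L\<^esub>" by (rule a_inv_closed l_neg)+
    then show ?thesis unfolding carr by blast
  qed
  have constants: "\<zero>\<^bsub>L\<^esub> < r" "\<one>\<^bsub>L\<^esub> < r" using zero_closed one_closed by (simp_all add: carr)
  have closed: "a \<oplus>\<^bsub>L\<^esub> b < r" "a \<otimes>\<^bsub>L\<^esub> b < r" if "a < r" "b < r" for a b
    using a_closed[of a b] m_closed[of a b] that by (simp_all add: carr)
  note laws = l_zero l_one a_comm m_comm a_assoc m_assoc l_distr
  show "field_conditions r L"
    unfolding field_conditions_def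
    by (intro conjI allI impI; (fact constants zero_not_one | rule inv neg closed; assumption
      | rule laws; simp only: carr lessThan_iff))
qed

lemma rows_code: "list_encode (map (\<lambda>a. list_encode (map (f a) [0..<n])) [0..<n]) = enc (rows_of n f)"
  by (simp add: enc_list_def rows_of_def enc_nat_def[abs_def] comp_def)

lemma dec_list_encode [simp]: "dec (list_encode xs) = xs"
proof -
  have "list_encode xs = enc xs" by (simp add: enc_list_def enc_nat_def[abs_def])
  then show ?thesis by simp
qed

lemma tabulated_field_code:
  assumes "field K" "carrier K = {..<q}"
  shows "tabulated K (table_ring q (field_data_of (field_code q K)))"
proof -
  interpret field K by fact
  have "field_data_of (field_code q K) = (\<zero>\<^bsub>K\<^esub>, \<one>\<^bsub>K\<^esub>, rows_of q (add K), rows_of q (monoid.mult K))"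
    by (simp add: field_data_of_def field_code_def table_code_def rows_code nth_default_def
        del: list_encode.simps)
  then show ?thesis
    by unfold_locales (simp_all add: table_ring_def assms(2))
qed

lemma mat_to_list_mat: "mat_to_list (mat n n f) = rows_of n (\<lambda>i j. f (i, j))"
  by (simp add: mat_to_list_def rows_of_def)

lemma ratfun_code_enc: "ratfun_code = enc"
proof -
  have "poly_code p = enc p" for p
    by (simp add: poly_code_def enc_list_def) (intro arg_cong[of _ _ list_encode] map_cong refl;
      auto simp: enc_Pair enc_list_def enc_nat_def[abs_def])
  then show ?thesis by (auto simp: ratfun_code_def enc_Pair fun_eq_iff)
qed

lemma mat_code_enc: "mat_code enc = (\<lambda>A. enc (mat_to_list A))"
  by (simp add: mat_code_def[abs_def] enc_list_def[abs_def])

lemma mat_code_id: "mat_code id = (\<lambda>A. enc (mat_to_list A))"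
  by (simp add: mat_code_def[abs_def] enc_list_def[abs_def] enc_nat_def[abs_def])

lemma ring_presentation_table:
  assumes "field L" "carrier L = {..<r}"
  shows "ring_presentation L {..<r} (\<lambda>x. x) (add L) (monoid.mult L) \<zero>\<^bsub>L\<^esub> \<one>\<^bsub>L\<^esub> (=)"
proof -
  interpret field L by fact
  show ?thesis
    using zero_closed one_closed a_closed m_closed by unfold_locales (auto simp: assms(2))
qed

context tabulated
begin

lemma ratfun_field_cring: "cring (ratfun_field K m)"
  unfolding ratfun_field_def by (rule domain.fraction_field_cring[OF mpoly_domain])

lemma ring_presentation_ratfun:
  "ring_presentation (ratfun_field K m) (ratfun_exprs K m) (ratfun_value K m) (ratfun_add K')
    (ratfun_mult K') (ratfun_const K' m \<zero>\<^bsub>K'\<^esub>) (ratfun_const K' m \<one>\<^bsub>K'\<^esub>) (ratfun_equal K')"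
proof -
  interpret F: cring "ratfun_field K m" by (rule ratfun_field_cring)
  show ?thesis
    by unfold_locales (simp_all only: ratfun_value_closed ratfun_zero ratfun_one ratfun_add ratfun_mult ratfun_equal)
qed

text \<open>The meaning of the test.  Soundness of the algorithm is the implication from left to right, termination the
  converse.\<close>

lemma certifies_iff:
  fixes m n r :: nat and L :: "nat ring"
  defines "valF \<equiv> ring_presentation.rows_value (ratfun_value K m) (ratfun_const K' m \<zero>\<^bsub>K'\<^esub>)"
    and "valL \<equiv> ring_presentation.rows_value (\<lambda>x. x) \<zero>\<^bsub>L\<^esub>"
  assumes carr: "carrier L = {..<r}"
    and Ds: "\<And>D. D \<in> set Ds \<Longrightarrow>
      ring_presentation.valid_rows (ratfun_exprs K m) (ratfun_const K' m \<zero>\<^bsub>K'\<^esub>) n D"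
  shows "certifies K' m n Ds r L Y W \<longleftrightarrow> field L \<and> map fst Y = Ds \<and>
     (\<forall>x\<in>set Y. valL n (snd x) \<in> carrier (mat_monoid n L)) \<and>
     word_system (mat_monoid n (ratfun_field K m)) (mat_monoid n L)
       (\<lambda>x. valF n (fst x)) (\<lambda>x. valL n (snd x)) Y W"
proof -
  interpret F: ring_presentation "ratfun_field K m" "ratfun_exprs K m" "ratfun_value K m" "ratfun_add K'"
    "ratfun_mult K'" "ratfun_const K' m \<zero>\<^bsub>K'\<^esub>" "ratfun_const K' m \<one>\<^bsub>K'\<^esub>" "ratfun_equal K'"
    by (rule ring_presentation_ratfun)
  let ?M = "mat_monoid n (ratfun_field K m)" and ?N = "mat_monoid n L"
  let ?f = "\<lambda>x. valF n (fst x)" and ?g = "\<lambda>x. valL n (snd x)"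
  define pre where "pre \<longleftrightarrow> field L \<and> map fst Y = Ds \<and>
     (\<forall>x\<in>set Y. \<forall>i<n. \<forall>j<n. rows_entry \<zero>\<^bsub>L\<^esub> (snd x) i j < r) \<and> (\<forall>w\<in>set W. \<forall>x\<in>set w. x \<in> set Y)"
  have valid: "(\<forall>x\<in>set Y. \<forall>i<n. \<forall>j<n. rows_entry \<zero>\<^bsub>L\<^esub> (snd x) i j < r)
      \<longleftrightarrow> (\<forall>x\<in>set Y. ?g x \<in> carrier ?N)" if "field L"
  proof -
    interpret L: ring_presentation L "{..<r}" "\<lambda>x. x" "add L" "monoid.mult L" "\<zero>\<^bsub>L\<^esub>" "\<one>\<^bsub>L\<^esub>" "(=)"
      using that carr by (rule ring_presentation_table)
    show ?thesis by (simp add: valL_def L.rows_value_def mat_monoid_carrier_iff carr)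
  qed
  have words: "same_ratfun_word K' m n u v \<longleftrightarrow> word_value ?M ?f u = word_value ?M ?f v"
    "same_field_word L n u v \<longleftrightarrow> word_value ?N ?g u = word_value ?N ?g v"
    if pre: pre and uv: "set u \<subseteq> set Y" "set v \<subseteq> set Y" for u v
  proof -
    have "field L" using pre by (simp add: pre_def)
    then interpret L: ring_presentation L "{..<r}" "\<lambda>x. x" "add L" "monoid.mult L" "\<zero>\<^bsub>L\<^esub>" "\<one>\<^bsub>L\<^esub>" "(=)"
      using carr by (rule ring_presentation_table)
    have "fst x \<in> set Ds" if "x \<in> set Y" for x using pre that by (auto simp: pre_def)
    then have vF: "F.valid_rows n (fst x)" if "x \<in> set Y" for x using Ds that by blast
    have vL: "L.valid_rows n (snd x)" if "x \<in> set Y" for x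
      using pre that by (simp add: pre_def L.valid_rows_def)
    have F: "F.valid_rows n (ratfun_word K' m n w) \<and>
        F.rows_value n (ratfun_word K' m n w) = word_value ?M ?f w" if "set w \<subseteq> set Y" for w
      unfolding ratfun_word_def valF_def using that vF by (intro F.word_rows) auto
    have L: "L.valid_rows n (field_word L n w) \<and>
        L.rows_value n (field_word L n w) = word_value ?N ?g w" if "set w \<subseteq> set Y" for w
      unfolding field_word_def valL_def using that vL by (intro L.word_rows) auto
    show "same_ratfun_word K' m n u v \<longleftrightarrow> word_value ?M ?f u = word_value ?M ?f v"
      using F[OF uv(1)] F[OF uv(2)] by (simp add: same_ratfun_word_def F.rows_equal)
    show "same_field_word L n u v \<longleftrightarrow> word_value ?N ?g u = word_value ?N ?g v"
      using L[OF uv(1)] L[OF uv(2)] by (simp add: same_field_word_def L.rows_equal)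
  qed
  have closure: "set u \<subseteq> set Y" if pre "u \<in> set (word_closure Y W)" for u
    using that by (fastforce simp: pre_def set_word_closure)
  have sub: "w \<in> set (word_closure Y W)" if "w \<in> set W" for w
    using that by (simp add: set_word_closure)
  have "certifies K' m n Ds r L Y W \<longleftrightarrow> pre \<and> [] \<in> set W \<and>
     (\<forall>u\<in>set (word_closure Y W). \<forall>v\<in>set (word_closure Y W).
        same_ratfun_word K' m n u v \<longleftrightarrow> same_field_word L n u v) \<and>
     (\<forall>u\<in>set (word_closure Y W). \<exists>w\<in>set W. same_field_word L n u w) \<and>
     distinct W \<and> (\<forall>u\<in>set W. \<forall>v\<in>set W. same_field_word L n u v \<longrightarrow> u = v)"
    unfolding certifies_def pre_def field_conditions_iff[OF carr] by blast
  also have "\<dots> \<longleftrightarrow> pre \<and> [] \<in> set W \<and>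
     (\<forall>u\<in>set (word_closure Y W). \<forall>v\<in>set (word_closure Y W).
        word_value ?M ?f u = word_value ?M ?f v \<longleftrightarrow> word_value ?N ?g u = word_value ?N ?g v) \<and>
     (\<forall>u\<in>set (word_closure Y W). \<exists>w\<in>set W. word_value ?N ?g u = word_value ?N ?g w) \<and>
     distinct W \<and> (\<forall>u\<in>set W. \<forall>v\<in>set W. word_value ?N ?g u = word_value ?N ?g v \<longrightarrow> u = v)"
    using words closure sub by (intro conj_cong ball_cong bex_cong refl) auto
  also have "\<dots> \<longleftrightarrow> field L \<and> map fst Y = Ds \<and> (\<forall>x\<in>set Y. ?g x \<in> carrier ?N) \<and> word_system ?M ?N ?f ?g Y W"
    unfolding word_system_def pre_def distinct_map inj_on_def using valid by blast
  finally show ?thesis .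
qed

end

text \<open>The images of the generators under an injective specialisation satisfy the same equations as the generators,
  for all words.\<close>

lemma certificate_exists:
  fixes K :: "nat ring"
  assumes K: "tabulated K K'" "field K" "finite (carrier K)"
    and Ds: "\<And>D. D \<in> set Ds \<Longrightarrow>
      ring_presentation.valid_rows (ratfun_exprs K m) (ratfun_const K' m \<zero>\<^bsub>K'\<^esub>) n D"
    and S: "S = ring_presentation.rows_value (ratfun_value K m) (ratfun_const K' m \<zero>\<^bsub>K'\<^esub>) n ` set Ds"
    and GL: "S \<subseteq> carrier (GL n (ratfun_field K m))"
    and fin: "finite (carrier (subgroup_generated (GL n (ratfun_field K m)) S))"
  shows "\<exists>r d Y W. certifies K' m n Ds r (table_ring r d) Y W"
proof -
  interpret T: tabulated K K' by (rule K(1))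
  interpret K: field K by (rule K(2))
  interpret F: ring_presentation "ratfun_field K m" "ratfun_exprs K m" "ratfun_value K m" "ratfun_add K'"
    "ratfun_mult K'" "ratfun_const K' m \<zero>\<^bsub>K'\<^esub>" "ratfun_const K' m \<one>\<^bsub>K'\<^esub>" "ratfun_equal K'"
    by (rule T.ring_presentation_ratfun)
  let ?M = "mat_monoid n (ratfun_field K m)"
  interpret M: monoid ?M by (rule F.mat_monoid_monoid)
  interpret U: group "units_of ?M" by (rule M.units_group)
  define H where "H = generate (units_of ?M) S"
  have H_carr: "carrier (subgroup_generated (GL n (ratfun_field K m)) S) = H"
    using GL by (simp add: H_def carrier_subgroup_generated GL_def Int_absorb1)
  have H_sub: "H \<subseteq> carrier ?M"
  proof
    fix A assume "A \<in> H"
    with GL have "A \<in> carrier (units_of ?M)" unfolding H_def GL_def by (intro U.generate_in_carrier)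
    then show "A \<in> carrier ?M" unfolding units_of_carrier by (rule M.Units_closed)
  qed
  have H_mat: "A \<in> carrier_mat n n" "elements_mat A \<subseteq> carrier (ratfun_field K m)" if "A \<in> H" for A
    using subsetD[OF H_sub that] by (simp_all add: mat_monoid_def)
  define E where "E = (\<Union>A\<in>H. elements_mat A)"
  have "finite E" using fin H_carr by (auto simp: E_def elements_mat_def)
  moreover have "E \<subseteq> carrier (ratfun_field K m)" using H_mat by (auto simp: E_def)
  ultimately obtain r d h where spec: "specialisation (mpoly_ring K m) (table_ring r d) h"
    and E: "E \<subseteq> local_part (mpoly_ring K m) (table_ring r d) h"
      "inj_on (local_eval (mpoly_ring K m) (table_ring r d) h) E"
    using K.ratfun_specialisation[OF K(3)] by blast
  let ?L = "table_ring r d"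
  interpret h: specialisation "mpoly_ring K m" ?L h by (rule spec)
  have carr: "carrier ?L = {..<r}" by (simp add: table_ring_def)
  have field: "field ?L" by (rule h.L.field_axioms)
  interpret L: ring_presentation ?L "{..<r}" "\<lambda>x. x" "add ?L" "monoid.mult ?L" "\<zero>\<^bsub>?L\<^esub>" "\<one>\<^bsub>?L\<^esub>" "(=)"
    using field carr by (rule ring_presentation_table)
  let ?N = "mat_monoid n ?L"
  define \<phi> where "\<phi> = map_mat (local_eval (mpoly_ring K m) ?L h)"
  have H_local: "elements_mat A \<subseteq> local_part (mpoly_ring K m) ?L h" if "A \<in> H" for A
    using E(1) that by (auto simp: E_def)
  have \<phi>_closed: "\<phi> A \<in> carrier ?N" if "A \<in> H" for A
    using H_local[OF that] H_mat(1)[OF that] h.local_eval_closed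
    by (auto simp: \<phi>_def mat_monoid_carrier_iff elements_mat_subset_iff)
  have \<phi>_mult: "\<phi> (A \<otimes>\<^bsub>?M\<^esub> B) = \<phi> A \<otimes>\<^bsub>?N\<^esub> \<phi> B" if "A \<in> H" "B \<in> H" for A B
    unfolding \<phi>_def ratfun_field_def using that H_mat(1) H_local by (intro h.local_mat_mult)
  have \<phi>_one: "\<phi> \<one>\<^bsub>?M\<^esub> = \<one>\<^bsub>?N\<^esub>"
    unfolding \<phi>_def ratfun_field_def by (rule h.local_mat_one)
  have \<phi>_inj: "inj_on \<phi> H"
  proof (rule inj_onI)
    fix A B assume AB: "A \<in> H" "B \<in> H" "\<phi> A = \<phi> B"
    note dims = H_mat(1)[OF AB(1)] H_mat(1)[OF AB(2)]
    show "A = B"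
    proof (rule eq_matI)
      fix i j assume "i < dim_row B" "j < dim_col B"
      then have ij: "i < n" "j < n" using dims by auto
      have "\<phi> A $$ (i, j) = \<phi> B $$ (i, j)" by (simp only: AB(3))
      then have "local_eval (mpoly_ring K m) ?L h (A $$ (i, j)) = local_eval (mpoly_ring K m) ?L h (B $$ (i, j))"
        using ij dims by (simp add: \<phi>_def)
      moreover have "A $$ (i, j) \<in> E" "B $$ (i, j) \<in> E"
        using AB(1,2) elements_matI[OF dims(1) ij refl] elements_matI[OF dims(2) ij refl]
        by (auto simp: E_def)
      ultimately show "A $$ (i, j) = B $$ (i, j)" using inj_onD[OF E(2)] by blast
    qed (use dims in auto)
  qed
  define Y where "Y = map (\<lambda>D. (D, rows_of n (\<lambda>i j. \<phi> (F.rows_value n D) $$ (i, j)))) Ds"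
  have Y_fst: "map fst Y = Ds" by (simp add: Y_def comp_def)
  have S_image: "S = (\<lambda>x. F.rows_value n (fst x)) ` set Y"
    unfolding S Y_fst[symmetric] by (simp add: image_image)
  have S_H: "F.rows_value n (fst x) \<in> H" if "x \<in> set Y" for x
    unfolding H_def using that by (intro generate.incl) (auto simp: S_image)
  have g: "L.rows_value n (snd x) = \<phi> (F.rows_value n (fst x))" if "x \<in> set Y" for x
  proof -
    have "snd x = rows_of n (\<lambda>i j. \<phi> (F.rows_value n (fst x)) $$ (i, j))"
      using that by (auto simp: Y_def)
    moreover have "\<phi> (F.rows_value n (fst x)) \<in> carrier_mat n n"
      using \<phi>_closed[OF S_H[OF that]] by (simp add: mat_monoid_carrier_iff)
    ultimately show ?thesis by (intro eq_matI) (auto simp: L.rows_value_def)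
  qed
  have "\<exists>W. word_system ?M ?N (\<lambda>x. F.rows_value n (fst x)) (\<lambda>x. L.rows_value n (snd x)) Y W"
  proof (rule word_system_exists)
    show "monoid ?M" by (rule F.mat_monoid_monoid)
    show "monoid ?N" using h.L.ring_axioms by (rule ring.mat_monoid_monoid)
    show "F.rows_value n (fst x) \<in> Units ?M" if "x \<in> set Y" for x
      using GL that by (auto simp: S_image GL_def units_of_carrier)
    show "finite (generate (units_of ?M) ((\<lambda>x. F.rows_value n (fst x)) ` set Y))"
      by (rule fin[unfolded H_carr, unfolded H_def S_image])
    show "\<phi> \<one>\<^bsub>?M\<^esub> = \<one>\<^bsub>?N\<^esub>" by (rule \<phi>_one)
    show "inj_on \<phi> (generate (units_of ?M) ((\<lambda>x. F.rows_value n (fst x)) ` set Y))"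
      using \<phi>_inj by (simp add: H_def S_image)
    show "\<phi> (A \<otimes>\<^bsub>?M\<^esub> B) = \<phi> A \<otimes>\<^bsub>?N\<^esub> \<phi> B"
      if "A \<in> generate (units_of ?M) ((\<lambda>x. F.rows_value n (fst x)) ` set Y)"
        "B \<in> generate (units_of ?M) ((\<lambda>x. F.rows_value n (fst x)) ` set Y)" for A B
      using that by (intro \<phi>_mult) (simp_all add: H_def S_image)
  qed (rule g)
  moreover have "\<forall>x\<in>set Y. L.rows_value n (snd x) \<in> carrier ?N"
    using g \<phi>_closed S_H by auto
  ultimately show ?thesis
    using T.certifies_iff[OF carr Ds] field Y_fst by blast
qed

theorem mainTheorem2:
  shows "\<exists>A :: recf.
    \<forall>(q :: nat) (m :: nat) (n :: nat) (K :: nat ring) (S :: nat ratfun mat set)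
      (Ds :: ratfun_expr mat list).
      let G = subgroup_generated (GL n (ratfun_field K m)) S in
      primepow q \<longrightarrow> field K \<longrightarrow> carrier K = {..<q} \<longrightarrow> m \<ge> 1 \<longrightarrow> n \<ge> 1 \<longrightarrow>
      finite S \<longrightarrow> S \<subseteq> carrier (GL n (ratfun_field K m)) \<longrightarrow> presents K m n Ds S \<longrightarrow>
      finite (carrier G) \<longrightarrow>
      (\<exists>(r :: nat) (L :: nat ring) (Ts :: nat mat list).
        computes A (input_code q K m n Ds) (output_code (order G) r L Ts) \<and>
        field L \<and> carrier L = {..<r} \<and>
        set Ts \<subseteq> carrier (GL n L) \<and>
        G \<cong> subgroup_generated (GL n L) (set Ts))"
proof -
  define P where "P = (\<lambda>(q, c, m, n, Ds) (r, d, Y, W).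
    certifies (table_ring q (field_data_of c)) m n Ds r (table_ring r d) Y W)"
  define out where "out = (\<lambda>((q :: nat, c :: nat, m :: nat, n, Ds :: ratfun_expr list list list), r, d, Y, W).
    result n r (table_ring r d) Y W)"
  have "decidable (\<lambda>p. P (fst p) (snd p))"
    unfolding P_def case_prod_beta by (intro computable_intros)
  from unbounded_search[OF this] obtain A where
    A: "\<And>x. \<exists>k. P x k \<Longrightarrow> \<exists>k. P x k \<and> computes A [enc x] (enc k)" by blast
  have "computable out"
    unfolding out_def case_prod_beta by (intro computable_intros)
  then obtain B where B: "\<And>p. computes B [enc p] (out p)" by (auto simp: computable_def)
  define input where "input = Comp pair_prog [Proj 0, Comp pair_prog [Proj 1, Comp pair_prog [Proj 2,
    Comp pair_prog [Proj 3, Proj 4]]]]"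
  \<comment> \<open>The output depends on the dimension of the matrices besides the certificate, so both are handed on.\<close>
  define prog where "prog = Comp B [Comp pair_prog [input, Comp A [input]]]"
  have input: "computes input [q, c, m, n, enc Ds] (enc (q, c, m, n, Ds))"
    for q c m n :: nat and Ds :: "ratfun_expr list list list"
  proof -
    let ?xs = "[q, c, m, n, enc Ds]"
    have proj: "computes (Proj 0) ?xs q" "computes (Proj 1) ?xs c" "computes (Proj 2) ?xs m"
      "computes (Proj 3) ?xs n" "computes (Proj 4) ?xs (enc Ds)"
      using computes.Proj[of 0 ?xs] computes.Proj[of 1 ?xs] computes.Proj[of 2 ?xs]
        computes.Proj[of 3 ?xs] computes.Proj[of 4 ?xs] by simp_all
    show ?thesis
      unfolding input_def enc_Pair enc_nat_simp
      by (rule computes_Comp2[OF proj(1) computes_Comp2[OF proj(2) computes_Comp2[OF proj(3)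
        computes_Comp2[OF proj(4,5) computes_pair] computes_pair] computes_pair] computes_pair])
  qed
  show ?thesis
  proof (rule exI[of _ prog], intro allI, unfold Let_def, intro impI)
    fix q m n :: nat and K :: "nat ring" and S :: "nat ratfun mat set" and Ds :: "ratfun_expr mat list"
    let ?F = "ratfun_field K m"
    let ?G = "subgroup_generated (GL n ?F) S"
    assume K: "field K" "carrier K = {..<q}" and GL: "S \<subseteq> carrier (GL n ?F)"
      and pres: "presents K m n Ds S" and fin: "finite (carrier ?G)"
    define K' where "K' = table_ring q (field_data_of (field_code q K))"
    have tab: "tabulated K K'" unfolding K'_def using K by (rule tabulated_field_code)
    interpret T: tabulated K K' by (rule tab)
    interpret F: ring_presentation ?F "ratfun_exprs K m" "ratfun_value K m" "ratfun_add K'"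
      "ratfun_mult K'" "ratfun_const K' m \<zero>\<^bsub>K'\<^esub>" "ratfun_const K' m \<one>\<^bsub>K'\<^esub>" "ratfun_equal K'"
      by (rule T.ring_presentation_ratfun)
    define Es where "Es = map mat_to_list Ds"
    have D: "D \<in> carrier_mat n n" "elements_mat D \<subseteq> ratfun_exprs K m" if "D \<in> set Ds" for D
      using pres that by (auto simp: presents_def)
    have entry: "rows_entry z (mat_to_list D) i j = D $$ (i, j)" if "D \<in> set Ds" "i < n" "j < n" for D z i j
      using D(1)[OF that(1)] that(2,3) by (simp add: rows_entry_def mat_to_list_def)
    have valid: "F.valid_rows n D" if D_Es: "D \<in> set Es" for D
    proof -
      obtain D' where "D' \<in> set Ds" "D = mat_to_list D'" using D_Es by (auto simp: Es_def)
      with D[of D'] show ?thesis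
        by (simp add: F.valid_rows_def entry elements_mat_subset_iff)
    qed
    have val: "F.rows_value n (mat_to_list D) = map_mat (ratfun_value K m) D" if "D \<in> set Ds" for D
      using D(1)[OF that] by (intro eq_matI) (simp_all add: F.rows_value_def entry[OF that])
    have "S = map_mat (ratfun_value K m) ` set Ds" using pres by (simp add: presents_def)
    also have "\<dots> = F.rows_value n ` set Es" by (simp add: Es_def image_image val cong: image_cong)
    finally have S: "S = F.rows_value n ` set Es" .
    have input_eq: "input_code q K m n Ds = [q, field_code q K, m, n, enc Es]"
      by (simp add: input_code_def Es_def enc_list_def[of "map _ _"] ratfun_code_enc mat_code_enc comp_def)
    define x where "x = (q, field_code q K, m, n, Es)"
    have "\<exists>r d Y W. certifies K' m n Es r (table_ring r d) Y W"
      using tab K(1) _ valid S GL fin by (rule certificate_exists) (simp add: K(2))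
    then obtain r d Y W where "certifies K' m n Es r (table_ring r d) Y W" by blast
    then have "P x (r, d, Y, W)" by (simp add: P_def x_def K'_def)
    then obtain k where k: "P x k" "computes A [enc x] (enc k)" using A by blast
    obtain r d Y W where k_eq: "k = (r, d, Y, W)" by (cases k)
    define L where "L = table_ring r d"
    have carr: "carrier L = {..<r}" by (simp add: L_def table_ring_def)
    have "certifies K' m n Es r L Y W" using k(1) by (simp add: P_def x_def K'_def L_def k_eq)
    let ?M = "mat_monoid n ?F" and ?N = "mat_monoid n L"
    let ?f = "\<lambda>x. F.rows_value n (fst x)" and ?g = "\<lambda>x. ring_presentation.rows_value (\<lambda>x. x) \<zero>\<^bsub>L\<^esub> n (snd x)"
    have cert: "field L" "map fst Y = Es" "\<forall>x\<in>set Y. ?g x \<in> carrier ?N" "word_system ?M ?N ?f ?g Y W"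
      using \<open>certifies K' m n Es r L Y W\<close> T.certifies_iff[OF carr valid] by blast+
    interpret L: ring_presentation L "{..<r}" "\<lambda>x. x" "add L" "monoid.mult L" "\<zero>\<^bsub>L\<^esub>" "\<one>\<^bsub>L\<^esub>" "(=)"
      using cert(1) carr by (rule ring_presentation_table)
    have S_image: "S = ?f ` set Y"
      unfolding S cert(2)[symmetric] by (simp add: image_image)
    have unit: "?f x \<in> Units ?M" if "x \<in> set Y" for x
      using GL that by (auto simp: S_image GL_def units_of_carrier)
    have "finite (generate (units_of ?M) (?f ` set Y))"
      using fin GL by (simp add: carrier_subgroup_generated GL_def Int_absorb1 S_image)
    note iso = word_system_iso[OF F.mat_monoid_monoid L.mat_monoid_monoid unit _ this cert(4), folded S_image]
    define Ts where "Ts = map ?g Y"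
    have "computes prog (input_code q K m n Ds) (out (x, k))"
      unfolding prog_def input_eq using input[of q "field_code q K" m n Es] k(2)
      by (auto simp: x_def[symmetric] intro!: computes_Comp1 computes_Comp2 B computes_pair[of "enc x" "enc k", folded enc_Pair])
    also have "out (x, k) = output_code (length W) r L Ts"
    proof -
      have Ts_rows: "list_encode (map (mat_code id) Ts)
          = enc (map (\<lambda>x. rows_of n (\<lambda>i j. rows_entry \<zero>\<^bsub>L\<^esub> (snd x) i j)) Y)"
        by (simp add: Ts_def L.rows_value_def mat_code_id mat_to_list_mat enc_list_def[of "map _ Y"] comp_def)
      have enc_nats: "list_encode xs = enc xs" for xs :: "nat list"
        by (simp add: enc_list_def enc_nat_def[abs_def])
      show ?thesis
        unfolding output_code_def Ts_rows field_code_def table_code_def rows_code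
        unfolding enc_nats
        by (simp add: out_def x_def k_eq result_def L_def)
    qed
    finally have "computes prog (input_code q K m n Ds) (output_code (order ?G) r L Ts)"
      using iso(1) cert(3) by (simp add: GL_def)
    moreover have "set Ts \<subseteq> carrier (GL n L)" "?G \<cong> subgroup_generated (GL n L) (set Ts)"
      using iso(2,3) cert(3) by (simp_all add: GL_def Ts_def)
    ultimately show "\<exists>r L Ts. computes prog (input_code q K m n Ds) (output_code (order ?G) r L Ts) \<and>
        field L \<and> carrier L = {..<r} \<and> set Ts \<subseteq> carrier (GL n L) \<and>
        ?G \<cong> subgroup_generated (GL n L) (set Ts)"
      using cert(1) carr by blast
  qed
qed

end
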